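(* Let $N\in\mathbb{N}_{\ge 1}$. Let $X_0,\dots,X_N$ (state spaces), $U_0,\dots,U_{N-1}$ (input spaces), $R_0,\dots,R_N$ (reference spaces) be Polish spaces, and let $f_k:X_k\times U_k\to X_{k+1}$, $g_k:X_k\times U_k\times R_k\to[0,+\infty]$ ($k=0,\dots,N-1$) and $g_N:X_N\times R_N\to[0,+\infty]$ be Borel maps. Let $J$ be the value of the optimal control problem in probability spaces, $J_k$ the cost-to-go of the dynamic programming algorithm in probability spaces, and $j_k$ the cost-to-go of the dynamic programming algorithm in the ground space, all as defined in the context. Then the following hold. (i) For every $k\in\{0,\dots,N\}$, every $\mu_k\in\mathcal{P}(X_k)$ and all $\rho_i\in\mathcal{P}(R_i)$, $i=k,\dots,N$, $$J_k(\mu_k,\rho_k,\dots,\rho_N)=\mathcal{K}[j_k](\mu_k,\rho_k,\dots,\rho_N)=\inf_{\gamma\in\Gamma(\mu_k,\rho_k,\dots,\rho_N)}\int_{X_k\times R_k\times\cdots\times R_N} j_k(x_k,r_k,\dots,r_N)\,d\gamma(x_k,r_k,\dots,r_N).$$ Moreover, the dynamic programming algorithm yields the optimal value: $J(\mu,\rho_0,\dots,\rho_N)=J_0(\mu,\rho_0,\dots,\rho_N)$ for every $\mu\in\mathcal{P}(X_0)$ and all $\rho_i\in\mathcal{P}(R_i)$, $i=0,\dots,N$. (ii) Let $k\in\{0,\dots,N-1\}$, $\mu_k\in\mathcal{P}(X_k)$, $\rho_i\in\mathcal{P}(R_i)$ for $i=k,\dots,N$, and $\varepsilon\ge 0$.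 Suppose that the Borel map $u_k^{\varepsilon/2}:X_k\times R_k\times\cdots\times R_N\to U_k$ is $\frac{\varepsilon}{2}$-optimal for the ground-space recursion at stage $k$ and that $\gamma_k^{\varepsilon/2}\in\Gamma(\mu_k,\rho_k,\dots,\rho_N)$ is an $\frac{\varepsilon}{2}$-optimal transport plan for $\mathcal{K}[j_k](\mu_k,\rho_k,\dots,\rho_N)$. Then $$\lambda_k^{\varepsilon}=\left(\mathrm{proj}_{X_k},\,u_k^{\varepsilon/2}\right)_{\#}\gamma_k^{\varepsilon/2}\in\mathcal{P}(X_k\times U_k),$$ where $\mathrm{proj}_{X_k}:X_k\times R_k\times\cdots\times R_N\to X_k$ is the projection, is an $\varepsilon$-optimal state-input distribution at stage $k$. If $\varepsilon=0$, then $\lambda_k^\ast:=\lambda_k^{\varepsilon}$ is optimal. (iii) If, in (ii), $\gamma_k^{\varepsilon/2}$ is induced by a transport map $T_k^{\varepsilon/2}:X_k\to R_k\times\cdots\times R_N$, i.e. $\gamma_k^{\varepsilon/2}=(\mathrm{id}_{X_k},T_k^{\varepsilon/2})_{\#}\mu_k$, then the $\varepsilon$-optimal state-input distribution reads $$\lambda_k^{\varepsilon}=\left(\mathrm{id}_{X_k},\,u_k^{\varepsilon/2}\circ(\mathrm{id}_{X_k},T_k^{\varepsilon/2})\right)_{\#}\mu_k .$$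
   Context: Standing assumptions: all spaces are Polish, all probability measures and all maps are Borel. $\mathcal{P}(X)$ is the set of Borel probability measures on $X$; $T_\#\mu$ is the pushforward, $(T_\#\mu)(A)=\mu(T^{-1}(A))$. For maps $h_1,h_2$ with common domain, $(h_1,h_2)(x)=(h_1(x),h_2(x))$. Couplings and (multi-marginal) optimal transport: for probability measures $\mu_i\in\mathcal{P}(S_i)$, $i=1,\dots,m$, $\Gamma(\mu_1,\dots,\mu_m)$ is the set of $\gamma\in\mathcal{P}(S_1\times\cdots\times S_m)$ whose $i$-th marginal is $\mu_i$ for all $i$. For $c:S_1\times\cdots\times S_m\to[0,+\infty]$, $\mathcal{K}[c](\mu_1,\dots,\mu_m)=\inf_{\gamma\in\Gamma(\mu_1,\dots,\mu_m)}\int c\,d\gamma$. A plan $\gamma\in\Gamma(\mu_1,\dots,\mu_m)$ is $\varepsilon$-optimal if $\int c\,d\gamma\le\mathcal{K}[c](\mu_1,\dots,\mu_m)+\varepsilon$. A probability measure $\lambda\in\mathcal{P}(X_k\times U_k)$ is treated as a single marginal on the space $X_k\times U_k$; thus $\mathcal{K}[g_k](\lambda,\rho_k)$ is the infimum of $\int g_k\,d\gamma$ over $\gamma\in\mathcal{P}((X_k\times U_k)\times R_k)$ with marginals $\lambda$ and $\rho_k$. Optimal control problem in probability spaces: for $\mu\in\mathcal{P}(X_0)$ and $\rho_i\in\mathcal{P}(R_i)$, $$J(\mu,\rho_0,\dots,\rho_N)=\inf\ \mathcal{K}[g_N](\mu_N,\rho_N)+\sum_{k=0}^{N-1}\mathcal{K}[g_k](\lambda_k,\rho_k),$$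 the infimum being over $\mu_k\in\mathcal{P}(X_k)$ ($k=0,\dots,N$) and $\lambda_k\in\mathcal{P}(X_k\times U_k)$ ($k=0,\dots,N-1$) subject to $\mu_0=\mu$, $\mu_{k+1}=(f_k)_\#\lambda_k$, and the first marginal (on $X_k$) of $\lambda_k$ being $\mu_k$. Dynamic programming algorithm in probability spaces: $J_N(\mu_N,\rho_N)=\mathcal{K}[g_N](\mu_N,\rho_N)$ and, for $k=N-1,\dots,0$, $$J_k(\mu_k,\rho_k,\dots,\rho_N)=\inf_{\lambda_k}\ \mathcal{K}[g_k](\lambda_k,\rho_k)+J_{k+1}((f_k)_\#\lambda_k,\rho_{k+1},\dots,\rho_N),$$ over $\lambda_k\in\mathcal{P}(X_k\times U_k)$ with $X_k$-marginal $\mu_k$. A state-input distribution $\lambda_k\in\mathcal{P}(X_k\times U_k)$ with $X_k$-marginal $\mu_k$ is $\varepsilon$-optimal (at stage $k$, for $\mu_k,\rho_k,\dots,\rho_N$) if $\mathcal{K}[g_k](\lambda_k,\rho_k)+J_{k+1}((f_k)_\#\lambda_k,\rho_{k+1},\dots,\rho_N)\le J_k(\mu_k,\rho_k,\dots,\rho_N)+\varepsilon$, and optimal if this holds with $\varepsilon=0$. Dynamic programming algorithm in the ground space: $j_N(x_N,r_N)=g_N(x_N,r_N)$ and, for $k=N-1,\dots,0$, $$j_k(x_k,r_k,\dots,r_N)=\inf_{u\in U_k}\ g_k(x_k,u,r_k)+j_{k+1}(f_k(x_k,u),r_{k+1},\dots,r_N).$$ A map $u_k:X_k\times R_k\times\cdots\times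 R_N\to U_k$ is $\varepsilon$-optimal at stage $k$ if, for all $(x_k,r_k,\dots,r_N)$ and with $u=u_k(x_k,r_k,\dots,r_N)$, $g_k(x_k,u,r_k)+j_{k+1}(f_k(x_k,u),r_{k+1},\dots,r_N)\le j_k(x_k,r_k,\dots,r_N)+\varepsilon$. Measurability: the functions $j_k$ need not be Borel but are lower semianalytic, hence universally measurable; integrals of $j_k$ against a Borel probability measure are understood with respect to the completion of that measure. *)

theory Defs
  imports "HOL-Probability.Probability"
begin

section \<open>Polish spaces and Borel probability measures\<close>

text \<open>
  The state, input and reference spaces vary with the stage, so they are given as families of
  abstract topologies on common ambient types. Embedding finitely many Polish spaces into their
  disjoint union shows that this is no restriction on the individual spaces.
\<close>

definition polish_topology :: "'a topology \<Rightarrow> bool" where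
  "polish_topology S \<longleftrightarrow> completely_metrizable_space S \<and> separable_space S"

definition borel_of :: "'a topology \<Rightarrow> 'a measure" where
  "borel_of S = sigma (topspace S) {A. openin S A}"

lemma space_borel_of [simp]: "space (borel_of S) = topspace S"
  unfolding borel_of_def by (rule space_measure_of) (auto dest: openin_subset)

lemma sets_borel_of: "sets (borel_of S) = sigma_sets (topspace S) {A. openin S A}"
  unfolding borel_of_def by (rule sets_measure_of) (auto dest: openin_subset)

lemma borel_of_euclidean: "borel_of euclidean = (borel :: 'a :: topological_space measure)"
  unfolding borel_of_def borel_def by simp

text \<open>
  On products the product \<open>\<sigma>\<close>-algebra is used throughout. For Polish (more generally, second
  countable) factors it is the Borel \<open>\<sigma>\<close>-algebra of the product topology.
\<close>

lemma openin_borel_of: "openin S A \<Longrightarrow> A \<in> sets (borel_of S)"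
  by (simp add: sets_borel_of)

lemma polish_topology_second_countable: "polish_topology S \<Longrightarrow> second_countable S"
proof -
  assume "polish_topology S"
  then obtain M d C where d: "Metric_space M d" and S: "S = Metric_space.mtopology M d"
    and C: "countable C" "C \<subseteq> topspace S" "S closure_of C = topspace S"
    unfolding polish_topology_def completely_metrizable_space_def separable_space_def by auto
  interpret Metric_space M d by (rule d)
  let ?B = "(\<lambda>(c, q). mball c (real_of_rat q)) ` (C \<times> UNIV)"
  have "\<exists>V\<in>?B. x \<in> V \<and> V \<subseteq> U" if U: "openin S U" "x \<in> U" for U x
  proof -
    obtain e where e: "e > 0" "mball x e \<subseteq> U" and x: "x \<in> M"
      using U unfolding S openin_mtopology by blast
    have "x \<in> mtopology closure_of C"
      using x C(3) S by simp
    then obtain c where c: "c \<in> C" "c \<in> mball x (e / 2)"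
      using e(1) unfolding metric_closure_of by (auto dest!: spec[of _ "e / 2"])
    obtain q where q: "d x c < real_of_rat q" "real_of_rat q < e / 2"
      using of_rat_dense[of "d x c" "e / 2"] c(2) by auto
    have "x \<in> mball c (real_of_rat q)"
      using q(1) c(2) x by (simp add: commute)
    moreover have "mball c (real_of_rat q) \<subseteq> mball x e"
      using c(2) q by (intro mball_subset) (auto simp: commute)
    ultimately show ?thesis using c(1) e(2) by blast
  qed
  then have "\<forall>U x. openin S U \<and> x \<in> U \<longrightarrow> (\<exists>V\<in>?B. x \<in> V \<and> V \<subseteq> U)" by meson
  moreover have "countable ?B" using C(1) by simp
  moreover have "\<forall>V\<in>?B. openin S V" by (auto simp: S)
  ultimately show "second_countable S"
    unfolding second_countable_def by (intro exI[of _ ?B] conjI)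
qed

lemma measurable_borel_ofI:
  assumes "\<And>A. openin T A \<Longrightarrow> f -` A \<inter> space M \<in> sets M" "f \<in> space M \<rightarrow> topspace T"
  shows "f \<in> M \<rightarrow>\<^sub>M borel_of T"
  unfolding borel_of_def
  by (rule measurable_measure_of) (use assms in \<open>auto dest: openin_subset\<close>)

lemma continuous_map_borel_measurable:
  assumes "continuous_map S T f"
  shows "f \<in> borel_of S \<rightarrow>\<^sub>M borel_of T"
proof (rule measurable_borel_ofI)
  fix A assume "openin T A"
  then have "openin S {x \<in> topspace S. f x \<in> A}"
    using assms by (simp add: continuous_map)
  moreover have "{x \<in> topspace S. f x \<in> A} = f -` A \<inter> space (borel_of S)" by auto
  ultimately show "f -` A \<inter> space (borel_of S) \<in> sets (borel_of S)"
    by (simp add: openin_borel_of)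
qed (use assms in \<open>auto simp: continuous_map\<close>)

lemma sets_borel_of_prod_topology:
  assumes "second_countable S" "second_countable T"
  shows "sets (borel_of (prod_topology S T)) = sets (borel_of S \<Otimes>\<^sub>M borel_of T)"
proof (rule antisym)
  have *: "id \<in> borel_of (prod_topology S T) \<rightarrow>\<^sub>M borel_of S \<Otimes>\<^sub>M borel_of T"
    by (rule measurable_pair)
      (simp_all add: comp_def continuous_map_borel_measurable continuous_map_fst continuous_map_snd)
  show "sets (borel_of S \<Otimes>\<^sub>M borel_of T) \<subseteq> sets (borel_of (prod_topology S T))"
  proof
    fix A assume A: "A \<in> sets (borel_of S \<Otimes>\<^sub>M borel_of T)"
    have "A \<subseteq> topspace S \<times> topspace T"
      using sets.sets_into_space[OF A] by (simp add: space_pair_measure)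
    then have "id -` A \<inter> space (borel_of (prod_topology S T)) = A" by auto
    then show "A \<in> sets (borel_of (prod_topology S T))"
      using measurable_sets[OF * A] by simp
  qed
next
  obtain \<B> where \<B>: "countable \<B>" "\<And>V. V \<in> \<B> \<Longrightarrow> openin S V"
    "\<And>U x. openin S U \<Longrightarrow> x \<in> U \<Longrightarrow> \<exists>V\<in>\<B>. x \<in> V \<and> V \<subseteq> U"
    using assms(1) unfolding second_countable_def by meson
  obtain \<C> where \<C>: "countable \<C>" "\<And>V. V \<in> \<C> \<Longrightarrow> openin T V"
    "\<And>U x. openin T U \<Longrightarrow> x \<in> U \<Longrightarrow> \<exists>V\<in>\<C>. x \<in> V \<and> V \<subseteq> U"
    using assms(2) unfolding second_countable_def by meson
  have "W \<in> sets (borel_of S \<Otimes>\<^sub>M borel_of T)" if W: "openin (prod_topology S T) W" for W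
  proof -
    let ?D = "{(B, C). B \<in> \<B> \<and> C \<in> \<C> \<and> B \<times> C \<subseteq> W}"
    have W_eq: "W = (\<Union>(B, C)\<in>?D. B \<times> C)"
    proof (intro equalityI subsetI)
      fix z assume "z \<in> W"
      then obtain A B where AB: "openin S A" "openin T B" "fst z \<in> A" "snd z \<in> B" "A \<times> B \<subseteq> W"
        using W unfolding openin_prod_topology_alt by (metis prod.collapse)
      obtain B' where B': "B' \<in> \<B>" "fst z \<in> B'" "B' \<subseteq> A"
        using \<B>(3)[OF AB(1,3)] by blast
      obtain C' where C': "C' \<in> \<C>" "snd z \<in> C'" "C' \<subseteq> B"
        using \<C>(3)[OF AB(2,4)] by blast
      have "(B', C') \<in> ?D" using B' C' AB(5) by blast
      moreover have "z \<in> B' \<times> C'" using B' C' by (simp add: mem_Times_iff)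
      ultimately show "z \<in> (\<Union>(B, C)\<in>?D. B \<times> C)" by blast
    qed auto
    have D: "countable ?D"
      by (rule countable_subset[of _ "\<B> \<times> \<C>"]) (use \<B>(1) \<C>(1) in auto)
    have "(case p of (B, C) \<Rightarrow> B \<times> C) \<in> sets (borel_of S \<Otimes>\<^sub>M borel_of T)"
      if "p \<in> ?D" for p
      using that \<B>(2) \<C>(2) by (auto intro!: pair_measureI openin_borel_of)
    with D show ?thesis
      by (subst W_eq) (rule sets.countable_UN'')
  qed
  then show "sets (borel_of (prod_topology S T)) \<subseteq> sets (borel_of S \<Otimes>\<^sub>M borel_of T)"
    unfolding sets_borel_of[of "prod_topology S T"]
    using sets.sigma_sets_subset[of "{W. openin (prod_topology S T) W}" "borel_of S \<Otimes>\<^sub>M borel_of T"]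
    by (simp add: space_pair_measure subset_iff)
qed

lemma sets_borel_of_product_topology:
  assumes "finite I" "\<And>i. i \<in> I \<Longrightarrow> second_countable (S i)"
  shows "sets (borel_of (product_topology S I)) = sets (Pi\<^sub>M I (\<lambda>i. borel_of (S i)))"
proof (rule antisym)
  have "(\<lambda>z. z) \<in> borel_of (product_topology S I) \<rightarrow>\<^sub>M Pi\<^sub>M I (\<lambda>i. borel_of (S i))"
    by (rule measurable_PiM_single')
      (auto intro!: continuous_map_borel_measurable continuous_map_product_projection)
  from measurable_sets[OF this]
  show "sets (Pi\<^sub>M I (\<lambda>i. borel_of (S i))) \<subseteq> sets (borel_of (product_topology S I))"
    using sets.sets_into_space[of _ "Pi\<^sub>M I (\<lambda>i. borel_of (S i))"]
    by (fastforce simp: space_PiM Int_absorb2)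
next
  have "\<exists>\<B>. countable \<B> \<and> (\<forall>V\<in>\<B>. openin (S i) V) \<and>
      (\<forall>U x. openin (S i) U \<and> x \<in> U \<longrightarrow> (\<exists>V\<in>\<B>. x \<in> V \<and> V \<subseteq> U))" if "i \<in> I" for i
    using assms(2)[OF that] unfolding second_countable_def by meson
  then obtain \<B> where \<B>: "\<And>i. i \<in> I \<Longrightarrow> countable (\<B> i)"
    "\<And>i V. i \<in> I \<Longrightarrow> V \<in> \<B> i \<Longrightarrow> openin (S i) V"
    "\<And>i U x. i \<in> I \<Longrightarrow> openin (S i) U \<Longrightarrow> x \<in> U \<Longrightarrow> \<exists>V\<in>\<B> i. x \<in> V \<and> V \<subseteq> U"
    by metis
  have "W \<in> sets (Pi\<^sub>M I (\<lambda>i. borel_of (S i)))" if W: "openin (product_topology S I) W" for W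
  proof -
    let ?D = "{D \<in> Pi\<^sub>E I \<B>. Pi\<^sub>E I D \<subseteq> W}"
    have "W = (\<Union>D\<in>?D. Pi\<^sub>E I D)"
    proof (intro equalityI subsetI)
      fix z assume z: "z \<in> W"
      then obtain A where A: "\<And>i. i \<in> I \<Longrightarrow> openin (S i) (A i)" "z \<in> Pi\<^sub>E I A" "Pi\<^sub>E I A \<subseteq> W"
        using W unfolding openin_product_topology_alt by meson
      then have "\<forall>i\<in>I. \<exists>V\<in>\<B> i. z i \<in> V \<and> V \<subseteq> A i"
        using \<B>(3) by (meson PiE_mem)
      then obtain D where D: "\<And>i. i \<in> I \<Longrightarrow> D i \<in> \<B> i \<and> z i \<in> D i \<and> D i \<subseteq> A i" by metis
      have "Pi\<^sub>E I (restrict D I) = Pi\<^sub>E I D" by (rule PiE_cong) auto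
      moreover have "Pi\<^sub>E I D \<subseteq> Pi\<^sub>E I A" using D by (intro PiE_mono) auto
      ultimately have "restrict D I \<in> ?D" "z \<in> Pi\<^sub>E I (restrict D I)"
        using D A(2,3) by (auto simp: PiE_iff)
      then show "z \<in> (\<Union>D\<in>?D. Pi\<^sub>E I D)" by blast
    qed auto
    moreover have "countable ?D"
      by (rule countable_subset[of _ "Pi\<^sub>E I \<B>"]) (use \<B>(1) assms(1) in \<open>auto intro: countable_PiE\<close>)
    moreover have "Pi\<^sub>E I D \<in> sets (Pi\<^sub>M I (\<lambda>i. borel_of (S i)))" if "D \<in> ?D" for D
      using that \<B>(2) assms(1) by (intro sets_PiM_I_finite openin_borel_of) auto
    ultimately show ?thesis
      by (metis (no_types, lifting) sets.countable_UN'')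
  qed
  then show "sets (borel_of (product_topology S I)) \<subseteq> sets (Pi\<^sub>M I (\<lambda>i. borel_of (S i)))"
    unfolding sets_borel_of[of "product_topology S I"]
    using sets.sigma_sets_subset[of "{W. openin (product_topology S I) W}" "Pi\<^sub>M I (\<lambda>i. borel_of (S i))"]
    by (simp add: space_PiM subset_iff)
qed


abbreviation prob_measures :: "'a measure \<Rightarrow> 'a measure set" where
  "prob_measures M \<equiv> space (prob_algebra M)"


section \<open>Couplings and optimal transport\<close>

definition couplings :: "'a measure \<Rightarrow> 'b measure \<Rightarrow> ('a \<times> 'b) measure set" where
  "couplings \<mu> \<nu> =
    {\<gamma> \<in> prob_measures (\<mu> \<Otimes>\<^sub>M \<nu>). distr \<gamma> \<mu> fst = \<mu> \<and> distr \<gamma> \<nu> snd = \<nu>}"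

text \<open>
  Plans with one marginal \<open>\<mu>\<close> and marginals \<open>\<rho> i\<close> for \<open>i \<in> I\<close>; only the \<open>\<sigma>\<close>-algebra of
  \<open>\<mu> \<Otimes>\<^sub>M Pi\<^sub>M I \<rho>\<close> matters in the membership condition.
\<close>

definition multi_couplings ::
    "'a measure \<Rightarrow> nat set \<Rightarrow> (nat \<Rightarrow> 'r measure) \<Rightarrow> ('a \<times> (nat \<Rightarrow> 'r)) measure set" where
  "multi_couplings \<mu> I \<rho> =
    {\<gamma> \<in> prob_measures (\<mu> \<Otimes>\<^sub>M Pi\<^sub>M I \<rho>).
      distr \<gamma> \<mu> fst = \<mu> \<and> (\<forall>i\<in>I. distr \<gamma> (\<rho> i) (\<lambda>(x, r). r i) = \<rho> i)}"

text \<open>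
  The ground cost-to-go functions below are in general not Borel but only universally measurable,
  that is, measurable with respect to the completion of every Borel probability measure. For Borel
  costs the completion can be dropped.
\<close>

definition plan_cost :: "('a \<Rightarrow> ennreal) \<Rightarrow> 'a measure \<Rightarrow> ennreal" where
  "plan_cost c \<gamma> = (\<integral>\<^sup>+ z. c z \<partial>completion \<gamma>)"

definition transport_cost :: "('a \<times> 'b \<Rightarrow> ennreal) \<Rightarrow> 'a measure \<Rightarrow> 'b measure \<Rightarrow> ennreal" where
  "transport_cost c \<mu> \<nu> = (INF \<gamma>\<in>couplings \<mu> \<nu>. plan_cost c \<gamma>)"

definition multi_transport_cost ::
    "('a \<times> (nat \<Rightarrow> 'r) \<Rightarrow> ennreal) \<Rightarrow> 'a measure \<Rightarrow> nat set \<Rightarrow> (nat \<Rightarrow> 'r measure) \<Rightarrow> ennreal" where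
  "multi_transport_cost c \<mu> I \<rho> = (INF \<gamma>\<in>multi_couplings \<mu> I \<rho>. plan_cost c \<gamma>)"

definition eps_optimal_plan ::
    "real \<Rightarrow> ('a \<times> (nat \<Rightarrow> 'r) \<Rightarrow> ennreal) \<Rightarrow> 'a measure \<Rightarrow> nat set \<Rightarrow> (nat \<Rightarrow> 'r measure) \<Rightarrow>
      ('a \<times> (nat \<Rightarrow> 'r)) measure \<Rightarrow> bool" where
  "eps_optimal_plan \<epsilon> c \<mu> I \<rho> \<gamma> \<longleftrightarrow>
    \<gamma> \<in> multi_couplings \<mu> I \<rho> \<and> plan_cost c \<gamma> \<le> multi_transport_cost c \<mu> I \<rho> + ennreal \<epsilon>"


section \<open>Optimal control problem in probability spaces\<close>

definition state_input_measures ::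
    "'x topology \<Rightarrow> 'u topology \<Rightarrow> 'x measure \<Rightarrow> ('x \<times> 'u) measure set" where
  "state_input_measures S V \<mu> =
    {\<Lambda> \<in> prob_measures (borel_of S \<Otimes>\<^sub>M borel_of V). distr \<Lambda> (borel_of S) fst = \<mu>}"

definition admissible_trajectories ::
    "nat \<Rightarrow> (nat \<Rightarrow> 'x topology) \<Rightarrow> (nat \<Rightarrow> 'u topology) \<Rightarrow> (nat \<Rightarrow> 'x \<times> 'u \<Rightarrow> 'x) \<Rightarrow>
      'x measure \<Rightarrow> ((nat \<Rightarrow> 'x measure) \<times> (nat \<Rightarrow> ('x \<times> 'u) measure)) set" where
  "admissible_trajectories N X U f \<mu> =
    {(m, l). m 0 = \<mu> \<and>
      (\<forall>k\<le>N. m k \<in> prob_measures (borel_of (X k))) \<and>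
      (\<forall>k<N. l k \<in> state_input_measures (X k) (U k) (m k)) \<and>
      (\<forall>k<N. m (Suc k) = distr (l k) (borel_of (X (Suc k))) (f k))}"

definition control_value ::
    "nat \<Rightarrow> (nat \<Rightarrow> 'x topology) \<Rightarrow> (nat \<Rightarrow> 'u topology) \<Rightarrow> (nat \<Rightarrow> 'x \<times> 'u \<Rightarrow> 'x) \<Rightarrow>
      (nat \<Rightarrow> ('x \<times> 'u) \<times> 'r \<Rightarrow> ennreal) \<Rightarrow> ('x \<times> 'r \<Rightarrow> ennreal) \<Rightarrow>
      'x measure \<Rightarrow> (nat \<Rightarrow> 'r measure) \<Rightarrow> ennreal" where
  "control_value N X U f g gN \<mu> \<rho> =
    (INF (m, l)\<in>admissible_trajectories N X U f \<mu>.
      transport_cost gN (m N) (\<rho> N) + (\<Sum>k<N. transport_cost (g k) (l k) (\<rho> k)))"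


section \<open>Dynamic programming in probability spaces\<close>

text \<open>
  In both backward recursions only the stages \<open>k \<le> N\<close> are meaningful, and the cost-to-go at stage
  \<open>k\<close> depends on the family \<open>\<rho>\<close> (respectively \<open>r\<close>) only through the indices \<open>k, \<dots>, N\<close>.
\<close>

function prob_cost_to_go ::
    "nat \<Rightarrow> (nat \<Rightarrow> 'x topology) \<Rightarrow> (nat \<Rightarrow> 'u topology) \<Rightarrow> (nat \<Rightarrow> 'x \<times> 'u \<Rightarrow> 'x) \<Rightarrow>
      (nat \<Rightarrow> ('x \<times> 'u) \<times> 'r \<Rightarrow> ennreal) \<Rightarrow> ('x \<times> 'r \<Rightarrow> ennreal) \<Rightarrow>
      nat \<Rightarrow> 'x measure \<Rightarrow> (nat \<Rightarrow> 'r measure) \<Rightarrow> ennreal" where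
  "prob_cost_to_go N X U f g gN k \<mu> \<rho> =
    (if k < N then
       (INF \<Lambda>\<in>state_input_measures (X k) (U k) \<mu>.
         transport_cost (g k) \<Lambda> (\<rho> k) +
         prob_cost_to_go N X U f g gN (Suc k) (distr \<Lambda> (borel_of (X (Suc k))) (f k)) \<rho>)
     else transport_cost gN \<mu> (\<rho> N))"
  by pat_completeness auto
termination by (relation "Wellfounded.measure (\<lambda>(N, X, U, f, g, gN, k, \<mu>, \<rho>). N - k)") auto

declare prob_cost_to_go.simps [simp del]

definition eps_optimal_state_input ::
    "real \<Rightarrow> nat \<Rightarrow> (nat \<Rightarrow> 'x topology) \<Rightarrow> (nat \<Rightarrow> 'u topology) \<Rightarrow> (nat \<Rightarrow> 'x \<times> 'u \<Rightarrow> 'x) \<Rightarrow>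
      (nat \<Rightarrow> ('x \<times> 'u) \<times> 'r \<Rightarrow> ennreal) \<Rightarrow> ('x \<times> 'r \<Rightarrow> ennreal) \<Rightarrow>
      nat \<Rightarrow> 'x measure \<Rightarrow> (nat \<Rightarrow> 'r measure) \<Rightarrow> ('x \<times> 'u) measure \<Rightarrow> bool" where
  "eps_optimal_state_input \<epsilon> N X U f g gN k \<mu> \<rho> \<Lambda> \<longleftrightarrow>
    \<Lambda> \<in> state_input_measures (X k) (U k) \<mu> \<and>
    transport_cost (g k) \<Lambda> (\<rho> k) +
      prob_cost_to_go N X U f g gN (Suc k) (distr \<Lambda> (borel_of (X (Suc k))) (f k)) \<rho>
    \<le> prob_cost_to_go N X U f g gN k \<mu> \<rho> + ennreal \<epsilon>"

abbreviation optimal_state_input ::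
    "nat \<Rightarrow> (nat \<Rightarrow> 'x topology) \<Rightarrow> (nat \<Rightarrow> 'u topology) \<Rightarrow> (nat \<Rightarrow> 'x \<times> 'u \<Rightarrow> 'x) \<Rightarrow>
      (nat \<Rightarrow> ('x \<times> 'u) \<times> 'r \<Rightarrow> ennreal) \<Rightarrow> ('x \<times> 'r \<Rightarrow> ennreal) \<Rightarrow>
      nat \<Rightarrow> 'x measure \<Rightarrow> (nat \<Rightarrow> 'r measure) \<Rightarrow> ('x \<times> 'u) measure \<Rightarrow> bool" where
  "optimal_state_input \<equiv> eps_optimal_state_input 0"


section \<open>Dynamic programming in the ground space\<close>

definition ref_space :: "nat \<Rightarrow> (nat \<Rightarrow> 'r topology) \<Rightarrow> nat \<Rightarrow> (nat \<Rightarrow> 'r) measure" where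
  "ref_space N R k = Pi\<^sub>M {k..N} (\<lambda>i. borel_of (R i))"

function ground_cost_to_go ::
    "nat \<Rightarrow> (nat \<Rightarrow> 'u topology) \<Rightarrow> (nat \<Rightarrow> 'x \<times> 'u \<Rightarrow> 'x) \<Rightarrow>
      (nat \<Rightarrow> ('x \<times> 'u) \<times> 'r \<Rightarrow> ennreal) \<Rightarrow> ('x \<times> 'r \<Rightarrow> ennreal) \<Rightarrow>
      nat \<Rightarrow> 'x \<times> (nat \<Rightarrow> 'r) \<Rightarrow> ennreal" where
  "ground_cost_to_go N U f g gN k (x, r) =
    (if k < N then
       (INF u\<in>topspace (U k).
         g k ((x, u), r k) +
         ground_cost_to_go N U f g gN (Suc k) (f k (x, u), restrict r {Suc k..N}))
     else gN (x, r N))"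
  by pat_completeness auto
termination by (relation "Wellfounded.measure (\<lambda>(N, U, f, g, gN, k, z). N - k)") auto

declare ground_cost_to_go.simps [simp del]

definition eps_optimal_input_map ::
    "real \<Rightarrow> nat \<Rightarrow> (nat \<Rightarrow> 'x topology) \<Rightarrow> (nat \<Rightarrow> 'u topology) \<Rightarrow> (nat \<Rightarrow> 'r topology) \<Rightarrow>
      (nat \<Rightarrow> 'x \<times> 'u \<Rightarrow> 'x) \<Rightarrow> (nat \<Rightarrow> ('x \<times> 'u) \<times> 'r \<Rightarrow> ennreal) \<Rightarrow> ('x \<times> 'r \<Rightarrow> ennreal) \<Rightarrow>
      nat \<Rightarrow> ('x \<times> (nat \<Rightarrow> 'r) \<Rightarrow> 'u) \<Rightarrow> bool" where
  "eps_optimal_input_map \<epsilon> N X U R f g gN k u \<longleftrightarrow>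
    (\<forall>x\<in>topspace (X k). \<forall>r\<in>(\<Pi>\<^sub>E i\<in>{k..N}. topspace (R i)).
      u (x, r) \<in> topspace (U k) \<and>
      g k ((x, u (x, r)), r k) +
        ground_cost_to_go N U f g gN (Suc k) (f k (x, u (x, r)), restrict r {Suc k..N})
      \<le> ground_cost_to_go N U f g gN k (x, r) + ennreal \<epsilon>)"

end

theory Submission
  imports Defs
begin

text \<open>
  Unrolling the ground recursion writes \<open>j k (x, r)\<close> as a single infimum, over all remaining inputs
  \<open>u k, \<dots>, u (N - 1)\<close>, of a Borel function: the total cost. Let \<open>L k\<close> be the infimum of the
  integral of the total cost over joint laws of state, inputs and references with the prescribed
  marginals. The theorem follows from two identities.

  First, \<open>L k\<close> is the transport cost of \<open>j k\<close>: inputs that are optimal up to \<open>\<delta>\<close> can be selected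
  measurably with respect to the completion of any given plan. Here Borel sets are projections of
  closed subsets of a product with the Baire space, such projections are universally measurable by
  Choquet's capacitability argument, and the leftmost branch is a selector.

  Second, \<open>L k\<close> satisfies the recursion of the cost-to-go in probability spaces: splitting a joint
  law at stage \<open>k\<close> is immediate, and gluing is possible because a law on a product with a Polish
  factor is the law of \<open>(x, D (x, \<omega>))\<close> with \<open>\<omega>\<close> uniform and independent of \<open>x\<close>.

  Part (ii) follows from (i) because the lower integral is superadditive and does not decrease
  when a function is pulled back along a measure preserving map.
\<close>

section \<open>Borel sets as projections of closed sets\<close>

text \<open>Unrolling answers a measurability obstacle. A selector is measurable only for the
  completion of a given law, and \<open>ground (Suc k)\<close> need not be Borel, so selecting stage
  by stage would mean composing selectors whose null sets depend on the law. With one infimum of a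
  Borel function over all remaining inputs, a single selection suffices, made for the plan at hand.
  The integral of an arbitrary function is the supremum over simple functions below it, and
  completing the measure does not change it; estimates for \<open>ground k\<close> are therefore
  inequalities between lower integrals, each used in the direction that holds for every function.
  Gluing meets a second obstacle, conditional laws on a Polish factor. They are built on bit
  sequences, where a law is determined by countably many prefix probabilities, and carried over by
  the same Baire space coding that reduces selection to closed sets. Empty input spaces are allowed.
  The ground costs up to such a stage are infinite, and this case is split off where a code needs a
  point.\<close>

definition cylinder :: "'a measure \<Rightarrow> ('a \<times> (nat \<Rightarrow> nat)) set \<Rightarrow> bool" where
  "cylinder M C \<longleftrightarrow>
    (\<exists>m. \<forall>z z'. (\<forall>i<m. z i = z' i) \<longrightarrow> (\<forall>y. (y, z) \<in> C \<longleftrightarrow> (y, z') \<in> C)) \<and>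
    (\<forall>z. {y. (y, z) \<in> C} \<in> sets M)"

text \<open>The coordinate \<open>y\<close> carries only a sigma-algebra, so closedness concerns
  \<open>z\<close> alone: the fibre of a cylinder over each \<open>y\<close> is clopen in the Baire
  space, and countable intersections have closed fibres. Measurability in \<open>y\<close> is kept
  for each fixed \<open>z\<close>.\<close>

definition closed_rel :: "'a measure \<Rightarrow> ('a \<times> (nat \<Rightarrow> nat)) set \<Rightarrow> bool" where
  "closed_rel M F \<longleftrightarrow> (\<exists>C. (\<forall>n::nat. cylinder M (C n)) \<and> F = (\<Inter>n. C n))"

text \<open>The even entries of \<open>z\<close> are the point itself, the odd ones the witness to be projected away.\<close>

definition analytic_rel :: "'a measure \<Rightarrow> ('a \<times> (nat \<Rightarrow> nat)) set \<Rightarrow> bool" where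
  "analytic_rel M B \<longleftrightarrow> (\<exists>F. closed_rel M F \<and> B = (\<lambda>(y, z). (y, \<lambda>i. z (2 * i))) ` F)"

lemma cylinderI:
  assumes "\<And>z z' y. (\<And>i. i < m \<Longrightarrow> z i = z' i) \<Longrightarrow> (y, z) \<in> C \<Longrightarrow> (y, z') \<in> C"
    and "\<And>z. {y. (y, z) \<in> C} \<in> sets M"
  shows "cylinder M C"
  unfolding cylinder_def
proof (intro conjI exI[of _ m] allI impI iffI)
  fix z z' :: "nat \<Rightarrow> nat" and y
  assume "\<forall>i<m. z i = z' i"
  then show "(y, z') \<in> C" if "(y, z) \<in> C" using assms(1)[of z z' y] that by simp
  show "(y, z) \<in> C" if "(y, z') \<in> C"
    using assms(1)[of z' z y] that \<open>\<forall>i<m. z i = z' i\<close> by simp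
qed (rule assms(2))

lemma cylinder_imp_closed_rel: "cylinder M C \<Longrightarrow> closed_rel M C"
  unfolding closed_rel_def by (rule exI[of _ "\<lambda>_. C"]) auto

lemma closed_rel_INT:
  assumes "\<And>n::nat. closed_rel M (F n)"
  shows "closed_rel M (\<Inter>n. F n)"
proof -
  obtain C where C: "\<And>n k. cylinder M (C n k)" "\<And>n. F n = (\<Inter>k::nat. C n k)"
    using assms unfolding closed_rel_def by metis
  have "(\<Inter>n. F n) = (\<Inter>j. case prod_decode j of (n, k) \<Rightarrow> C n k)"
    unfolding C(2) by (auto split: prod.split) (metis prod_encode_inverse case_prod_conv)
  then show ?thesis
    unfolding closed_rel_def using C(1)
    by (intro exI[of _ "\<lambda>j. case prod_decode j of (n, k) \<Rightarrow> C n k"]) (auto split: prod.split)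
qed

lemma closed_rel_Int:
  assumes "closed_rel M F" "closed_rel M G"
  shows "closed_rel M (F \<inter> G)"
proof -
  have "F \<inter> G = (\<Inter>n::nat. if n = 0 then F else G)"
    by (auto split: if_splits)
  then show ?thesis using closed_rel_INT[of M "\<lambda>n. if n = 0 then F else G"] assms by simp
qed

lemma closed_rel_space:
  assumes "closed_rel M F" "(y, z) \<in> F"
  shows "y \<in> space M"
proof -
  obtain C where C: "\<And>n::nat. cylinder M (C n)" "F = (\<Inter>n. C n)"
    using assms(1) unfolding closed_rel_def by metis
  have "{y. (y, z) \<in> C 0} \<in> sets M" using C(1) unfolding cylinder_def by auto
  then show ?thesis using sets.sets_into_space assms(2) C(2) by auto
qed

text \<open>Any substitution of coordinates is continuous: the first \<open>m\<close> entries of the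
  substituted sequence read only finitely many entries of \<open>z\<close>, all below one more than
  the largest index read.\<close>

lemma cylinder_reindex:
  assumes "cylinder M C"
  shows "cylinder M {(y, z). (y, \<lambda>i. z (h i)) \<in> C}"
proof -
  obtain m where m: "\<And>z z' y. (\<forall>i<m. z i = z' i) \<Longrightarrow> ((y, z) \<in> C \<longleftrightarrow> (y, z') \<in> C)"
    using assms unfolding cylinder_def by blast
  have "h i < Suc (Max (h ` {..<m}))" if "i < m" for i
    using that by (simp add: le_imp_less_Suc)
  then show ?thesis
    using assms by (intro cylinderI[where m="Suc (Max (h ` {..<m}))"])
      (auto simp: cylinder_def intro: m[THEN iffD1, rotated])
qed

lemma closed_rel_reindex:
  assumes "closed_rel M F"
  shows "closed_rel M {(y, z). (y, \<lambda>i. z (h i)) \<in> F}"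
proof -
  obtain C where C: "\<And>n::nat. cylinder M (C n)" "F = (\<Inter>n. C n)"
    using assms unfolding closed_rel_def by metis
  then show ?thesis
    unfolding closed_rel_def
    by (intro exI[of _ "\<lambda>n. {(y, z). (y, \<lambda>i. z (h i)) \<in> C n}"]) (auto intro: cylinder_reindex)
qed

text \<open>One point has to carry a witness for every \<open>n\<close> at once. The even entries
  are shared, and the odd entries store all witnesses side by side, indexed by
  \<open>prod_encode (n, j)\<close>; the substitution \<open>h n\<close> reads off the
  \<open>n\<close>-th one.\<close>

lemma analytic_rel_INT:
  assumes "\<And>n::nat. analytic_rel M (B n)"
  shows "analytic_rel M (\<Inter>n. B n)"
proof -
  obtain F where F: "\<And>n. closed_rel M (F n)"
    "\<And>n. B n = (\<lambda>(y, z). (y, \<lambda>i. z (2 * i))) ` F n"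
    using assms unfolding analytic_rel_def by metis
  define h where "h n i = (if even i then i else 2 * prod_encode (n, i div 2) + 1)" for n i :: nat
  define G where "G = (\<Inter>n. {(y, z). (y, \<lambda>i. z (h n i)) \<in> F n})"
  have "closed_rel M G"
    unfolding G_def by (intro closed_rel_INT closed_rel_reindex F)
  moreover have "(\<Inter>n. B n) = (\<lambda>(y, z). (y, \<lambda>i. z (2 * i))) ` G"
  proof (intro equalityI subsetI)
    fix p assume p: "p \<in> (\<Inter>n. B n)"
    obtain y v where yv: "p = (y, v)" by force
    have "\<forall>n. \<exists>z. (y, z) \<in> F n \<and> v = (\<lambda>i. z (2 * i))"
      using p F(2) yv by force
    then obtain z where z: "\<And>n. (y, z n) \<in> F n" "\<And>n. v = (\<lambda>i. z n (2 * i))" by metis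
    define w where "w i = (if even i then v (i div 2)
      else case prod_decode (i div 2) of (n, j) \<Rightarrow> z n (2 * j + 1))" for i
    have "(\<lambda>i. w (h n i)) = z n" for n
      by (rule ext) (auto simp: w_def h_def fun_cong[OF z(2)[of n]])
    then have "(y, w) \<in> G" unfolding G_def using z(1) by simp
    moreover have "v = (\<lambda>i. w (2 * i))" by (simp add: w_def)
    ultimately show "p \<in> (\<lambda>(y, z). (y, \<lambda>i. z (2 * i))) ` G"
      unfolding yv by force
  next
    fix p assume "p \<in> (\<lambda>(y, z). (y, \<lambda>i. z (2 * i))) ` G"
    then obtain y z where yz: "p = (y, \<lambda>i. z (2 * i))" "(y, z) \<in> G" by auto
    have "p \<in> B n" for n
      unfolding F(2) yz(1)
      by (rule image_eqI[of _ _ "(y, \<lambda>i. z (h n i))"]) (use yz(2) in \<open>auto simp: h_def G_def\<close>)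
    then show "p \<in> (\<Inter>n. B n)" by simp
  qed
  ultimately show ?thesis unfolding analytic_rel_def by auto
qed

text \<open>The witness has to announce which \<open>B n\<close> contains the point: entry 1 holds
  \<open>n\<close>, and the remaining odd entries, shifted by two to keep parity, hold the witness
  proper.\<close>

lemma analytic_rel_UN:
  assumes "\<And>n::nat. analytic_rel M (B n)"
  shows "analytic_rel M (\<Union>n. B n)"
proof -
  obtain F where F: "\<And>n. closed_rel M (F n)"
    "\<And>n. B n = (\<lambda>(y, z). (y, \<lambda>i. z (2 * i))) ` F n"
    using assms unfolding analytic_rel_def by metis
  obtain C where C: "\<And>n k. cylinder M (C n k)" "\<And>n. F n = (\<Inter>k::nat. C n k)"
    using F(1) unfolding closed_rel_def by metis
  define h where "h i = (if even i then i else i + 2)" for i :: nat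
  \<comment> \<open>The implication switches the constraint off unless \<open>n\<close> is the
    announced index, so intersecting over all \<open>n\<close> produces a disjoint sum. The clause
    \<open>y \<in> space M\<close> keeps the section measurable where the constraint is off.\<close>
  define D where "D n k = {(y, z). y \<in> space M \<and> (z (1::nat) = n \<longrightarrow> (y, \<lambda>i. z (h i)) \<in> C n k)}" for n k
  define G where "G = (\<Inter>n. \<Inter>k. D n k)"
  have "cylinder M (D n k)" for n k
  proof -
    have *: "cylinder M {(y, z). (y, \<lambda>i. z (h i)) \<in> C n k}"
      by (intro cylinder_reindex C)
    then obtain m where m: "\<And>z z' y. (\<forall>i<m. z i = z' i) \<Longrightarrow>
        ((y, \<lambda>i. z (h i)) \<in> C n k \<longleftrightarrow> (y, \<lambda>i. z' (h i)) \<in> C n k)"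
      unfolding cylinder_def mem_Collect_eq case_prod_conv by blast
    show ?thesis
    proof (rule cylinderI[where m="max m 2"])
      fix z z' y assume z: "\<And>i. i < max m 2 \<Longrightarrow> z i = z' i" and "(y, z) \<in> D n k"
      moreover have "(y, \<lambda>i. z (h i)) \<in> C n k \<longleftrightarrow> (y, \<lambda>i. z' (h i)) \<in> C n k"
        using z by (intro m) auto
      moreover have "z 1 = z' 1" using z by auto
      ultimately show "(y, z') \<in> D n k" unfolding D_def by auto
    next
      fix z
      have "{y. (y, z) \<in> D n k} = (if z 1 = n then {y. (y, \<lambda>i. z (h i)) \<in> C n k} else space M)"
        using C(1)[of n k] sets.sets_into_space unfolding D_def cylinder_def by auto
      also have "\<dots> \<in> sets M" using * unfolding cylinder_def by auto
      finally show "{y. (y, z) \<in> D n k} \<in> sets M" .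
    qed
  qed
  then have "closed_rel M G"
    unfolding G_def by (intro closed_rel_INT cylinder_imp_closed_rel)
  moreover have "(\<Union>n. B n) = (\<lambda>(y, z). (y, \<lambda>i. z (2 * i))) ` G"
  proof (intro equalityI subsetI)
    fix p assume "p \<in> (\<Union>n. B n)"
    then obtain n y z where z: "(y, z) \<in> F n" "p = (y, \<lambda>i. z (2 * i))" unfolding F(2) by auto
    define w where "w i = (if even i then z i else if i = 1 then n else z (i - 2))" for i
    have "(\<lambda>i. w (h i)) = z" by (rule ext) (auto simp: w_def h_def)
    then have "(y, w) \<in> G"
      using z(1) closed_rel_space[OF F(1) z(1)] unfolding G_def D_def C(2) by (auto simp: w_def)
    moreover have "p = (y, \<lambda>i. w (2 * i))" by (simp add: w_def z)
    ultimately show "p \<in> (\<lambda>(y, z). (y, \<lambda>i. z (2 * i))) ` G" by force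
  next
    fix p assume "p \<in> (\<lambda>(y, z). (y, \<lambda>i. z (2 * i))) ` G"
    then obtain y z where yz: "p = (y, \<lambda>i. z (2 * i))" "(y, z) \<in> G" by auto
    have "(y, \<lambda>i. z (h i)) \<in> F (z 1)" using yz(2) unfolding G_def D_def C(2) by auto
    then have "p \<in> B (z 1)"
      unfolding F(2) yz(1)
      by (intro image_eqI[of _ _ "(y, \<lambda>i. z (h i))"]) (auto simp: h_def)
    then show "p \<in> (\<Union>n. B n)" by auto
  qed
  ultimately show ?thesis unfolding analytic_rel_def by auto
qed

lemma analytic_rel_cylinder:
  assumes "cylinder M C"
  shows "analytic_rel M C"
proof -
  have "C = (\<lambda>(y, z). (y, \<lambda>i. z (2 * i))) ` {(y, z). (y, \<lambda>i. z (2 * i)) \<in> C}"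
  proof (intro equalityI subsetI)
    fix p assume p: "p \<in> C"
    obtain y v where yv: "p = (y, v)" by force
    then show "p \<in> (\<lambda>(y, z). (y, \<lambda>i. z (2 * i))) ` {(y, z). (y, \<lambda>i. z (2 * i)) \<in> C}"
      using p by (intro image_eqI[of _ _ "(y, \<lambda>i. v (i div 2))"]) auto
  qed auto
  then show ?thesis
    unfolding analytic_rel_def using cylinder_imp_closed_rel[OF cylinder_reindex[OF assms, of "\<lambda>i. 2 * i"]]
    by blast
qed

text \<open>Complements of analytic sets need not be analytic, so the sigma-algebra argument runs
  over sets that are analytic together with their complement: complementation becomes trivial, and a
  countable union costs one union and one intersection. The generators are cylinders whose
  complements are cylinders.\<close>

lemma borel_imp_analytic_rel:
  assumes "B \<in> sets (M \<Otimes>\<^sub>M (borel :: (nat \<Rightarrow> nat) measure))"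
  shows "analytic_rel M B"
proof -
  let ?\<Omega> = "space M \<times> (UNIV :: (nat \<Rightarrow> nat) set)"
  define \<D> where "\<D> = {B. B \<subseteq> ?\<Omega> \<and> analytic_rel M B \<and> analytic_rel M (?\<Omega> - B)}"
  have cyl: "C \<in> \<D>" if "cylinder M C" "cylinder M (?\<Omega> - C)" for C
  proof -
    have "C \<subseteq> ?\<Omega>"
      using that(1) sets.sets_into_space unfolding cylinder_def by fastforce
    then show ?thesis using that analytic_rel_cylinder unfolding \<D>_def by auto
  qed
  have sa: "sigma_algebra ?\<Omega> \<D>"
    unfolding sigma_algebra_iff2
  proof (intro conjI ballI allI impI)
    show "\<D> \<subseteq> Pow ?\<Omega>" by (auto simp: \<D>_def)
    have "cylinder M {}" "cylinder M ?\<Omega>" by (auto intro!: cylinderI)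
    then show "{} \<in> \<D>" by (intro cyl) auto
    show "?\<Omega> - B \<in> \<D>" if "B \<in> \<D>" for B
      using that by (auto simp: \<D>_def Diff_Diff_Int Int_absorb1)
    show "(\<Union>i. A i) \<in> \<D>" if A: "range A \<subseteq> \<D>" for A :: "nat \<Rightarrow> _"
    proof -
      have "?\<Omega> - (\<Union>i. A i) = (\<Inter>i. ?\<Omega> - A i)" by auto
      moreover have "A i \<in> \<D>" for i using A by auto
      ultimately show ?thesis by (auto simp: \<D>_def intro!: analytic_rel_UN analytic_rel_INT simp del: INT_simps)
    qed
  qed
  define K where "K = sigma ?\<Omega> \<D>"
  have sets_K: "sets K = \<D>"
    unfolding K_def using sigma_algebra.sigma_sets_eq[OF sa]
    by (subst sets_measure_of) (auto simp: \<D>_def)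
  have space_K: "space K = ?\<Omega>" unfolding K_def by (rule space_measure_of) (auto simp: \<D>_def)
  have "fst \<in> K \<rightarrow>\<^sub>M M"
  proof (rule measurableI)
    fix A assume A: "A \<in> sets M"
    have "A \<times> UNIV \<in> \<D>"
    proof (rule cyl)
      show "cylinder M (A \<times> UNIV)" using A by (auto intro!: cylinderI)
      have "?\<Omega> - A \<times> UNIV = (space M - A) \<times> UNIV" by auto
      then show "cylinder M (?\<Omega> - A \<times> UNIV)" using A by (auto intro!: cylinderI)
    qed
    moreover have "fst -` A \<inter> space K = A \<times> UNIV"
      using sets.sets_into_space[OF A] by (auto simp: space_K)
    ultimately show "fst -` A \<inter> space K \<in> sets K" by (simp add: sets_K)
  qed (auto simp: space_K)
  moreover have "snd \<in> K \<rightarrow>\<^sub>M (borel :: (nat \<Rightarrow> nat) measure)"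
  proof (rule measurable_coordinatewise_then_product)
    fix i
    show "(\<lambda>p. snd p i) \<in> K \<rightarrow>\<^sub>M borel"
      unfolding measurable_def
    proof (intro CollectI conjI ballI)
      fix S :: "nat set"
      have "{p \<in> ?\<Omega>. snd p i \<in> S} \<in> \<D>"
      proof (rule cyl)
        show "cylinder M {p \<in> ?\<Omega>. snd p i \<in> S}" 
          by (rule cylinderI[where m="Suc i"]) auto
        have "?\<Omega> - {p \<in> ?\<Omega>. snd p i \<in> S} = {p \<in> ?\<Omega>. snd p i \<notin> S}" by auto
        also have "cylinder M \<dots>" by (rule cylinderI[where m="Suc i"]) auto
        finally show "cylinder M (?\<Omega> - {p \<in> ?\<Omega>. snd p i \<in> S})" .
      qed
      moreover have "(\<lambda>p. snd p i) -` S \<inter> space K = {p \<in> ?\<Omega>. snd p i \<in> S}"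
        by (auto simp: space_K)
      ultimately show "(\<lambda>p. snd p i) -` S \<inter> space K \<in> sets K" by (simp add: sets_K)
    qed auto
  qed
  ultimately have "(\<lambda>p. (fst p, snd p)) \<in> K \<rightarrow>\<^sub>M M \<Otimes>\<^sub>M borel" by (rule measurable_Pair)
  from measurable_sets[OF this assms] have "B \<inter> space K \<in> sets K" by (simp add: vimage_def)
  moreover have "B \<subseteq> space K"
    using sets.sets_into_space[OF assms] by (simp add: space_K space_pair_measure)
  ultimately have "B \<in> \<D>" by (simp add: Int_absorb2 sets_K)
  then show ?thesis by (simp add: \<D>_def)
qed


section \<open>Capacitability and leftmost branches\<close>

text \<open>A measurable hull \<open>E\<close> has the outer measure of \<open>A\<close>. Measurable
  subsets of \<open>A\<close> approach this value, so a countable union of them differs from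
  \<open>E\<close> by a null set, and \<open>A\<close> lies between the two.\<close>

lemma sets_completion_inner_approx:
  assumes "finite_measure M" "A \<subseteq> space M"
    and inner: "\<And>c. c < outer_measure_of M A \<Longrightarrow> \<exists>H\<in>sets M. H \<subseteq> A \<and> c \<le> emeasure M H"
  shows "A \<in> sets (completion M)"
proof -
  interpret finite_measure M by fact
  obtain E where E: "E \<in> sets M" "A \<subseteq> E" "outer_measure_of M A = emeasure M E"
    using outer_measure_of_attain[OF assms(2)] by auto
  show ?thesis
  proof (cases "emeasure M E = 0")
    case True
    then show ?thesis using E by (intro sets_completionI[of A "{}" A E]) (auto simp: null_sets_def)
  next
    case False
    \<comment> \<open>Values strictly below the measure of the hull exist only if that measure is
      positive, hence the separate null case.\<close>
    define c where "c n = emeasure M E - ennreal (1 / Suc n)" for n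
    have "c n < emeasure M E" for n
      unfolding c_def using False by (intro ennreal_between) (auto simp: zero_less_iff_neq_zero less_top[symmetric])
    then have "\<forall>n. \<exists>H\<in>sets M. H \<subseteq> A \<and> c n \<le> emeasure M H"
      using inner E(3) by simp
    then obtain H where H: "\<And>n. H n \<in> sets M" "\<And>n. H n \<subseteq> A" "\<And>n. c n \<le> emeasure M (H n)"
      by metis
    let ?H = "\<Union>n. H n"
    have "emeasure M E \<le> emeasure M ?H"
    proof (rule ennreal_le_epsilon)
      fix e :: real assume "0 < e"
      then obtain n where n: "1 / Suc n < e" using nat_approx_posE by blast
      have "emeasure M E \<le> c n + ennreal (1 / Suc n)"
        unfolding c_def by (simp add: ennreal_minus_le_iff diff_add_self_ennreal) (metis nle_le)
      also have "\<dots> \<le> emeasure M ?H + ennreal e"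
        using n H by (intro add_mono order_trans[OF H(3)] emeasure_mono ennreal_leI) auto
      finally show "emeasure M E \<le> emeasure M ?H + ennreal e" .
    qed
    then have "emeasure M (E - ?H) = 0"
      using H E by (subst emeasure_Diff) (auto intro!: UN_least order_trans[OF H(2)] simp: diff_eq_0_iff_ennreal less_top[symmetric])
    then have "E - ?H \<in> null_sets M" using H E by auto
    moreover have "A = ?H \<union> (A - ?H)" using H by auto
    moreover have "A - ?H \<subseteq> E - ?H" using E by auto
    ultimately show ?thesis using H
      by (intro sets_completionI[of A "?H" "A - ?H" "E - ?H"]) auto
  qed
qed

text \<open>Koenig's lemma. If no extension of a prefix compatible with all levels were again
  compatible with all levels, then, only finitely many next entries being admissible, a single level
  would rule them all out. The conclusion speaks of prefixes of \<open>s\<close>; passing to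
  \<open>s\<close> itself is left to closedness at the place of use.\<close>

lemma bounded_branch:
  fixes Q :: "nat \<Rightarrow> (nat \<Rightarrow> nat) \<Rightarrow> bool"
  assumes anti: "\<And>k z. Q (Suc k) z \<Longrightarrow> Q k z"
    and bdd: "\<And>k z i. Q k z \<Longrightarrow> i < k \<Longrightarrow> z i \<le> b i"
    and ex: "\<And>k. \<exists>z. Q k z"
  shows "\<exists>s. \<forall>n k. \<exists>z. (\<forall>i<n. z i = s i) \<and> Q k z"
proof -
  have anti': "Q k z" if "Q l z" "k \<le> l" for k l z
    using that(2,1) by (induction rule: dec_induct) (auto intro: anti)
  define P where "P t \<longleftrightarrow> (\<forall>k. \<exists>z. (\<forall>i<length t. z i = t ! i) \<and> Q k z)" for t
  have step: "\<exists>m. P (t @ [m])" if t: "P t" for t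
  proof (rule ccontr)
    assume "\<not> ?thesis"
    then have "\<forall>m. \<exists>k. \<forall>z. (\<forall>i<length (t @ [m]). z i = (t @ [m]) ! i) \<longrightarrow> \<not> Q k z"
      unfolding P_def by blast
    then obtain k where k: "\<And>m z. (\<forall>i<length (t @ [m]). z i = (t @ [m]) ! i) \<Longrightarrow> \<not> Q (k m) z"
      by metis
    \<comment> \<open>The first argument makes the bound on entry \<open>length t\<close> available;
      the second lies beyond every level at which an admissible extension fails.\<close>
    define K where "K = max (Suc (length t)) (Max (k ` {..b (length t)}))"
    obtain z where z: "\<forall>i<length t. z i = t ! i" "Q K z" using t unfolding P_def by blast
    have "z (length t) \<le> b (length t)" using z(2) by (rule bdd) (simp add: K_def)
    then have "k (z (length t)) \<le> K" unfolding K_def by (intro max.coboundedI2 Max_ge) auto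
    then have "Q (k (z (length t))) z" using z(2) anti' by blast
    moreover have "\<forall>i<length (t @ [z (length t)]). z i = (t @ [z (length t)]) ! i"
      using z(1) by (auto simp: nth_append less_Suc_eq)
    ultimately show False using k by blast
  qed
  have "\<exists>p. \<forall>n. (P (p n) \<and> length (p n) = n) \<and> (\<exists>m. p (Suc n) = p n @ [m])"
  proof (rule dependent_nat_choice)
    show "\<exists>x. P x \<and> length x = 0" using ex by (auto simp: P_def)
  next
    fix t n assume "P t \<and> length t = n"
    then show "\<exists>t'. (P t' \<and> length t' = Suc n) \<and> (\<exists>m. t' = t @ [m])"
    proof -
      obtain m where "P (t @ [m])" using step \<open>P t \<and> length t = n\<close> by blast
      then show ?thesis using \<open>P t \<and> length t = n\<close> by (intro exI[of _ "t @ [m]"]) simp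
    qed
  qed
  then obtain p where p: "\<And>n. P (p n)" "\<And>n. length (p n) = n" "\<And>n. \<exists>m. p (Suc n) = p n @ [m]"
    by metis
  define s where "s i = p (Suc i) ! i" for i
  have nth: "p n ! i = s i" if "i < n" for i n
    using that
  proof (induction n)
    case (Suc n)
    then show ?case using p(3)[of n] p(2)[of n] by (cases "i = n") (auto simp: s_def nth_append)
  qed simp
  show ?thesis
    using p(1) unfolding P_def by (intro exI[of _ s]) (auto simp: p(2) nth)
qed

text \<open>
  Capacitability: cutting the branches to a box \<open>z i \<le> b i\<close> loses arbitrarily little outer
  measure, and the projection of the part in a box is a decreasing limit of finite unions.
\<close>

lemma closed_rel_Domain_completion:
  assumes fin: "finite_measure M" and F: "closed_rel M F"
  shows "fst ` F \<in> sets (completion M)"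
proof (rule sets_completion_inner_approx[OF fin])
  interpret finite_measure M by fact
  show sub: "fst ` F \<subseteq> space M" using closed_rel_space[OF F] by auto
  obtain C where C: "\<And>n::nat. cylinder M (C n)" "F = (\<Inter>n. C n)"
    using F unfolding closed_rel_def by metis
  obtain l where l: "\<And>n z z' y. (\<forall>i<l n. z i = z' i) \<Longrightarrow> ((y, z) \<in> C n \<longleftrightarrow> (y, z') \<in> C n)"
    using C(1) unfolding cylinder_def by metis
  fix c assume c: "c < outer_measure_of M (fst ` F)"
  \<comment> \<open>Entries beyond \<open>length p\<close> are free, so letting the last side of the
    box grow exhausts the previous set, and outer measure is continuous along this increase.\<close>
  define E where "E p = {y. \<exists>z. (\<forall>i<length p. z i \<le> p ! i) \<and> (y, z) \<in> F}" for p
  have E_sub: "E p \<subseteq> space M" for p using sub by (force simp: E_def)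
  have step: "\<exists>m. c < outer_measure_of M (E (p @ [m]))" if p: "c < outer_measure_of M (E p)" for p
  proof -
    have "E p = (\<Union>m. E (p @ [m]))"
    proof (intro equalityI subsetI)
      fix y assume "y \<in> E p"
      then obtain z where z: "\<forall>i<length p. z i \<le> p ! i" "(y, z) \<in> F" unfolding E_def by auto
      then have "y \<in> E (p @ [z (length p)])"
        unfolding E_def by (auto simp: nth_append less_Suc_eq intro!: exI[of _ z])
      then show "y \<in> (\<Union>m. E (p @ [m]))" by auto
    next
      fix y assume "y \<in> (\<Union>m. E (p @ [m]))"
      then obtain m z where "\<forall>i<Suc (length p). z i \<le> (p @ [m]) ! i" "(y, z) \<in> F"
        unfolding E_def by auto
      then show "y \<in> E p"
        unfolding E_def by (intro CollectI exI[of _ z]) (metis less_SucI nth_append)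
    qed
    moreover have "incseq (\<lambda>m. E (p @ [m]))"
    proof (rule incseq_SucI, rule subsetI)
      fix m y assume "y \<in> E (p @ [m])"
      then obtain z where z: "\<forall>i<Suc (length p). z i \<le> (p @ [m]) ! i" "(y, z) \<in> F"
        unfolding E_def by auto
      have "z i \<le> (p @ [Suc m]) ! i" if "i < Suc (length p)" for i
        using z(1)[rule_format, OF that] that by (auto simp: nth_append split: if_splits)
      then show "y \<in> E (p @ [Suc m])" unfolding E_def using z(2) by auto
    qed
    ultimately have "(SUP m. outer_measure_of M (E (p @ [m]))) = outer_measure_of M (E p)"
      using SUP_outer_measure_of_incseq[of "\<lambda>m. E (p @ [m])" M] E_sub by auto
    with p have "c < (SUP m. outer_measure_of M (E (p @ [m])))" by simp
    then show ?thesis by (simp only: less_SUP_iff) blast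
  qed
  have "\<exists>p. \<forall>n. (c < outer_measure_of M (E (p n)) \<and> length (p n) = n) \<and> (\<exists>m. p (Suc n) = p n @ [m])"
  proof (rule dependent_nat_choice)
    have "E [] = fst ` F" by (force simp: E_def)
    then show "\<exists>x. c < outer_measure_of M (E x) \<and> length x = 0" using c by auto
  next
    fix t n assume t: "c < outer_measure_of M (E t) \<and> length t = n"
    then obtain m where "c < outer_measure_of M (E (t @ [m]))" using step by blast
    then show "\<exists>t'. (c < outer_measure_of M (E t') \<and> length t' = Suc n) \<and> (\<exists>m. t' = t @ [m])"
      using t by (intro exI[of _ "t @ [m]"]) simp
  qed
  then obtain p where p: "\<And>n. c < outer_measure_of M (E (p n))" "\<And>n. length (p n) = n"
      "\<And>n. \<exists>m. p (Suc n) = p n @ [m]"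
    by metis
  define b where "b i = p (Suc i) ! i" for i
  have nth: "p n ! i = b i" if "i < n" for i n
    using that
  proof (induction n)
    case (Suc n)
    then show ?case using p(3)[of n] p(2)[of n] by (cases "i = n") (auto simp: b_def nth_append)
  qed simp
  \<comment> \<open>Level \<open>k\<close> imposes only those constraints \<open>C j\<close> that
    the first \<open>k\<close> entries of a branch decide. Truncating a branch after
    \<open>k\<close> entries thus keeps its status, and finitely many truncated branches in the box
    suffice.\<close>
  define Q where "Q y k z \<longleftrightarrow> (\<forall>i<k. z i \<le> b i) \<and> (\<forall>j<k. l j \<le> k \<longrightarrow> (y, z) \<in> C j)"
    for y k and z :: "nat \<Rightarrow> nat"
  define Q' where "Q' y k z \<longleftrightarrow> (\<forall>j\<le>k. Q y j z)" for y k z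
  define H where "H k = {y \<in> space M. \<exists>z. Q' y k z}" for k
  have Q'_cong: "Q' y k z \<longleftrightarrow> Q' y k z'" if "\<forall>i<k. z i = z' i" for y k z z'
  proof -
    have "(y, z) \<in> C j \<longleftrightarrow> (y, z') \<in> C j" if "l j \<le> k" for j
      using that \<open>\<forall>i<k. z i = z' i\<close> by (intro l) auto
    then show ?thesis
      unfolding Q'_def Q_def using that by auto
  qed
  have H_sets: "H k \<in> sets M" for k
  proof -
    define Z where "Z = {z. (\<forall>i<k. z i \<le> b i) \<and> (\<forall>i. i \<ge> k \<longrightarrow> z i = 0)}"
    have "Z \<subseteq> (\<lambda>g i. if i < k then g i else 0) ` (\<Pi>\<^sub>E i\<in>{..<k}. {..b i})"
    proof
      fix z assume "z \<in> Z"
      then show "z \<in> (\<lambda>g i. if i < k then g i else 0) ` (\<Pi>\<^sub>E i\<in>{..<k}. {..b i})"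
        by (intro image_eqI[of _ _ "restrict z {..<k}"]) (auto simp: Z_def)
    qed
    then have "finite Z" by (rule finite_subset) (auto intro!: finite_PiE)
    have "H k = (\<Union>z\<in>Z. {y \<in> space M. Q' y k z})"
    proof (intro equalityI subsetI)
      fix y assume "y \<in> H k"
      then obtain z where y: "y \<in> space M" and z: "Q' y k z" unfolding H_def by auto
      have "Q' y k (\<lambda>i. if i < k then z i else 0)" using z by (subst Q'_cong[of _ _ z]) auto
      moreover have "(\<lambda>i. if i < k then z i else 0) \<in> Z"
        using z unfolding Z_def Q'_def Q_def by auto
      ultimately show "y \<in> (\<Union>z\<in>Z. {y \<in> space M. Q' y k z})" using y by auto
    qed (auto simp: H_def)
    moreover have "{y \<in> space M. Q' y k z} \<in> sets M" for z
    proof -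
      have [measurable]: "Measurable.pred M (\<lambda>y. (y, z) \<in> C j)" for j
      proof -
        have "{y. (y, z) \<in> C j} \<in> sets M" using C(1) unfolding cylinder_def by auto
        moreover from this have "{y \<in> space M. (y, z) \<in> C j} = {y. (y, z) \<in> C j}"
          using sets.sets_into_space by auto
        ultimately show ?thesis by (simp add: pred_def)
      qed
      show ?thesis unfolding Q'_def Q_def by measurable
    qed
    ultimately show ?thesis using \<open>finite Z\<close> by auto
  qed
  have Q'_anti: "Q' y (Suc k) z \<Longrightarrow> Q' y k z" for y k z unfolding Q'_def by auto
  have "c \<le> emeasure M (\<Inter>k. H k)"
  proof -
    have "decseq H" by (rule decseq_SucI) (auto simp: H_def intro: Q'_anti)
    then have "emeasure M (\<Inter>k. H k) = (INF k. emeasure M (H k))"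
      using H_sets by (intro INF_emeasure_decseq[symmetric]) auto
    also have "c \<le> \<dots>"
    proof (rule INF_greatest)
      fix k
      \<comment> \<open>The sets \<open>E (p k)\<close> need not be measurable, but each lies in the
        measurable set \<open>H k\<close>; the bound \<open>c\<close> passes to \<open>H k\<close>,
        and to the limit because the measure is finite.\<close>
      have "E (p k) \<subseteq> H k"
      proof
        fix y assume y: "y \<in> E (p k)"
        then obtain z where "\<forall>i<k. z i \<le> b i" "(y, z) \<in> F" unfolding E_def by (auto simp: p(2) nth)
        then have "Q' y k z" unfolding Q'_def Q_def C(2) by auto
        then show "y \<in> H k" unfolding H_def using E_sub[of "p k"] y by auto
      qed
      then have "outer_measure_of M (E (p k)) \<le> emeasure M (H k)"
        using H_sets by (metis outer_measure_of_eq outer_measure_of_mono)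
      then show "c \<le> emeasure M (H k)" using p(1)[of k] by auto
    qed
    finally show ?thesis .
  qed
  moreover have "(\<Inter>k. H k) \<subseteq> fst ` F"
  proof
    fix y assume y: "y \<in> (\<Inter>k. H k)"
    have "\<exists>s. \<forall>n k. \<exists>z. (\<forall>i<n. z i = s i) \<and> Q' y k z"
    proof (rule bounded_branch[where b=b])
      show "z i \<le> b i" if "Q' y k z" "i < k" for k z i
        using that unfolding Q'_def Q_def by auto
      show "\<exists>z. Q' y k z" for k using y by (auto simp: H_def)
    qed (rule Q'_anti)
    then obtain s where s: "\<And>n k. \<exists>z. (\<forall>i<n. z i = s i) \<and> Q' y k z" by blast
    have "(y, s) \<in> C j" for j
    proof -
      \<comment> \<open>The least level at which \<open>C j\<close> is among the imposed
        constraints.\<close>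
      let ?k = "max (Suc j) (l j)"
      obtain z where z: "\<forall>i<l j. z i = s i" "Q' y ?k z" using s by blast
      then have "(y, z) \<in> C j" unfolding Q'_def Q_def by (metis le_refl less_max_iff_disj lessI max.cobounded2)
      then show ?thesis using l z(1) by blast
    qed
    then have "(y, s) \<in> F" unfolding C(2) by auto
    then show "y \<in> fst ` F" by force
  qed
  ultimately show "\<exists>H\<in>sets M. H \<subseteq> fst ` F \<and> c \<le> emeasure M H"
    using H_sets by (intro bexI[of _ "\<Inter>k. H k"]) auto
qed

text \<open>Taking at each position the least entry that keeps the branch extendable inside
  \<open>F\<close> yields a branch all of whose prefixes extend into \<open>F\<close>; closedness of
  the fibre puts the branch itself in \<open>F\<close>. Extendability of a prefix is a projection,
  hence the completion in the conclusion.\<close>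

lemma closed_rel_selection:
  assumes fin: "finite_measure M" and F: "closed_rel M F"
  shows "\<exists>s \<in> completion M \<rightarrow>\<^sub>M borel. \<forall>y\<in>fst ` F. (y, s y) \<in> F"
proof -
  define D where "D t y \<longleftrightarrow> (\<exists>z. (y, z) \<in> F \<and> (\<forall>i<length t. z i = t ! i))" for t y
  define ext where "ext t y = t @ [LEAST m. D (t @ [m]) y]" for t y
  define pre where "pre y n = ((\<lambda>t. ext t y) ^^ n) []" for y n
  have pre_simps: "pre y 0 = []" "pre y (Suc n) = ext (pre y n) y" for y n
    by (simp_all add: pre_def)
  have len: "length (pre y n) = n" for y n
    by (induction n) (simp_all add: pre_simps ext_def)
  have D_meas [measurable]: "Measurable.pred (completion M) (D t)" for t
  proof -
    have "cylinder M {(y, z). y \<in> space M \<and> (\<forall>i<length t. z i = t ! i)}"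
      by (rule cylinderI[where m="length t"]) auto
    then have "fst ` (F \<inter> {(y, z). y \<in> space M \<and> (\<forall>i<length t. z i = t ! i)}) \<in> sets (completion M)"
      by (intro closed_rel_Domain_completion fin closed_rel_Int F cylinder_imp_closed_rel)
    also have "fst ` (F \<inter> {(y, z). y \<in> space M \<and> (\<forall>i<length t. z i = t ! i)}) =
        {y \<in> space (completion M). D t y}"
      using closed_rel_space[OF F] by (force simp: D_def)
    finally show ?thesis by (simp add: pred_def)
  qed
  have pre_meas [measurable]: "(\<lambda>y. pre y n) \<in> completion M \<rightarrow>\<^sub>M count_space UNIV" for n
  proof (induction n)
    case (Suc n)
    note Suc [measurable]
    show ?case unfolding pre_simps ext_def by measurable
  qed (simp add: pre_simps)
  define s where "s y i = pre y (Suc i) ! i" for y i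
  have nth: "pre y n ! i = s y i" if "i < n" for i n y
    using that
  proof (induction n)
    case (Suc n)
    then show ?case by (cases "i = n") (auto simp: s_def pre_simps ext_def nth_append len)
  qed simp
  have "s \<in> completion M \<rightarrow>\<^sub>M borel"
  proof (rule measurable_coordinatewise_then_product)
    fix i
    have "(\<lambda>y. s y i) \<in> completion M \<rightarrow>\<^sub>M count_space UNIV" unfolding s_def by measurable
    then show "(\<lambda>y. s y i) \<in> completion M \<rightarrow>\<^sub>M borel" by (rule measurable_compose) simp
  qed
  moreover have "(y, s y) \<in> F" if "y \<in> fst ` F" for y
  proof -
    have pre_D: "D (pre y n) y" for n
    proof (induction n)
      case 0
      then show ?case using that by (force simp: D_def pre_simps)
    next
      case (Suc n)
      then obtain z where z: "(y, z) \<in> F" "\<forall>i<n. z i = pre y n ! i" unfolding D_def by (auto simp: len)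
      then have "D (pre y n @ [z n]) y"
        unfolding D_def by (auto simp: len nth_append less_Suc_eq intro!: exI[of _ z])
      then show ?case unfolding pre_simps ext_def by (rule LeastI)
    qed
    obtain C where C: "\<And>n::nat. cylinder M (C n)" "F = (\<Inter>n. C n)"
      using F unfolding closed_rel_def by metis
    have "(y, s y) \<in> C j" for j
    proof -
      obtain m where m: "\<And>z z'. (\<forall>i<m. z i = z' i) \<Longrightarrow> ((y, z) \<in> C j \<longleftrightarrow> (y, z') \<in> C j)"
        using C(1)[of j] unfolding cylinder_def by blast
      obtain z where "(y, z) \<in> F" "\<forall>i<m. z i = s y i"
        using pre_D[of m] unfolding D_def by (auto simp: len nth)
      then show ?thesis using m C(2) by blast
    qed
    then show ?thesis unfolding C(2) by auto
  qed
  ultimately show ?thesis by auto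
qed


section \<open>Polish spaces as retracts of the Baire space\<close>

text \<open>A measurable retraction does the work of a Borel isomorphism and avoids distinguishing
  countable from uncountable spaces. Since \<open>\<psi>\<close> is total, a retract is never
  empty.\<close>

definition baire_retract :: "'a measure \<Rightarrow> bool" where
  "baire_retract M \<longleftrightarrow> (\<exists>\<phi> \<psi>. \<phi> \<in> M \<rightarrow>\<^sub>M (borel :: (nat \<Rightarrow> nat) measure) \<and> \<psi> \<in> borel \<rightarrow>\<^sub>M M \<and>
    (\<forall>x\<in>space M. \<psi> (\<phi> x) = x))"

lemma baire_retractE:
  assumes "baire_retract M"
  obtains \<phi> \<psi> where "\<phi> \<in> M \<rightarrow>\<^sub>M (borel :: (nat \<Rightarrow> nat) measure)" "\<psi> \<in> borel \<rightarrow>\<^sub>M M"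
    "\<And>x. x \<in> space M \<Longrightarrow> \<psi> (\<phi> x) = x"
  using assms unfolding baire_retract_def by blast

text \<open>Coordinates are taken into \<open>count_space UNIV\<close> because this is where
  searches for a least number are measurable.\<close>

lemma measurable_baire_iff:
  "f \<in> M \<rightarrow>\<^sub>M (borel :: (nat \<Rightarrow> nat) measure) \<longleftrightarrow> (\<forall>i. (\<lambda>x. f x i) \<in> M \<rightarrow>\<^sub>M count_space UNIV)"
proof -
  have "(\<lambda>x. f x i) \<in> M \<rightarrow>\<^sub>M count_space UNIV \<longleftrightarrow> (\<lambda>x. f x i) \<in> M \<rightarrow>\<^sub>M borel" for i
    by (intro arg_cong[of _ _ "\<lambda>S. _ \<in> S"] measurable_cong_sets)
      (simp_all add: sets_borel_eq_count_space)
  moreover have "f \<in> M \<rightarrow>\<^sub>M borel" if "\<And>i. (\<lambda>x. f x i) \<in> M \<rightarrow>\<^sub>M borel"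
    using that by (rule measurable_coordinatewise_then_product)
  moreover have "(\<lambda>x. f x i) \<in> M \<rightarrow>\<^sub>M borel" if "f \<in> M \<rightarrow>\<^sub>M borel" for i
    using that by (rule measurable_product_then_coordinatewise)
  ultimately show ?thesis by metis
qed

text \<open>
  A point is coded by a sequence \<open>z\<close> such that \<open>c (z k)\<close> is within \<open>2^-k\<close> of it, where \<open>c\<close>
  enumerates a dense set; decoding takes the limit.
\<close>

lemma polish_baire_retract:
  assumes "polish_topology S" "topspace S \<noteq> {}"
  shows "baire_retract (borel_of S)"
proof -
  obtain M d C where d: "Metric_space M d" "Metric_space.mcomplete M d" and S: "S = Metric_space.mtopology M d"
    and C: "countable C" "C \<subseteq> topspace S" "S closure_of C = topspace S"
    using assms(1) unfolding polish_topology_def completely_metrizable_space_def separable_space_def by auto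
  interpret Metric_space M d by (rule d)
  have top: "topspace S = M" by (simp add: S)
  have "C \<noteq> {}" using C(3) assms(2) by (metis closure_of_empty)
  define c where "c = from_nat_into C"
  have c: "c n \<in> M" for n
    using from_nat_into[OF \<open>C \<noteq> {}\<close>] C(2) top unfolding c_def by auto
  have dense: "\<exists>n. d x (c n) < e" if "x \<in> M" and e: "0 < e" for x e
  proof -
    have "x \<in> mtopology closure_of C" using that C(3) top S by simp
    then obtain y where "y \<in> C" "y \<in> mball x e" using e unfolding metric_closure_of by blast
    then show ?thesis using from_nat_into_surj[OF C(1), of y] unfolding c_def by auto
  qed
  define \<phi> where "\<phi> x k = (LEAST n. d x (c n) < (1/2)^k)" for x and k :: nat
  have \<phi>: "d x (c (\<phi> x k)) < (1/2)^k" if "x \<in> M" for x k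
    unfolding \<phi>_def by (rule LeastI_ex) (use dense that in auto)
  have \<phi>_meas: "\<phi> \<in> borel_of S \<rightarrow>\<^sub>M borel"
    unfolding measurable_baire_iff
  proof
    fix k
    have [measurable]: "Measurable.pred (borel_of S) (\<lambda>x. d x (c n) < (1/2)^k)" for n
    proof -
      have "openin S (mball (c n) ((1/2)^k))" by (simp add: S)
      then have "mball (c n) ((1/2)^k) \<in> sets (borel_of S)" by (rule openin_borel_of)
      also have "mball (c n) ((1/2)^k) = {x \<in> space (borel_of S). d x (c n) < (1/2)^k}"
        using c[of n] by (auto simp: top commute)
      finally show ?thesis by (simp add: pred_def)
    qed
    show "(\<lambda>x. \<phi> x k) \<in> borel_of S \<rightarrow>\<^sub>M count_space UNIV"
      unfolding \<phi>_def by measurable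
  qed
  obtain x0 where x0: "x0 \<in> M" using assms(2) top by auto
  \<comment> \<open>The constant 3 is the tail sum of the bound in \<open>G\<close> below: steps of
    size \<open>3/2 * (1/2)^k\<close> from index \<open>k\<close> on add up to
    \<open>3 * (1/2)^k\<close>.\<close>
  define L where "L z x \<longleftrightarrow> x \<in> M \<and> (\<forall>k. d x (c (z k)) \<le> 3 * (1/2)^k)" for z :: "nat \<Rightarrow> nat" and x
  have small: "\<exists>k. a * (1/2)^k < e" if "0 < e" "0 < a" for a e :: real
    using real_arch_pow_inv[of "e / a" "1/2"] that by (auto simp: field_simps)
  have L_unique: "x = y" if "L z x" "L z y" for z x y
  proof (rule ccontr)
    assume "x \<noteq> y"
    then have "d x y > 0" using that by (simp add: L_def)
    then obtain k where "6 * (1/2)^k < d x y" using small[of "d x y" 6] by auto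
    moreover have "d x y \<le> d x (c (z k)) + d y (c (z k))"
      using that c by (metis L_def commute triangle)
    ultimately show False using that unfolding L_def by (smt (verit))
  qed
  \<comment> \<open>Two successive approximations of one point lie within \<open>(1/2)^k\<close> and
    \<open>(1/2)^(k + 1)\<close> of it, whence 3/2. The condition mentions only the sequence,
    through countably many pairs of entries, so it is measurable.\<close>
  define G where "G = {z. \<forall>k. d (c (z k)) (c (z (Suc k))) \<le> 3/2 * (1/2)^k}"
  have L_ex: "\<exists>x. L z x" if "z \<in> G" for z
  proof -
    have step: "d (c (z k)) (c (z (k + n))) \<le> 3 * (1/2)^k - 3 * (1/2)^(k + n)" for k n
    proof (induction n)
      case (Suc n)
      have "d (c (z k)) (c (z (k + Suc n))) \<le> d (c (z k)) (c (z (k + n))) + d (c (z (k + n))) (c (z (Suc (k + n))))"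
        using c by (simp add: triangle)
      also have "\<dots> \<le> 3 * (1/2)^k - 3 * (1/2)^(k + n) + 3/2 * (1/2)^(k + n)"
        using Suc that unfolding G_def by (intro add_mono) auto
      finally show ?case by simp
    qed (use c in simp)
    have bound: "d (c (z k)) (c (z l)) \<le> 3 * (1/2)^k" if "k \<le> l" for k l
      using step[of k "l - k"] that by (smt (verit) le_add_diff_inverse zero_le_power divide_nonneg_nonneg)
    have "MCauchy (\<lambda>k. c (z k))"
      unfolding MCauchy_def
    proof (intro conjI allI impI)
      fix e :: real assume "0 < e"
      then obtain K where K: "3 * (1/2)^K < e" using small[of e 3] by auto
      have "d (c (z n)) (c (z n')) < e" if "K \<le> n" "K \<le> n'" for n n'
      proof -
        have le: "(1/2::real)^n \<le> (1/2)^K" "(1/2::real)^n' \<le> (1/2)^K"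
          using that by (auto intro!: power_decreasing)
        show ?thesis
        proof (cases "n \<le> n'")
          case True
          then show ?thesis using bound[OF True] le K by linarith
        next
          case False
          then have "d (c (z n')) (c (z n)) \<le> 3 * (1/2)^n'" by (intro bound) simp
          then show ?thesis using le K commute[of "c (z n)" "c (z n')"] by linarith
        qed
      qed
      then show "\<exists>N. \<forall>n n'. N \<le> n \<longrightarrow> N \<le> n' \<longrightarrow> d (c (z n)) (c (z n')) < e" by blast
    qed (use c in auto)
    then obtain x where x: "limitin mtopology (\<lambda>k. c (z k)) x sequentially"
      using d(2) unfolding mcomplete_def by blast
    have "d x (c (z k)) \<le> 3 * (1/2)^k" for k
    proof (rule field_le_epsilon)
      fix e :: real assume "0 < e"
      then obtain l where l: "d (c (z n)) x < e" if "n \<ge> l" for n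
        using x unfolding limit_metric_sequentially by blast
      have xM: "x \<in> M" using x unfolding limit_metric_sequentially by blast
      have "d x (c (z k)) \<le> d (c (z (max k l))) x + d (c (z k)) (c (z (max k l)))"
        using c xM by (metis commute triangle)
      also have "\<dots> \<le> e + 3 * (1/2)^k"
        using bound[of k "max k l"] l[of "max k l"] by auto
      finally show "d x (c (z k)) \<le> 3 * (1/2)^k + e" by simp
    qed
    then show ?thesis using x unfolding L_def limit_metric_sequentially by blast
  qed
  define \<psi> where "\<psi> z = (if z \<in> G then (THE x. L z x) else x0)" for z
  have \<psi>_L: "L z (\<psi> z)" if "z \<in> G" for z
    using L_ex[OF that] L_unique that unfolding \<psi>_def by (auto intro: theI)
  have \<psi>_M: "\<psi> z \<in> M" for z
    using \<psi>_L x0 unfolding \<psi>_def L_def by auto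
  have coord [measurable]: "(\<lambda>z :: nat \<Rightarrow> nat. z k) \<in> borel \<rightarrow>\<^sub>M count_space UNIV" for k
    using measurable_baire_iff[of "\<lambda>z. z" borel] by auto
  have G_meas [measurable]: "G \<in> sets borel"
  proof -
    have "G = {z \<in> space borel. \<forall>k. (\<lambda>(a, b). d (c a) (c b) \<le> 3/2 * (1/2)^k) (z k, z (Suc k))}" by (simp add: G_def)
    also have "\<dots> \<in> sets borel" by measurable
    finally show ?thesis .
  qed
  have \<psi>_meas: "\<psi> \<in> borel \<rightarrow>\<^sub>M borel_of S"
  proof (rule measurable_borel_ofI)
    fix U assume U: "openin S U"
    \<comment> \<open>This reduces membership of the limit in an open set to single entries of
      \<open>z\<close>. Radius 4 exceeds the error bound 3, so the ball contains
      \<open>\<psi> z\<close>; conversely, 7 = 3 + 4 makes such a ball fit into the one around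
      \<open>\<psi> z\<close>.\<close>
    have U_iff: "\<psi> z \<in> U \<longleftrightarrow> (\<exists>k. mball (c (z k)) (4 * (1/2)^k) \<subseteq> U)" if z: "z \<in> G" for z
    proof
      assume "\<psi> z \<in> U"
      then obtain e where e: "e > 0" "mball (\<psi> z) e \<subseteq> U" using U unfolding S openin_mtopology by blast
      obtain k where k: "7 * (1/2)^k < e" using small[of e 7] e by auto
      have "mball (c (z k)) (4 * (1/2)^k) \<subseteq> mball (\<psi> z) e"
        using \<psi>_L[OF z] k c \<psi>_M unfolding L_def
        by (intro mball_subset) (auto simp: commute dest!: spec[of _ k])
      then show "\<exists>k. mball (c (z k)) (4 * (1/2)^k) \<subseteq> U" using e by blast
    next
      assume "\<exists>k. mball (c (z k)) (4 * (1/2)^k) \<subseteq> U"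
      then obtain k where k: "mball (c (z k)) (4 * (1/2)^k) \<subseteq> U" by auto
      have "d (\<psi> z) (c (z k)) \<le> 3 * (1/2)^k" using \<psi>_L[OF z] unfolding L_def by auto
      also have "\<dots> < 4 * (1/2)^k" by simp
      finally have "\<psi> z \<in> mball (c (z k)) (4 * (1/2)^k)"
        using c \<psi>_M by (auto simp: commute)
      then show "\<psi> z \<in> U" using k by auto
    qed
    have "\<psi> -` U \<inter> space borel = {z \<in> space borel.
        if z \<in> G then \<exists>k. (\<lambda>a. mball (c a) (4 * (1/2)^k) \<subseteq> U) (z k) else x0 \<in> U}"
    proof (rule set_eqI)
      fix z
      have "\<psi> z = x0" if "z \<notin> G" using that by (simp add: \<psi>_def)
      then show "z \<in> \<psi> -` U \<inter> space borel \<longleftrightarrow> z \<in> {z \<in> space borel.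
          if z \<in> G then \<exists>k. (\<lambda>a. mball (c a) (4 * (1/2)^k) \<subseteq> U) (z k) else x0 \<in> U}"
        using U_iff by (cases "z \<in> G") simp_all
    qed
    also have "\<dots> \<in> sets borel"
    proof -
      have [measurable]: "Measurable.pred borel (\<lambda>z. (\<lambda>a. mball (c a) (4 * (1/2)^k) \<subseteq> U) (z k))" for k
        by (rule measurable_compose[OF coord]) simp
      show ?thesis by measurable
    qed
    finally show "\<psi> -` U \<inter> space borel \<in> sets borel" .
  qed (use \<psi>_M top in auto)
  have "\<psi> (\<phi> x) = x" if "x \<in> M" for x
  proof -
    have "\<phi> x \<in> G"
      unfolding G_def
    proof (intro CollectI allI)
      fix k
      have "d (c (\<phi> x k)) (c (\<phi> x (Suc k))) \<le> d x (c (\<phi> x k)) + d x (c (\<phi> x (Suc k)))"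
        using that c by (metis commute triangle)
      also have "\<dots> \<le> 3/2 * (1/2)^k"
        using \<phi>[OF that, of k] \<phi>[OF that, of "Suc k"] by simp
      finally show "d (c (\<phi> x k)) (c (\<phi> x (Suc k))) \<le> 3/2 * (1/2)^k" .
    qed
    moreover have "L (\<phi> x) x"
      unfolding L_def using that \<phi>[OF that] by (auto intro!: less_imp_le order_less_le_trans[OF \<phi>[OF that]])
    ultimately show ?thesis using L_unique \<psi>_L by blast
  qed
  then show ?thesis
    unfolding baire_retract_def using \<phi>_meas \<psi>_meas top by auto
qed

lemma baire_retract_pair:
  assumes "baire_retract M" "baire_retract M'"
  shows "baire_retract (M \<Otimes>\<^sub>M M')"
proof -
  obtain \<phi> \<psi> where [measurable]: "\<phi> \<in> M \<rightarrow>\<^sub>M (borel :: (nat \<Rightarrow> nat) measure)" "\<psi> \<in> borel \<rightarrow>\<^sub>M M"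
    and inv: "\<And>x. x \<in> space M \<Longrightarrow> \<psi> (\<phi> x) = x"
    using baire_retractE[OF assms(1)] by blast
  obtain \<phi>' \<psi>' where [measurable]: "\<phi>' \<in> M' \<rightarrow>\<^sub>M (borel :: (nat \<Rightarrow> nat) measure)" "\<psi>' \<in> borel \<rightarrow>\<^sub>M M'"
    and inv': "\<And>x. x \<in> space M' \<Longrightarrow> \<psi>' (\<phi>' x) = x"
    using baire_retractE[OF assms(2)] by blast
  have coord [measurable]: "(\<lambda>z :: nat \<Rightarrow> nat. z k) \<in> borel \<rightarrow>\<^sub>M count_space UNIV" for k
    using measurable_baire_iff[of "\<lambda>z. z" borel] by auto
  have [measurable]: "(\<lambda>x. \<phi> x i) \<in> M \<rightarrow>\<^sub>M count_space UNIV" "(\<lambda>x. \<phi>' x i) \<in> M' \<rightarrow>\<^sub>M count_space UNIV" for i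
    using measurable_baire_iff[of \<phi>] measurable_baire_iff[of \<phi>'] by auto
  define \<Phi> where "\<Phi> p i = (if even i then \<phi> (fst p) (i div 2) else \<phi>' (snd p) (i div 2))" for p and i :: nat
  define \<Psi> where "\<Psi> z = (\<psi> (\<lambda>i. z (2 * i)), \<psi>' (\<lambda>i. z (2 * i + 1)))" for z :: "nat \<Rightarrow> nat"
  have "\<Phi> \<in> M \<Otimes>\<^sub>M M' \<rightarrow>\<^sub>M borel"
    unfolding measurable_baire_iff \<Phi>_def by measurable
  moreover have [measurable]: "(\<lambda>z i. z (h i)) \<in> borel \<rightarrow>\<^sub>M (borel :: (nat \<Rightarrow> nat) measure)" for h :: "nat \<Rightarrow> nat"
    unfolding measurable_baire_iff by measurable
  have "\<Psi> \<in> borel \<rightarrow>\<^sub>M M \<Otimes>\<^sub>M M'" unfolding \<Psi>_def by measurable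
  moreover have "\<Psi> (\<Phi> p) = p" if "p \<in> space (M \<Otimes>\<^sub>M M')" for p
    using that inv inv' by (auto simp: \<Psi>_def \<Phi>_def space_pair_measure)
  ultimately show ?thesis unfolding baire_retract_def by blast
qed

lemma baire_retract_PiM:
  fixes M :: "nat \<Rightarrow> 'a measure"
  assumes "\<And>i. i \<in> I \<Longrightarrow> baire_retract (M i)"
  shows "baire_retract (Pi\<^sub>M I M)"
proof -
  have "\<forall>i. \<exists>\<phi> \<psi>. i \<in> I \<longrightarrow> \<phi> \<in> M i \<rightarrow>\<^sub>M (borel :: (nat \<Rightarrow> nat) measure) \<and> \<psi> \<in> borel \<rightarrow>\<^sub>M M i \<and>
    (\<forall>x\<in>space (M i). \<psi> (\<phi> x) = x)" using assms unfolding baire_retract_def by blast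
  then obtain \<phi> \<psi> where \<phi>: "\<And>i. i \<in> I \<Longrightarrow> \<phi> i \<in> M i \<rightarrow>\<^sub>M (borel :: (nat \<Rightarrow> nat) measure)"
    and \<psi>: "\<And>i. i \<in> I \<Longrightarrow> \<psi> i \<in> borel \<rightarrow>\<^sub>M M i"
    and inv: "\<And>i x. i \<in> I \<Longrightarrow> x \<in> space (M i) \<Longrightarrow> \<psi> i (\<phi> i x) = x" by metis
  define \<Phi> where "\<Phi> p n = (case prod_decode n of (i, j) \<Rightarrow> if i \<in> I then \<phi> i (p i) j else 0)" for p n
  define \<Psi> where "\<Psi> z = (\<lambda>i\<in>I. \<psi> i (\<lambda>j. z (prod_encode (i, j))))" for z :: "nat \<Rightarrow> nat"
  have "\<Phi> \<in> Pi\<^sub>M I M \<rightarrow>\<^sub>M borel"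
    unfolding measurable_baire_iff
  proof
    fix n
    obtain i j where ij: "prod_decode n = (i, j)" by force
    show "(\<lambda>p. \<Phi> p n) \<in> Pi\<^sub>M I M \<rightarrow>\<^sub>M count_space UNIV"
    proof (cases "i \<in> I")
      case True
      have "(\<lambda>p. p i) \<in> Pi\<^sub>M I M \<rightarrow>\<^sub>M M i" using True by (rule measurable_component_singleton)
      then have "(\<lambda>p. \<phi> i (p i) j) \<in> Pi\<^sub>M I M \<rightarrow>\<^sub>M count_space UNIV"
        by (rule measurable_compose) (use \<phi>[OF True, unfolded measurable_baire_iff] in blast)
      then show ?thesis using True by (simp add: \<Phi>_def ij)
    qed (simp add: \<Phi>_def ij)
  qed
  moreover have "\<Psi> \<in> borel \<rightarrow>\<^sub>M Pi\<^sub>M I M"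
    unfolding \<Psi>_def
  proof (rule measurable_restrict)
    fix i assume "i \<in> I"
    have "(\<lambda>z j. z (prod_encode (i, j))) \<in> borel \<rightarrow>\<^sub>M (borel :: (nat \<Rightarrow> nat) measure)"
      using measurable_baire_iff[of "\<lambda>z. z" borel] by (simp add: measurable_baire_iff[of "\<lambda>z j. z (prod_encode (i, j))"])
    then show "(\<lambda>z. \<psi> i (\<lambda>j. z (prod_encode (i, j)))) \<in> borel \<rightarrow>\<^sub>M M i"
      by (rule measurable_compose) (rule \<psi>[OF \<open>i \<in> I\<close>])
  qed
  moreover have "\<Psi> (\<Phi> p) = p" if "p \<in> space (Pi\<^sub>M I M)" for p
    using that by (intro ext) (auto simp: \<Psi>_def \<Phi>_def space_PiM PiE_iff inv extensional_def)
  ultimately show ?thesis unfolding baire_retract_def by blast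
qed


section \<open>Measurable selection\<close>

text \<open>Pulling \<open>B\<close> back along the decoding \<open>\<psi>\<close> preserves the
  projection, because every point of \<open>V\<close> has a code. The leftmost branch of the closed
  set above it carries such a code in its even entries, and decoding gives the selector.\<close>

theorem measurable_selection:
  assumes fin: "finite_measure M" and V: "baire_retract V" and B: "B \<in> sets (M \<Otimes>\<^sub>M V)"
  shows "fst ` B \<in> sets (completion M)"
    and "\<exists>s \<in> completion M \<rightarrow>\<^sub>M V. \<forall>y\<in>fst ` B. (y, s y) \<in> B"
proof -
  obtain \<phi> \<psi> where \<phi>: "\<phi> \<in> V \<rightarrow>\<^sub>M (borel :: (nat \<Rightarrow> nat) measure)" and \<psi>: "\<psi> \<in> borel \<rightarrow>\<^sub>M V"
    and inv: "\<And>x. x \<in> space V \<Longrightarrow> \<psi> (\<phi> x) = x"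
    using baire_retractE[OF V] by blast
  note [measurable] = \<psi> B
  define B' where "B' = {p \<in> space (M \<Otimes>\<^sub>M (borel :: (nat \<Rightarrow> nat) measure)). (fst p, \<psi> (snd p)) \<in> B}"
  have B_sub: "B \<subseteq> space M \<times> space V" using sets.sets_into_space[OF B] by (simp add: space_pair_measure)
  have "B' \<in> sets (M \<Otimes>\<^sub>M borel)" unfolding B'_def by measurable
  then obtain F where F: "closed_rel M F" and B'_eq: "B' = (\<lambda>(y, z). (y, \<lambda>i. z (2 * i))) ` F"
    using borel_imp_analytic_rel unfolding analytic_rel_def by blast
  have dom: "fst ` F = fst ` B"
  proof -
    have "fst ` F = fst ` B'" unfolding B'_eq by force
    also have "\<dots> = fst ` B"
    proof (intro equalityI subsetI)
      fix y assume "y \<in> fst ` B"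
      then obtain v where v: "(y, v) \<in> B" by auto
      then have "(y, \<phi> v) \<in> B'" using B_sub inv[of v] by (auto simp: B'_def space_pair_measure)
      then show "y \<in> fst ` B'" by force
    qed (force simp: B'_def)
    finally show ?thesis .
  qed
  then show "fst ` B \<in> sets (completion M)"
    using closed_rel_Domain_completion[OF fin F] by simp
  obtain s where s: "s \<in> completion M \<rightarrow>\<^sub>M borel" "\<And>y. y \<in> fst ` F \<Longrightarrow> (y, s y) \<in> F"
    using closed_rel_selection[OF fin F] by blast
  have "(\<lambda>y i. s y (2 * i)) \<in> completion M \<rightarrow>\<^sub>M borel"
    using s(1) unfolding measurable_baire_iff by blast
  then have "(\<lambda>y. \<psi> (\<lambda>i. s y (2 * i))) \<in> completion M \<rightarrow>\<^sub>M V"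
    by (rule measurable_compose) (rule \<psi>)
  moreover have "(y, \<psi> (\<lambda>i. s y (2 * i))) \<in> B" if "y \<in> fst ` B" for y
  proof -
    have "(y, \<lambda>i. s y (2 * i)) \<in> B'" unfolding B'_eq using s(2)[of y] that dom by force
    then show ?thesis by (simp add: B'_def)
  qed
  ultimately show "\<exists>s \<in> completion M \<rightarrow>\<^sub>M V. \<forall>y\<in>fst ` B. (y, s y) \<in> B"
    by (intro bexI[of _ "\<lambda>y. \<psi> (\<lambda>i. s y (2 * i))"] ballI)
qed

text \<open>The infimum need not be Borel, so values are rounded to a grid of mesh
  \<open>\<delta>\<close>: the selector of the first sublevel set that \<open>h\<close> reaches over
  \<open>y\<close> loses at most one mesh.\<close>

theorem near_minimal_selection:
  fixes h :: "'a \<times> 'v \<Rightarrow> ennreal"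
  assumes fin: "finite_measure M" and V: "baire_retract V" and h: "h \<in> borel_measurable (M \<Otimes>\<^sub>M V)"
    and \<delta>: "0 < (\<delta> :: real)"
  shows "\<exists>s \<in> completion M \<rightarrow>\<^sub>M V. \<forall>y\<in>space M. h (y, s y) \<le> (INF v\<in>space V. h (y, v)) + ennreal \<delta>"
proof -
  note h [measurable]
  define B where "B n = {p \<in> space (M \<Otimes>\<^sub>M V). h p < ennreal (\<delta> * real (Suc n))}" for n
  have B: "B n \<in> sets (M \<Otimes>\<^sub>M V)" for n unfolding B_def by measurable
  have A [measurable]: "fst ` B n \<in> sets (completion M)" for n
    by (rule measurable_selection(1)[OF fin V B])
  have "\<forall>n. \<exists>s \<in> completion M \<rightarrow>\<^sub>M V. \<forall>y\<in>fst ` B n. (y, s y) \<in> B n"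
    using measurable_selection(2)[OF fin V B] by blast
  then obtain s where s [measurable]: "\<And>n. s n \<in> completion M \<rightarrow>\<^sub>M V"
    and sB: "\<And>n y. y \<in> fst ` B n \<Longrightarrow> (y, s n y) \<in> B n" by metis
  \<comment> \<open>Where the infimum is infinite no sublevel set is reached; \<open>k y\<close> is
    then a fixed unspecified number, and the bound to be shown is trivial.\<close>
  define k where "k y = (LEAST n. y \<in> fst ` B n)" for y
  have k [measurable]: "k \<in> completion M \<rightarrow>\<^sub>M count_space UNIV" unfolding k_def by measurable
  have "(\<lambda>y. s (k y) y) \<in> completion M \<rightarrow>\<^sub>M V"
    by (rule measurable_compose_countable[OF s k])
  moreover have "h (y, s (k y) y) \<le> (INF v\<in>space V. h (y, v)) + ennreal \<delta>" if y: "y \<in> space M" for y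
  proof (cases "(INF v\<in>space V. h (y, v)) = top")
    case False
    then obtain v where v: "v \<in> space V" "h (y, v) < top" by (auto simp: less_top INF_less_iff)
    obtain n where n: "enn2real (h (y, v)) / \<delta> < real n" using reals_Archimedean2 by blast
    have "h (y, v) = ennreal (enn2real (h (y, v)))" using v by simp
    also have "\<dots> < ennreal (\<delta> * real (Suc n))"
      using n \<delta> by (intro ennreal_lessI) (auto simp: field_simps intro: add_pos_nonneg)
    finally have "(y, v) \<in> B n" using v y by (auto simp: B_def space_pair_measure)
    then have "y \<in> fst ` B n" by (intro image_eqI[of _ _ "(y, v)"]) simp_all
    then have ky: "y \<in> fst ` B (k y)" unfolding k_def by (rule LeastI)
    have "ennreal (\<delta> * real (k y)) \<le> (INF v\<in>space V. h (y, v))"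
    proof (rule INF_greatest)
      fix v assume v: "v \<in> space V"
      show "ennreal (\<delta> * real (k y)) \<le> h (y, v)"
      proof (cases "k y")
        case (Suc m)
        then have "y \<notin> fst ` B m" unfolding k_def by (metis lessI not_less_Least)
        then have "(y, v) \<notin> B m" by force
        then show ?thesis using v y Suc by (simp add: B_def space_pair_measure not_less)
      qed simp
    qed
    then have "ennreal (\<delta> * real (k y)) + ennreal \<delta> \<le> (INF v\<in>space V. h (y, v)) + ennreal \<delta>"
      by (rule add_right_mono)
    moreover have "h (y, s (k y) y) \<le> ennreal (\<delta> * real (k y)) + ennreal \<delta>"
      using sB[OF ky] \<delta> by (simp add: B_def ennreal_plus[symmetric] algebra_simps less_imp_le del: ennreal_plus)
    ultimately show ?thesis by (rule order_trans[rotated])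
  qed simp
  ultimately show ?thesis by (intro bexI[of _ "\<lambda>y. s (k y) y"] ballI)
qed


section \<open>Noise outsourcing\<close>

text \<open>
  Probabilities \<open>q t\<close> of the bit prefixes \<open>t\<close> split \<open>[0, 1)\<close> into intervals, level by level;
  \<open>prefix_split q t\<close> is the left endpoint of the interval of \<open>t\<close>. A uniform variable picks the bits.
\<close>

definition prefix_split :: "(bool list \<Rightarrow> real) \<Rightarrow> bool list \<Rightarrow> real" where
  "prefix_split q t = (\<Sum>i<length t. if t ! i then q (take i t @ [False]) else 0)"

lemma prefix_split_simps:
  "prefix_split q [] = 0"
  "prefix_split q (t @ [c]) = prefix_split q t + (if c then q (t @ [False]) else 0)"
  by (auto simp: prefix_split_def nth_append intro!: sum.cong)

primrec bit_prefix :: "(bool list \<Rightarrow> real) \<Rightarrow> real \<Rightarrow> nat \<Rightarrow> bool list" where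
  "bit_prefix q u 0 = []"
| "bit_prefix q u (Suc n) = bit_prefix q u n @
    [prefix_split q (bit_prefix q u n) + q (bit_prefix q u n @ [False]) \<le> u]"

definition bits_of :: "(bool list \<Rightarrow> real) \<Rightarrow> real \<Rightarrow> nat \<Rightarrow> bool" where
  "bits_of q u n = bit_prefix q u (Suc n) ! n"

lemma length_bit_prefix [simp]: "length (bit_prefix q u n) = n"
  by (induction n) auto

lemma map_bits_of: "map (bits_of q u) [0..<n] = bit_prefix q u n"
proof (induction n)
  case (Suc n)
  then show ?case by (simp add: bits_of_def nth_append)
qed simp

text \<open>The interval of \<open>t\<close> has length \<open>q t\<close> and is cut at distance
  \<open>q (t @ [False])\<close> from its left end, the very point with which
  \<open>bit_prefix\<close> compares \<open>u\<close>. The statement in \<open>l\<close>,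
  \<open>a\<close>, \<open>b\<close>, \<open>p\<close> isolates this case distinction from the
  lists.\<close>

lemma bit_prefix_iff:
  assumes "q [] = 1" "\<And>t. q t = q (t @ [False]) + q (t @ [True])" "\<And>t. 0 \<le> q t"
    and u: "0 \<le> u" "u < 1"
  shows "bit_prefix q u (length t) = t \<longleftrightarrow> prefix_split q t \<le> u \<and> u < prefix_split q t + q t"
proof (induction t rule: rev_induct)
  case (snoc c t)
  have "bit_prefix q u (length (t @ [c])) = t @ [c] \<longleftrightarrow>
      bit_prefix q u (length t) = t \<and> (c \<longleftrightarrow> prefix_split q t + q (t @ [False]) \<le> u)"
    by auto
  moreover have "(l \<le> u \<and> u < l + p \<and> (c \<longleftrightarrow> l + a \<le> u)) \<longleftrightarrow>
      l + (if c then a else 0) \<le> u \<and> u < l + (if c then a else 0) + (if c then b else a)"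
    if "p = a + b" "0 \<le> a" "0 \<le> b" for l a b p :: real
    using that by (cases c) auto
  note this[OF assms(2)[of t] assms(3) assms(3), of "prefix_split q t"]
  moreover have "q (t @ [c]) = (if c then q (t @ [True]) else q (t @ [False]))" by simp
  ultimately show ?case unfolding prefix_split_simps snoc.IH by argo
qed (use assms(1) u in \<open>simp add: prefix_split_simps\<close>)

lemma emeasure_bit_prefix:
  assumes q: "q [] = 1" "\<And>t. q t = q (t @ [False]) + q (t @ [True])" "\<And>t. 0 \<le> q t"
  shows "emeasure (uniform_measure lborel {0..<1}) {u. bit_prefix q u (length t) = t} = ennreal (q t)"
proof -
  let ?l = "prefix_split q t"
  \<comment> \<open>The interval of \<open>t\<close> stays inside \<open>[0, 1)\<close>, so
    intersecting with the support of the uniform law loses no mass.\<close>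
  have sub: "0 \<le> ?l \<and> ?l + q t \<le> 1"
  proof (induction t rule: rev_induct)
    case (snoc c t)
    have "0 \<le> l + (if c then a else 0) \<and> l + (if c then a else 0) + (if c then b else a) \<le> 1"
      if "p = a + b" "0 \<le> a" "0 \<le> b" "0 \<le> l \<and> l + p \<le> 1" for l a b p :: real
      using that by (cases c) auto
    note this[OF q(2)[of t] q(3) q(3) snoc]
    moreover have "q (t @ [c]) = (if c then q (t @ [True]) else q (t @ [False]))" by simp
    ultimately show ?case unfolding prefix_split_simps by argo
  qed (use q(1) in \<open>simp add: prefix_split_simps\<close>)
  have "(\<lambda>u. bit_prefix q u n) \<in> borel \<rightarrow>\<^sub>M count_space UNIV" for n
  proof (induction n)
    case (Suc n)
    note Suc [measurable]
    show ?case unfolding bit_prefix.simps by measurable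
  qed simp
  then have "{u \<in> space borel. bit_prefix q u (length t) = t} \<in> sets borel"
    by measurable
  then have "{u. bit_prefix q u (length t) = t} \<in> sets lborel" by simp
  then have "emeasure (uniform_measure lborel {0..<1}) {u. bit_prefix q u (length t) = t} =
      emeasure lborel ({0..<1} \<inter> {u. bit_prefix q u (length t) = t})"
    by (simp add: emeasure_uniform_measure divide_ennreal_def)
  also have "{0..<1} \<inter> {u. bit_prefix q u (length t) = t} = {?l..<?l + q t}"
    using bit_prefix_iff[where q=q, OF q] sub by auto
  also have "emeasure lborel \<dots> = ennreal (q t)" using q(3)[of t] by simp
  finally show ?thesis .
qed

section \<open>Laws on a product with the space of bit sequences\<close>

abbreviation bit_sequences :: "(nat \<Rightarrow> bool) measure" where
  "bit_sequences \<equiv> Pi\<^sub>M UNIV (\<lambda>_. count_space UNIV)"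

text \<open>Prefix cylinders are nested or disjoint, so the rectangles over them form an
  intersection-stable generator; the empty rectangle \<open>{} \<times> C []\<close> covers the
  disjoint case, and \<open>C []\<close> supplies the whole space.\<close>

lemma measure_eqI_bit_prefix:
  assumes fin: "finite_measure P" and sets: "sets P = sets (M \<Otimes>\<^sub>M bit_sequences)"
    "sets Q = sets (M \<Otimes>\<^sub>M bit_sequences)"
    and eq: "\<And>A t. A \<in> sets M \<Longrightarrow> emeasure P (A \<times> {c. map c [0..<length t] = t}) =
      emeasure Q (A \<times> {c. map c [0..<length t] = t})"
  shows "P = Q"
proof -
  interpret finite_measure P by fact
  let ?\<Omega> = "space M \<times> (UNIV :: (nat \<Rightarrow> bool) set)"
  define C where "C t = {c. map c [0..<length t] = t}" for t :: "bool list"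
  define E where "E = {A \<times> C t | A t. A \<in> sets M}"
  have E_sub: "E \<subseteq> Pow ?\<Omega>"
    unfolding E_def by (auto dest: sets.sets_into_space)
  have C_nth: "c \<in> C t \<longleftrightarrow> (\<forall>i<length t. c i = t ! i)" for c t
    unfolding C_def mem_Collect_eq list_eq_iff_nth_eq[of "map c _"] by auto
  have C_Int_le: "C t \<inter> C t' = {} \<or> C t \<inter> C t' = C t'" if le: "length t \<le> length t'" for t t'
  proof (cases "\<forall>i<length t. t' ! i = t ! i")
    case True
    then have "C t' \<subseteq> C t" using le by (auto simp: C_nth)
    then show ?thesis by blast
  next
    case False
    then obtain i where "i < length t" "t' ! i \<noteq> t ! i" by blast
    then have "c \<notin> C t \<inter> C t'" for c using le by (auto simp: C_nth)
    then show ?thesis by blast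
  qed
  have C_Int: "C t \<inter> C t' = {} \<or> C t \<inter> C t' = C t \<or> C t \<inter> C t' = C t'" for t t'
    using C_Int_le[of t t'] C_Int_le[of t' t] by (cases "length t \<le> length t'") (auto simp: Int_commute)
  have "Int_stable E"
  proof (rule Int_stableI)
    fix a b assume "a \<in> E" "b \<in> E"
    then obtain A A' t t' where *: "a = A \<times> C t" "b = A' \<times> C t'" "A \<in> sets M" "A' \<in> sets M"
      unfolding E_def by blast
    have "a \<inter> b = (A \<inter> A') \<times> (C t \<inter> C t')" using * by auto
    moreover have "{} \<times> C [] \<in> E" unfolding E_def by blast
    moreover have "(A \<inter> A') \<times> C t'' \<in> E" for t'' using * unfolding E_def by blast
    ultimately show "a \<inter> b \<in> E" using C_Int[of t t'] by auto
  qed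
  define K where "K = sigma ?\<Omega> E"
  have space_K: "space K = ?\<Omega>" and sets_K: "sets K = sigma_sets ?\<Omega> E"
    unfolding K_def using E_sub by (auto simp: space_measure_of sets_measure_of)
  have E_K: "A \<times> C t \<in> sets K" if "A \<in> sets M" for A t
    unfolding sets_K using that by (intro sigma_sets.Basic) (auto simp: E_def)
  have fst_K: "fst \<in> K \<rightarrow>\<^sub>M M"
  proof (rule measurableI)
    fix A assume A: "A \<in> sets M"
    have "fst -` A \<inter> space K = A \<times> C []"
      using sets.sets_into_space[OF A] by (auto simp: space_K C_def)
    then show "fst -` A \<inter> space K \<in> sets K" using E_K[OF A] by simp
  qed (auto simp: space_K)
  have snd_K: "snd \<in> K \<rightarrow>\<^sub>M bit_sequences"
  proof (rule measurable_PiM_single')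
    fix i
    have "(\<lambda>p. snd p i) -` {v} \<inter> space K \<in> sets K" for v
    proof -
      have "(\<lambda>p. snd p i) -` {v} \<inter> space K = (\<Union>t\<in>{t. length t = Suc i \<and> t ! i = v}. space M \<times> C t)"
      proof (intro equalityI subsetI)
        fix p assume p: "p \<in> (\<lambda>p. snd p i) -` {v} \<inter> space K"
        then have "p \<in> space M \<times> C (map (snd p) [0..<Suc i])"
          "map (snd p) [0..<Suc i] \<in> {t. length t = Suc i \<and> t ! i = v}"
          by (auto simp: space_K C_nth nth_append simp del: upt_Suc)
        then show "p \<in> (\<Union>t\<in>{t. length t = Suc i \<and> t ! i = v}. space M \<times> C t)" by blast
      qed (auto simp: space_K C_nth)
      also have "\<dots> \<in> sets K" by (intro sets.countable_UN') (auto intro: E_K)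
      finally show ?thesis .
    qed
    then show "(\<lambda>p. snd p i) \<in> K \<rightarrow>\<^sub>M count_space UNIV"
      by (subst measurable_count_space_eq2_countable) auto
  qed (auto simp: space_K)
  have "sets (M \<Otimes>\<^sub>M bit_sequences) = sigma_sets ?\<Omega> E"
  proof
    have pair: "(\<lambda>p. (fst p, snd p)) \<in> K \<rightarrow>\<^sub>M M \<Otimes>\<^sub>M bit_sequences"
      using fst_K snd_K by (rule measurable_Pair)
    show "sets (M \<Otimes>\<^sub>M bit_sequences) \<subseteq> sigma_sets ?\<Omega> E"
    proof
      fix A assume A: "A \<in> sets (M \<Otimes>\<^sub>M bit_sequences)"
      have "A \<subseteq> ?\<Omega>" using sets.sets_into_space[OF A] by (auto simp: space_pair_measure)
      then show "A \<in> sigma_sets ?\<Omega> E"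
        using measurable_sets[OF pair A] by (simp add: vimage_def Int_absorb2 space_K sets_K)
    qed
    have "C t \<in> sets bit_sequences" for t
    proof -
      have "C t = {c \<in> space bit_sequences. \<forall>i<length t. c i = t ! i}" by (auto simp: C_nth space_PiM)
      also have "\<dots> \<in> sets bit_sequences" by measurable
      finally show ?thesis .
    qed
    then have "E \<subseteq> sets (M \<Otimes>\<^sub>M bit_sequences)" unfolding E_def by auto
    then show "sigma_sets ?\<Omega> E \<subseteq> sets (M \<Otimes>\<^sub>M bit_sequences)"
      using sets.sigma_sets_subset[of E "M \<Otimes>\<^sub>M bit_sequences"]
      by (simp add: space_pair_measure space_PiM)
  qed
  with sets have "sets P = sigma_sets ?\<Omega> E" "sets Q = sigma_sets ?\<Omega> E" by auto
  then show ?thesis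
  proof (rule measure_eqI_generator_eq[OF \<open>Int_stable E\<close> E_sub, rotated])
    show "range (\<lambda>_::nat. space M \<times> C []) \<subseteq> E" unfolding E_def by blast
    show "(\<Union>i::nat. space M \<times> C []) = ?\<Omega>" by (auto simp: C_def)
    show "emeasure P X = emeasure Q X" if "X \<in> E" for X
      using that eq unfolding E_def C_def by blast
  qed simp
qed


lemma density_distr_unique:
  assumes "sigma_finite_measure M" "f \<in> borel_measurable M" "g \<in> borel_measurable M"
    and eq: "\<And>A. A \<in> sets M \<Longrightarrow> (\<integral>\<^sup>+x. f x * indicator A x \<partial>M) = (\<integral>\<^sup>+x. g x * indicator A x \<partial>M)"
  shows "AE x in M. f x = g x"
proof (rule sigma_finite_measure.density_unique[OF assms(1-3)])
  show "density M f = density M g"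
    by (rule measure_eqI) (use assms in \<open>auto simp: emeasure_density\<close>)
qed

text \<open>For each prefix \<open>t\<close>, the mass that \<open>\<beta>\<close> gives to
  \<open>A\<close> together with prefix \<open>t\<close> is absolutely continuous in
  \<open>A\<close> with respect to the first marginal. Its density \<open>p t\<close> is the
  conditional probability of the prefix given \<open>x\<close>, and splitting \<open>[0, 1)\<close>
  according to these probabilities realises the conditional law of the bits.\<close>

lemma exists_bit_kernel:
  fixes b :: "'w \<Rightarrow> nat \<Rightarrow> bool"
  assumes \<beta>: "prob_space \<beta>" "sets \<beta> = sets (M \<Otimes>\<^sub>M W)"
    and b: "\<And>n. Measurable.pred W (\<lambda>w. b w n)"
  shows "\<exists>G \<in> M \<Otimes>\<^sub>M borel \<rightarrow>\<^sub>M bit_sequences.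
    distr \<beta> (M \<Otimes>\<^sub>M bit_sequences) (\<lambda>(x, w). (x, b w)) =
    distr (distr \<beta> M fst \<Otimes>\<^sub>M uniform_measure lborel {0..<1::real}) (M \<Otimes>\<^sub>M bit_sequences)
      (\<lambda>(x, u). (x, G (x, u)))"
proof -
  interpret \<beta>: prob_space \<beta> by fact
  note [measurable_cong] = \<beta>(2)
  note b [measurable]
  define \<mu> where "\<mu> = distr \<beta> M fst"
  define \<U> where "\<U> = uniform_measure lborel {0..<1::real}"
  have sets_\<mu> [measurable_cong]: "sets \<mu> = sets M" by (simp add: \<mu>_def)
  have space_\<mu>: "space \<mu> = space M" by (simp add: \<mu>_def)
  have sets_\<U> [measurable_cong]: "sets \<U> = sets borel" by (simp add: \<U>_def)
  have space_\<beta>: "space \<beta> = space M \<times> space W"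
    using sets_eq_imp_space_eq[OF \<beta>(2)] by (simp add: space_pair_measure)
  interpret \<mu>: prob_space \<mu> unfolding \<mu>_def by (rule \<beta>.prob_space_distr) measurable
  interpret \<U>: prob_space \<U> unfolding \<U>_def by (rule prob_space_uniform_measure) auto
  define P where "P t = {w \<in> space W. map (b w) [0..<length t] = t}" for t
  have P_iff: "w \<in> P t \<longleftrightarrow> w \<in> space W \<and> (\<forall>i<length t. b w i = t ! i)" for w t
    unfolding P_def mem_Collect_eq list_eq_iff_nth_eq[of "map (b w) _"] by auto
  have P [measurable]: "P t \<in> sets W" for t
  proof -
    have "P t = {w \<in> space W. \<forall>i<length t. b w i = t ! i}" by (auto simp: P_iff)
    also have "\<dots> \<in> sets W" by measurable
    finally show ?thesis .
  qed
  define \<nu> where "\<nu> t = distr (density \<beta> (indicator (space M \<times> P t))) M fst" for t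
  have \<nu>_sets: "sets (\<nu> t) = sets M" for t by (simp add: \<nu>_def)
  have \<nu>: "emeasure (\<nu> t) A = emeasure \<beta> (A \<times> P t)" if [measurable]: "A \<in> sets M" for A t
  proof -
    have A: "A \<subseteq> space M" using that by (rule sets.sets_into_space)
    have "emeasure (\<nu> t) A = emeasure (density \<beta> (indicator (space M \<times> P t))) (fst -` A \<inter> space \<beta>)"
      unfolding \<nu>_def by (subst emeasure_distr) simp_all
    also have "fst -` A \<inter> space \<beta> = A \<times> space W" using A by (auto simp: space_\<beta>)
    also have "emeasure (density \<beta> (indicator (space M \<times> P t))) (A \<times> space W) =
        (\<integral>\<^sup>+z. indicator (space M \<times> P t) z * indicator (A \<times> space W) z \<partial>\<beta>)"
      by (rule emeasure_density) (simp_all add: \<beta>(2))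
    also have "\<dots> = (\<integral>\<^sup>+z. indicator (A \<times> P t) z \<partial>\<beta>)"
      using A sets.sets_into_space[OF P] by (intro nn_integral_cong) (auto simp: indicator_def)
    also have "\<dots> = emeasure \<beta> (A \<times> P t)" by (simp add: \<beta>(2))
    finally show ?thesis .
  qed
  have \<mu>: "emeasure \<mu> A = emeasure \<beta> (A \<times> space W)" if "A \<in> sets M" for A
  proof -
    have "fst -` A \<inter> space \<beta> = A \<times> space W" using sets.sets_into_space[OF that] by (auto simp: space_\<beta>)
    then show ?thesis unfolding \<mu>_def using that by (subst emeasure_distr) simp_all
  qed
  have ac: "absolutely_continuous \<mu> (\<nu> t)" for t
    unfolding absolutely_continuous_def
  proof
    fix A assume A: "A \<in> null_sets \<mu>"
    then have AM: "A \<in> sets M" and 0: "emeasure \<beta> (A \<times> space W) = 0"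
      using \<mu>[of A] by (auto simp: null_sets_def sets_\<mu>)
    have "emeasure \<beta> (A \<times> P t) \<le> emeasure \<beta> (A \<times> space W)"
      using AM sets.sets_into_space[OF P] by (intro emeasure_mono) (auto simp: \<beta>(2))
    then show "A \<in> null_sets (\<nu> t)" using 0 AM \<nu>[OF AM] \<nu>_sets by (auto simp: null_sets_def)
  qed
  define p where "p t = RN_deriv \<mu> (\<nu> t)" for t
  have p_meas [measurable]: "p t \<in> borel_measurable M" for t
    using borel_measurable_RN_deriv[of \<mu> "\<nu> t"] by (simp add: p_def measurable_cong_sets[OF sets_\<mu> refl])
  have p_meas_\<mu>: "p t \<in> borel_measurable \<mu>" for t by measurable
  have p: "(\<integral>\<^sup>+x. p t x * indicator A x \<partial>\<mu>) = emeasure \<beta> (A \<times> P t)" if "A \<in> sets M" for t A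
  proof -
    have "density \<mu> (p t) = \<nu> t"
      unfolding p_def by (rule \<mu>.density_RN_deriv[OF ac]) (simp add: \<nu>_sets sets_\<mu>)
    then have "emeasure (density \<mu> (p t)) A = emeasure \<beta> (A \<times> P t)" using \<nu>[OF that] by simp
    then show ?thesis using that p_meas_\<mu> by (subst (asm) emeasure_density) (auto simp: sets_\<mu>)
  qed
  have p_Nil: "AE x in \<mu>. p [] x = 1"
  proof (rule density_distr_unique)
    fix A assume "A \<in> sets \<mu>"
    then have A: "A \<in> sets M" by (simp add: sets_\<mu>)
    have "P [] = space W" by (auto simp: P_iff)
    then show "(\<integral>\<^sup>+x. p [] x * indicator A x \<partial>\<mu>) = (\<integral>\<^sup>+x. 1 * indicator A x \<partial>\<mu>)"
      using A by (simp add: p \<mu>[symmetric] sets_\<mu>)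
  qed (use p_meas_\<mu> \<mu>.sigma_finite_measure_axioms in auto)
  have p_split: "AE x in \<mu>. p t x = p (t @ [False]) x + p (t @ [True]) x" for t
  proof (rule density_distr_unique)
    fix A assume "A \<in> sets \<mu>"
    then have A [measurable]: "A \<in> sets M" by (simp add: sets_\<mu>)
    have "P t = P (t @ [False]) \<union> P (t @ [True])" "P (t @ [False]) \<inter> P (t @ [True]) = {}"
      by (auto simp: P_iff nth_append less_Suc_eq)
    then have *: "A \<times> P t = A \<times> P (t @ [False]) \<union> A \<times> P (t @ [True])"
      "(A \<times> P (t @ [False])) \<inter> (A \<times> P (t @ [True])) = {}" by auto
    have "(\<integral>\<^sup>+x. p t x * indicator A x \<partial>\<mu>) = emeasure \<beta> (A \<times> P t)" by (rule p[OF A])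
    also have "\<dots> = emeasure \<beta> (A \<times> P (t @ [False])) + emeasure \<beta> (A \<times> P (t @ [True]))"
      unfolding *(1) by (rule plus_emeasure[symmetric]) (use * A P in \<open>auto simp: \<beta>(2)\<close>)
    also have "\<dots> = (\<integral>\<^sup>+x. p (t @ [False]) x * indicator A x \<partial>\<mu>) + (\<integral>\<^sup>+x. p (t @ [True]) x * indicator A x \<partial>\<mu>)"
      by (simp only: p[OF A])
    also have "\<dots> = (\<integral>\<^sup>+x. (p (t @ [False]) x + p (t @ [True]) x) * indicator A x \<partial>\<mu>)"
      by (subst nn_integral_add[symmetric]) (simp_all add: distrib_right)
    finally show "(\<integral>\<^sup>+x. p t x * indicator A x \<partial>\<mu>) =
      (\<integral>\<^sup>+x. (p (t @ [False]) x + p (t @ [True]) x) * indicator A x \<partial>\<mu>)" .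
  qed (use p_meas_\<mu> \<mu>.sigma_finite_measure_axioms in auto)
  \<comment> \<open>Bit lists are countable, so a single null set takes care of all prefixes.
    \<open>G\<close> is measurable at bad points as well, and these contribute nothing to the
    law.\<close>
  define good where "good x \<longleftrightarrow> p [] x = 1 \<and> (\<forall>t. p t x = p (t @ [False]) x + p (t @ [True]) x)" for x
  have AE_good: "AE x in \<mu>. good x"
    unfolding good_def using p_Nil p_split by (simp add: AE_all_countable)
  have good_Nil: "p [] x = 1" and good_split: "p t x = p (t @ [False]) x + p (t @ [True]) x"
    if "good x" for x t
    using that unfolding good_def by blast+
  define q where "q x t = enn2real (p t x)" for x t
  have [measurable]: "(\<lambda>x. q x t) \<in> borel_measurable M" for t unfolding q_def by measurable
  have good_p: "p t x = ennreal (q x t)" if "good x" for x t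
  proof -
    have "p t x \<le> 1"
    proof (induction t rule: rev_induct)
      case (snoc c t)
      have "p (t @ [c]) x \<le> p (t @ [False]) x + p (t @ [True]) x" by (cases c) auto
      also have "\<dots> = p t x" by (rule good_split[OF that, symmetric])
      finally show ?case using snoc by simp
    qed (simp add: good_Nil[OF that])
    then have "p t x < top" by (rule le_less_trans) simp
    then show ?thesis by (simp add: q_def)
  qed
  have good_q: "q x [] = 1" "q x t = q x (t @ [False]) + q x (t @ [True])" "0 \<le> q x t"
    if "good x" for x t
  proof -
    show "q x [] = 1" by (simp add: q_def good_Nil[OF that])
    show "0 \<le> q x t" by (simp add: q_def)
    have "ennreal (q x t) = ennreal (q x (t @ [False])) + ennreal (q x (t @ [True]))"
      unfolding good_p[OF that, symmetric] by (rule good_split[OF that])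
    also have "\<dots> = ennreal (q x (t @ [False]) + q x (t @ [True]))"
      by (rule ennreal_plus[symmetric]) (simp_all add: q_def)
    finally have "ennreal (q x t) = ennreal (q x (t @ [False]) + q x (t @ [True]))" .
    then show "q x t = q x (t @ [False]) + q x (t @ [True])"
      by (rule ennreal_inj[THEN iffD1, rotated 2]) (simp_all add: q_def)
  qed
  define G where "G z = bits_of (q (fst z)) (snd z)" for z :: "'a \<times> real"
  have [measurable]: "(\<lambda>x. prefix_split (q x) t) \<in> borel_measurable M" for t
    unfolding prefix_split_def by measurable
  have pre_meas [measurable]: "(\<lambda>z. bit_prefix (q (fst z)) (snd z) n) \<in> M \<Otimes>\<^sub>M borel \<rightarrow>\<^sub>M count_space UNIV" for n
  proof (induction n)
    case (Suc n)
    note Suc [measurable]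
    have "(\<lambda>z. t @ [prefix_split (q (fst z)) t + q (fst z) (t @ [False]) \<le> snd z]) \<in>
        M \<Otimes>\<^sub>M borel \<rightarrow>\<^sub>M count_space UNIV" for t
      by measurable
    from measurable_compose_countable[OF this Suc] show ?case by simp
  qed simp
  have G [measurable]: "G \<in> M \<Otimes>\<^sub>M borel \<rightarrow>\<^sub>M bit_sequences"
    unfolding G_def bits_of_def
  proof (rule measurable_PiM_single')
    show "(\<lambda>z. bit_prefix (q (fst z)) (snd z) (Suc n) ! n) \<in> M \<Otimes>\<^sub>M borel \<rightarrow>\<^sub>M count_space UNIV" for n
      by (rule measurable_compose[OF pre_meas[of "Suc n"]]) simp
  qed auto
  have b_meas [measurable]: "b \<in> W \<rightarrow>\<^sub>M bit_sequences"
    by (rule measurable_PiM_single') (use b in auto)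
  let ?l = "distr \<beta> (M \<Otimes>\<^sub>M bit_sequences) (\<lambda>(x, w). (x, b w))"
  let ?r = "distr (\<mu> \<Otimes>\<^sub>M \<U>) (M \<Otimes>\<^sub>M bit_sequences) (\<lambda>(x, u). (x, G (x, u)))"
  have "?l = ?r"
  proof (rule measure_eqI_bit_prefix)
    show "finite_measure ?l"
      by (intro prob_space.finite_measure \<beta>.prob_space_distr) measurable
    fix A and t :: "bool list"
    assume A [measurable]: "A \<in> sets M"
    have A_sub: "A \<subseteq> space M" by (rule sets.sets_into_space[OF A])
    define C where "C = {c. map c [0..<length t] = t}"
    have C [measurable]: "C \<in> sets bit_sequences"
    proof -
      have "C = {c \<in> space bit_sequences. \<forall>i<length t. c i = t ! i}"
        unfolding C_def list_eq_iff_nth_eq[of "map _ _"] by (auto simp: space_PiM)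
      also have "\<dots> \<in> sets bit_sequences" by measurable
      finally show ?thesis .
    qed
    have "emeasure ?l (A \<times> C) = emeasure \<beta> (A \<times> P t)"
    proof -
      have "(\<lambda>(x, w). (x, b w)) -` (A \<times> C) \<inter> space \<beta> = A \<times> P t"
        using A_sub by (auto simp: space_\<beta> C_def P_def)
      then show ?thesis by (subst emeasure_distr) simp_all
    qed
    also have "\<dots> = (\<integral>\<^sup>+x. p t x * indicator A x \<partial>\<mu>)" by (rule p[OF A, symmetric])
    \<comment> \<open>For a good \<open>x\<close> in \<open>A\<close>, the section is the set of
      \<open>u\<close> whose bits start with \<open>t\<close>, of uniform measure
      \<open>p t x\<close>. Integrating the sections gives the product measure.\<close>
    also have "\<dots> = (\<integral>\<^sup>+x. emeasure \<U> (Pair x -` ((\<lambda>(x, u). (x, G (x, u))) -` (A \<times> C) \<inter> space (\<mu> \<Otimes>\<^sub>M \<U>))) \<partial>\<mu>)"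
    proof (rule nn_integral_cong_AE, use AE_good in eventually_elim)
      case (elim x)
      show "p t x * indicator A x = emeasure \<U> (Pair x -` ((\<lambda>(x, u). (x, G (x, u))) -` (A \<times> C) \<inter> space (\<mu> \<Otimes>\<^sub>M \<U>)))"
      proof (cases "x \<in> A")
        case True
        then have "Pair x -` ((\<lambda>(x, u). (x, G (x, u))) -` (A \<times> C) \<inter> space (\<mu> \<Otimes>\<^sub>M \<U>)) =
            {u. bit_prefix (q x) u (length t) = t}"
          using A_sub by (auto simp: space_pair_measure space_\<mu> \<U>_def C_def G_def map_bits_of)
        moreover have "emeasure \<U> {u. bit_prefix (q x) u (length t) = t} = p t x"
          unfolding \<U>_def good_p[OF elim] by (rule emeasure_bit_prefix) (rule good_q[OF elim])+
        ultimately show ?thesis using True by simp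
      next
        case False
        then have "Pair x -` ((\<lambda>(x, u). (x, G (x, u))) -` (A \<times> C) \<inter> space (\<mu> \<Otimes>\<^sub>M \<U>)) = {}" by auto
        then show ?thesis using False by simp
      qed
    qed
    also have "\<dots> = emeasure (\<mu> \<Otimes>\<^sub>M \<U>) ((\<lambda>(x, u). (x, G (x, u))) -` (A \<times> C) \<inter> space (\<mu> \<Otimes>\<^sub>M \<U>))"
      by (rule \<U>.emeasure_pair_measure_alt[symmetric]) measurable
    also have "\<dots> = emeasure ?r (A \<times> C)"
      by (rule emeasure_distr[symmetric]) measurable
    finally show "emeasure ?l (A \<times> C) = emeasure ?r (A \<times> C)" .
  qed simp_all
  then show ?thesis using G unfolding \<mu>_def \<U>_def by blast
qed

text \<open>Bit number \<open>prod_encode (i, j)\<close> of \<open>b w\<close> tells whether entry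
  \<open>i\<close> of the code of \<open>w\<close> equals \<open>j\<close>; \<open>dec\<close>
  recovers the entry as the least \<open>j\<close> whose bit is set. Both \<open>dec\<close> and
  \<open>\<psi>\<close> are total, so decoding applies to every bit sequence that \<open>G\<close>
  may produce.\<close>

theorem noise_outsourcing:
  assumes \<beta>: "prob_space \<beta>" "sets \<beta> = sets (M \<Otimes>\<^sub>M W)" and W: "baire_retract W"
  shows "\<exists>D \<in> M \<Otimes>\<^sub>M borel \<rightarrow>\<^sub>M W.
    \<beta> = distr (distr \<beta> M fst \<Otimes>\<^sub>M uniform_measure lborel {0..<1::real}) (M \<Otimes>\<^sub>M W)
      (\<lambda>(x, u). (x, D (x, u)))"
proof -
  note [measurable_cong] = \<beta>(2)
  obtain \<phi> \<psi> where \<phi>: "\<phi> \<in> W \<rightarrow>\<^sub>M (borel :: (nat \<Rightarrow> nat) measure)" and \<psi>: "\<psi> \<in> borel \<rightarrow>\<^sub>M W"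
    and inv: "\<And>w. w \<in> space W \<Longrightarrow> \<psi> (\<phi> w) = w"
    using baire_retractE[OF W] by blast
  note [measurable] = \<psi>
  have \<phi>_coord [measurable]: "(\<lambda>w. \<phi> w i) \<in> W \<rightarrow>\<^sub>M count_space UNIV" for i
    using \<phi> unfolding measurable_baire_iff by blast
  define b where "b w n = (\<phi> w (fst (prod_decode n)) = snd (prod_decode n))" for w n
  define dec where "dec c = (\<lambda>i. LEAST j. c (prod_encode (i, j)))" for c :: "nat \<Rightarrow> bool"
  have b_pred: "Measurable.pred W (\<lambda>w. b w n)" for n unfolding b_def by measurable
  have b_meas [measurable]: "b \<in> W \<rightarrow>\<^sub>M bit_sequences"
    by (rule measurable_PiM_single') (use b_pred in auto)
  have [measurable]: "dec \<in> bit_sequences \<rightarrow>\<^sub>M borel"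
    unfolding measurable_baire_iff dec_def by measurable
  have dec_b: "dec (b w) = \<phi> w" for w
    by (rule ext) (simp add: dec_def b_def Least_equality)
  obtain G where [measurable]: "G \<in> M \<Otimes>\<^sub>M borel \<rightarrow>\<^sub>M bit_sequences"
    and G: "distr \<beta> (M \<Otimes>\<^sub>M bit_sequences) (\<lambda>(x, w). (x, b w)) =
      distr (distr \<beta> M fst \<Otimes>\<^sub>M uniform_measure lborel {0..<1::real}) (M \<Otimes>\<^sub>M bit_sequences)
        (\<lambda>(x, u). (x, G (x, u)))"
    using exists_bit_kernel[where b=b, OF \<beta> b_pred] by blast
  have "\<beta> = distr \<beta> (M \<Otimes>\<^sub>M W) (\<lambda>z. z)"
    using \<beta>(2) by (intro measure_eqI) (auto simp: emeasure_distr)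
  also have "\<dots> = distr \<beta> (M \<Otimes>\<^sub>M W) ((\<lambda>(x, c). (x, \<psi> (dec c))) \<circ> (\<lambda>(x, w). (x, b w)))"
    by (rule distr_cong)
      (use sets_eq_imp_space_eq[OF \<beta>(2)] in \<open>auto simp: dec_b inv space_pair_measure\<close>)
  also have "\<dots> = distr (distr \<beta> (M \<Otimes>\<^sub>M bit_sequences) (\<lambda>(x, w). (x, b w))) (M \<Otimes>\<^sub>M W) (\<lambda>(x, c). (x, \<psi> (dec c)))"
    by (rule distr_distr[symmetric]) measurable
  also have "\<dots> = distr (distr \<beta> M fst \<Otimes>\<^sub>M uniform_measure lborel {0..<1::real}) (M \<Otimes>\<^sub>M W)
      ((\<lambda>(x, c). (x, \<psi> (dec c))) \<circ> (\<lambda>(x, u). (x, G (x, u))))"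
    unfolding G by (rule distr_distr) measurable
  also have "(\<lambda>(x, c). (x, \<psi> (dec c))) \<circ> (\<lambda>(x, u). (x, G (x, u))) = (\<lambda>(x, u). (x, \<psi> (dec (G (x, u)))))"
    by auto
  finally show ?thesis
    by (intro bexI[of _ "\<lambda>z. \<psi> (dec (G z))"]) (simp_all, measurable)
qed


section \<open>Lower integrals and the total cost\<close>

lemma ennreal_INF_const_add:
  fixes c :: ennreal
  shows "c + (INF i\<in>I. F i) = (INF i\<in>I. c + F i)"
proof (rule antisym)
  show "c + (INF i\<in>I. F i) \<le> (INF i\<in>I. c + F i)"
    by (intro INF_greatest add_left_mono INF_lower)
  show "(INF i\<in>I. c + F i) \<le> c + (INF i\<in>I. F i)"
  proof (cases "c = top")
    case False
    have "(INF i\<in>I. c + F i) - c \<le> (INF i\<in>I. F i)"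
      by (rule INF_greatest) (use False in \<open>auto simp: ennreal_minus_le_iff intro: INF_lower\<close>)
    then show ?thesis using False by (simp add: ennreal_minus_le_iff)
  qed simp
qed

text \<open>Serves for the sum of two transport infima, over couplings at one stage and over joint
  laws of the later stages, whose indices vary independently.\<close>

lemma ennreal_INF_add_INF_greatest:
  fixes a :: "'i \<Rightarrow> ennreal" and b :: "'j \<Rightarrow> ennreal"
  assumes "\<And>i j. i \<in> I \<Longrightarrow> j \<in> J \<Longrightarrow> c \<le> a i + b j"
  shows "c \<le> (INF i\<in>I. a i) + (INF j\<in>J. b j)"
  unfolding ennreal_INF_const_add
  by (rule INF_greatest) (subst add.commute, unfold ennreal_INF_const_add, rule INF_greatest,
    use assms in \<open>simp add: add.commute\<close>)

text \<open>A simple function below \<open>F\<close> plus one below \<open>G\<close> is a simple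
  function below \<open>F + G\<close>. For functions that are not measurable, equality may
  fail.\<close>

lemma nn_integral_superadditive:
  "(\<integral>\<^sup>+x. F x \<partial>M) + (\<integral>\<^sup>+x. G x \<partial>M) \<le> (\<integral>\<^sup>+x. F x + G x \<partial>M)"
proof -
  define S where "S h = {s. simple_function M s \<and> s \<le> h}" for h :: "'a \<Rightarrow> ennreal"
  have ne: "S h \<noteq> {}" for h unfolding S_def by (auto intro!: exI[of _ "\<lambda>_. 0"] simp: le_fun_def)
  have I: "(\<integral>\<^sup>+x. h x \<partial>M) = (SUP s\<in>S h. integral\<^sup>S M s)" for h
    by (simp add: nn_integral_def S_def)
  have le: "integral\<^sup>S M s + integral\<^sup>S M t \<le> (\<integral>\<^sup>+x. F x + G x \<partial>M)" if "s \<in> S F" "t \<in> S G" for s t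
  proof -
    have "integral\<^sup>S M s + integral\<^sup>S M t = (\<integral>\<^sup>+x. s x \<partial>M) + (\<integral>\<^sup>+x. t x \<partial>M)"
      using that by (simp add: S_def nn_integral_eq_simple_integral)
    also have "\<dots> = (\<integral>\<^sup>+x. s x + t x \<partial>M)"
      using that by (intro nn_integral_add[symmetric]) (auto simp: S_def borel_measurable_simple_function)
    also have "\<dots> \<le> (\<integral>\<^sup>+x. F x + G x \<partial>M)"
      using that by (intro nn_integral_mono add_mono) (auto simp: S_def le_fun_def)
    finally show ?thesis .
  qed
  show ?thesis
    unfolding I[of F] I[of G] ennreal_SUP_add_left[OF ne, symmetric] ennreal_SUP_add_right[OF ne]
    by (intro SUP_least le)
qed

text \<open>Subtracting the finite constant from a simple function below \<open>F + c\<close> leaves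
  one below \<open>F\<close>; truncation at zero only helps, as adding \<open>c\<close> again gives
  at least the original function.\<close>

lemma nn_integral_add_const_le:
  assumes "prob_space M" "c < top"
  shows "(\<integral>\<^sup>+x. F x + c \<partial>M) \<le> (\<integral>\<^sup>+x. F x \<partial>M) + c"
  unfolding nn_integral_def[of M "\<lambda>x. F x + c"]
proof (rule SUP_least, elim CollectE conjE)
  fix s assume s: "simple_function M s" "s \<le> (\<lambda>x. F x + c)"
  note [measurable] = borel_measurable_simple_function[OF s(1)]
  have "integral\<^sup>S M s = (\<integral>\<^sup>+x. s x \<partial>M)" by (simp add: nn_integral_eq_simple_integral s)
  also have "\<dots> \<le> (\<integral>\<^sup>+x. (s x - c) + c \<partial>M)"
    using assms(2) by (intro nn_integral_mono) (metis ennreal_minus_le_iff add.commute order_refl top.not_eq_extremum)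
  also have "\<dots> = (\<integral>\<^sup>+x. s x - c \<partial>M) + c"
    by (subst nn_integral_add) (auto simp: prob_space.emeasure_space_1[OF assms(1)])
  also have "\<dots> \<le> (\<integral>\<^sup>+x. F x \<partial>M) + c"
    using s(2) assms(2) by (intro add_right_mono nn_integral_mono)
      (auto simp: le_fun_def ennreal_minus_le_iff add.commute)
  finally show "integral\<^sup>S M s \<le> (\<integral>\<^sup>+x. F x \<partial>M) + c" .
qed

text \<open>A simple function below \<open>F\<close> pulls back to one below the composition with
  \<open>T\<close>. The reverse inequality may fail, since functions below the composition need not
  factor through \<open>T\<close>.\<close>

lemma nn_integral_distr_le:
  assumes T: "T \<in> M \<rightarrow>\<^sub>M M'"
  shows "(\<integral>\<^sup>+x. F x \<partial>distr M M' T) \<le> (\<integral>\<^sup>+x. F (T x) \<partial>M)"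
  unfolding nn_integral_def[of "distr M M' T" F]
proof (rule SUP_least, elim CollectE conjE)
  fix s assume s: "simple_function (distr M M' T) s" "s \<le> F"
  have "integral\<^sup>S (distr M M' T) s = (\<integral>\<^sup>+x. s x \<partial>distr M M' T)"
    by (simp add: nn_integral_eq_simple_integral s)
  also have "\<dots> = (\<integral>\<^sup>+x. s (T x) \<partial>M)"
    using T borel_measurable_simple_function[OF s(1)] by (intro nn_integral_distr) auto
  also have "\<dots> \<le> (\<integral>\<^sup>+x. F (T x) \<partial>M)"
    using s(2) by (intro nn_integral_mono) (auto simp: le_fun_def)
  finally show "integral\<^sup>S (distr M M' T) s \<le> (\<integral>\<^sup>+x. F (T x) \<partial>M)" .
qed

text \<open>Lets the estimates for \<open>ground k\<close> work with lower integrals against the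
  plan itself.\<close>

lemma plan_cost_eq: "plan_cost c \<gamma> = (\<integral>\<^sup>+z. c z \<partial>\<gamma>)"
  unfolding plan_cost_def by (rule nn_integral_completion)

section \<open>The control problem and its unrolled cost\<close>

locale control_problem =
  fixes N :: nat
    and X :: "nat \<Rightarrow> 'x topology"
    and U :: "nat \<Rightarrow> 'u topology"
    and R :: "nat \<Rightarrow> 'r topology"
    and f :: "nat \<Rightarrow> 'x \<times> 'u \<Rightarrow> 'x"
    and g :: "nat \<Rightarrow> ('x \<times> 'u) \<times> 'r \<Rightarrow> ennreal"
    and gN :: "'x \<times> 'r \<Rightarrow> ennreal"
  assumes X: "\<And>k. k \<le> N \<Longrightarrow> polish_topology (X k)"
    and U: "\<And>k. k < N \<Longrightarrow> polish_topology (U k)"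
    and R: "\<And>k. k \<le> N \<Longrightarrow> polish_topology (R k)"
    and f: "\<And>k. k < N \<Longrightarrow>
      f k \<in> borel_of (X k) \<Otimes>\<^sub>M borel_of (U k) \<rightarrow>\<^sub>M borel_of (X (Suc k))"
    and g: "\<And>k. k < N \<Longrightarrow>
      g k \<in> borel_measurable ((borel_of (X k) \<Otimes>\<^sub>M borel_of (U k)) \<Otimes>\<^sub>M borel_of (R k))"
    and gN: "gN \<in> borel_measurable (borel_of (X N) \<Otimes>\<^sub>M borel_of (R N))"
begin

abbreviation "inputs k \<equiv> Pi\<^sub>M {k..<N} (\<lambda>i. borel_of (U i))"
abbreviation "refs k \<equiv> Pi\<^sub>M {k..N} (\<lambda>i. borel_of (R i))"
abbreviation "stage k \<equiv> borel_of (X k) \<Otimes>\<^sub>M (inputs k \<Otimes>\<^sub>M refs k)"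

function total_cost :: "nat \<Rightarrow> 'x \<Rightarrow> (nat \<Rightarrow> 'u) \<Rightarrow> (nat \<Rightarrow> 'r) \<Rightarrow> ennreal" where
  "total_cost k x v r =
    (if k < N then g k ((x, v k), r k) + total_cost (Suc k) (f k (x, v k)) v r else gN (x, r N))"
  by pat_completeness auto
termination by (relation "Wellfounded.measure (\<lambda>(k, x, v, r). N - k)") auto

declare total_cost.simps [simp del]

lemma total_cost_N: "total_cost N x v r = gN (x, r N)"
  by (simp add: total_cost.simps[of N])

lemma total_cost_Suc: "k < N \<Longrightarrow>
    total_cost k x v r = g k ((x, v k), r k) + total_cost (Suc k) (f k (x, v k)) v r"
  by (simp add: total_cost.simps[of k])

lemma total_cost_cong:
  assumes "k \<le> N" "\<And>i. i \<in> {k..<N} \<Longrightarrow> v i = v' i" "\<And>i. i \<in> {k..N} \<Longrightarrow> r i = r' i"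
  shows "total_cost k x v r = total_cost k x v' r'"
  using assms
proof (induction k arbitrary: x rule: inc_induct)
  case (step k)
  have "total_cost (Suc k) y v r = total_cost (Suc k) y v' r'" for y
    by (rule step.IH) (use step.prems in auto)
  then show ?case using step.prems(1)[of k] step.prems(2)[of k] step.hyps by (simp add: total_cost_Suc)
qed (simp add: total_cost_N)

text \<open>The index sets may exceed what stage \<open>k\<close> reads, so that the backward
  induction keeps both index sets and only the state space changes.\<close>

lemma measurable_total_cost:
  assumes "k \<le> N" "{k..<N} \<subseteq> I" "{k..N} \<subseteq> J"
  shows "(\<lambda>z. total_cost k (fst z) (fst (snd z)) (snd (snd z))) \<in> borel_measurable
    (borel_of (X k) \<Otimes>\<^sub>M (Pi\<^sub>M I (\<lambda>i. borel_of (U i)) \<Otimes>\<^sub>M Pi\<^sub>M J (\<lambda>i. borel_of (R i))))"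
  using assms
proof (induction k rule: inc_induct)
  case base
  then have [measurable]: "(\<lambda>r. r N) \<in> Pi\<^sub>M J (\<lambda>i. borel_of (R i)) \<rightarrow>\<^sub>M borel_of (R N)"
    by (intro measurable_component_singleton) auto
  note gN [measurable]
  show ?case unfolding total_cost_N by measurable
next
  case (step k)
  have [measurable]: "(\<lambda>r. r k) \<in> Pi\<^sub>M J (\<lambda>i. borel_of (R i)) \<rightarrow>\<^sub>M borel_of (R k)"
    "(\<lambda>r. r k) \<in> Pi\<^sub>M I (\<lambda>i. borel_of (U i)) \<rightarrow>\<^sub>M borel_of (U k)"
    using step by (auto intro!: measurable_component_singleton)
  note g[OF step.hyps(2), measurable] f[OF step.hyps(2), measurable]
  let ?M = "\<lambda>k. borel_of (X k) \<Otimes>\<^sub>M (Pi\<^sub>M I (\<lambda>i. borel_of (U i)) \<Otimes>\<^sub>M Pi\<^sub>M J (\<lambda>i. borel_of (R i)))"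
  have "(\<lambda>z. (f k (fst z, fst (snd z) k), snd z)) \<in> ?M k \<rightarrow>\<^sub>M ?M (Suc k)" by measurable
  moreover have "(\<lambda>z. total_cost (Suc k) (fst z) (fst (snd z)) (snd (snd z))) \<in> borel_measurable (?M (Suc k))"
    using step.prems by (intro step.IH) auto
  ultimately have "(\<lambda>z. total_cost (Suc k) (fst (f k (fst z, fst (snd z) k), snd z))
      (fst (snd (f k (fst z, fst (snd z) k), snd z))) (snd (snd (f k (fst z, fst (snd z) k), snd z))))
      \<in> borel_measurable (?M k)"
    by (rule measurable_compose)
  then have "(\<lambda>z. total_cost (Suc k) (f k (fst z, fst (snd z) k)) (fst (snd z)) (snd (snd z)))
      \<in> borel_measurable (?M k)"
    by simp
  then show ?case unfolding total_cost_Suc[OF step.hyps(2)] by measurable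
qed

lemma measurable_total_cost_stage [measurable]:
  "k \<le> N \<Longrightarrow> (\<lambda>z. total_cost k (fst z) (fst (snd z)) (snd (snd z))) \<in> borel_measurable (stage k)"
  by (rule measurable_total_cost) auto

abbreviation "ground k \<equiv> ground_cost_to_go N U f g gN k"

text \<open>Nested infima over \<open>u\<close> and the later inputs form one infimum over the
  product: \<open>v(k := u)\<close> and restriction pass between the two, and
  \<open>total_cost\<close> does not see the entries that differ. At stage \<open>N\<close> the
  input product is a single point; an empty space among the remaining inputs makes both sides
  infinite.\<close>

lemma ground_cost_to_go_eq:
  assumes "k \<le> N"
  shows "ground k (x, r) = (INF v\<in>space (inputs k). total_cost k x v r)"
  using assms
proof (induction k arbitrary: x r rule: inc_induct)
  case base
  then show ?case by (simp add: ground_cost_to_go.simps[of N] total_cost_N space_PiM)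
next
  case (step k)
  have "ground k (x, r) =
      (INF u\<in>topspace (U k). g k ((x, u), r k) +
        (INF v\<in>space (inputs (Suc k)). total_cost (Suc k) (f k (x, u)) v (restrict r {Suc k..N})))"
    by (subst ground_cost_to_go.simps) (simp only: step.hyps if_True step.IH)
  also have "\<dots> = (INF u\<in>topspace (U k). INF v\<in>space (inputs (Suc k)).
      g k ((x, u), r k) + total_cost (Suc k) (f k (x, u)) v r)"
    unfolding ennreal_INF_const_add
    by (intro INF_cong refl arg_cong2[of _ _ _ _ "(+)"] total_cost_cong) (use step.hyps in auto)
  also have "\<dots> = (INF v\<in>space (inputs k). total_cost k x v r)"
  proof (rule antisym)
    show "(INF u\<in>topspace (U k). INF v\<in>space (inputs (Suc k)).
        g k ((x, u), r k) + total_cost (Suc k) (f k (x, u)) v r) \<le> (INF v\<in>space (inputs k). total_cost k x v r)"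
    proof (rule INF_greatest)
      fix v assume v: "v \<in> space (inputs k)"
      have "v k \<in> topspace (U k)" "restrict v {Suc k..<N} \<in> space (inputs (Suc k))"
        using v step.hyps by (auto simp: space_PiM PiE_iff)
      moreover have "total_cost k x v r = g k ((x, v k), r k) + total_cost (Suc k) (f k (x, v k)) (restrict v {Suc k..<N}) r"
        unfolding total_cost_Suc[OF step.hyps(2)]
        by (intro arg_cong2[of _ _ _ _ "(+)"] refl total_cost_cong) (use step.hyps in auto)
      ultimately show "(INF u\<in>topspace (U k). INF v\<in>space (inputs (Suc k)).
          g k ((x, u), r k) + total_cost (Suc k) (f k (x, u)) v r) \<le> total_cost k x v r"
        by (intro INF_lower2[of "v k"] INF_lower2[of "restrict v {Suc k..<N}"]) auto
    qed
    show "(INF v\<in>space (inputs k). total_cost k x v r) \<le> (INF u\<in>topspace (U k). INF v\<in>space (inputs (Suc k)).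
        g k ((x, u), r k) + total_cost (Suc k) (f k (x, u)) v r)"
    proof (intro INF_greatest)
      fix u v assume u: "u \<in> topspace (U k)" and v: "v \<in> space (inputs (Suc k))"
      have "v(k := u) \<in> space (inputs k)"
        using u v step.hyps by (auto simp: space_PiM PiE_iff extensional_def)
      moreover have "total_cost k x (v(k := u)) r = g k ((x, u), r k) + total_cost (Suc k) (f k (x, u)) v r"
        unfolding total_cost_Suc[OF step.hyps(2)] fun_upd_same
        by (intro arg_cong2[of _ _ _ _ "(+)"] refl total_cost_cong) (use step.hyps in auto)
      ultimately show "(INF v\<in>space (inputs k). total_cost k x v r) \<le>
          g k ((x, u), r k) + total_cost (Suc k) (f k (x, u)) v r"
        by (metis INF_lower)
    qed
  qed
  finally show ?case .
qed

end


section \<open>Joint plans\<close>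

lemma prob_measuresD:
  assumes "\<mu> \<in> prob_measures M"
  shows "sets \<mu> = sets M" "prob_space \<mu>" "space \<mu> = space M"
  using assms sets_eq_imp_space_eq[of \<mu> M] by (auto simp: space_prob_algebra)

lemma prob_measures_distr:
  assumes "\<mu> \<in> prob_measures M" "T \<in> M \<rightarrow>\<^sub>M M'" "sets L = sets M'"
  shows "distr \<mu> L T \<in> prob_measures M'"
proof -
  have "T \<in> \<mu> \<rightarrow>\<^sub>M L"
    using assms by (simp add: measurable_cong_sets[OF prob_measuresD(1)[OF assms(1)] assms(3)])
  then show ?thesis
    using prob_space.prob_space_distr[OF prob_measuresD(2)[OF assms(1)]] assms(3)
    by (simp add: space_prob_algebra)
qed

text \<open>The form of the composition rule that checks marginals of an image law by comparing maps
  only on the space of the original law.\<close>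

lemma distr_distr_cong:
  assumes "T \<in> M \<rightarrow>\<^sub>M M'" "S \<in> M' \<rightarrow>\<^sub>M L" "\<And>x. x \<in> space M \<Longrightarrow> S (T x) = S' x"
  shows "distr (distr M M' T) L S = distr M L S'"
  unfolding distr_distr[OF assms(2,1)] by (rule distr_cong) (auto simp: assms(3))

context control_problem
begin

definition plans :: "nat \<Rightarrow> 'x measure \<Rightarrow> (nat \<Rightarrow> 'r measure) \<Rightarrow>
    ('x \<times> (nat \<Rightarrow> 'u) \<times> (nat \<Rightarrow> 'r)) measure set" where
  "plans k \<mu> \<rho> = {\<gamma> \<in> prob_measures (stage k). distr \<gamma> (borel_of (X k)) fst = \<mu> \<and>
    (\<forall>i\<in>{k..N}. distr \<gamma> (\<rho> i) (\<lambda>z. snd (snd z) i) = \<rho> i)}"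

text \<open>The quantity \<open>L k\<close> of the outline. At the stages \<open>k \<le> N\<close>
  its integrand is Borel, in contrast to \<open>ground k\<close>.\<close>

definition plan_value :: "nat \<Rightarrow> 'x measure \<Rightarrow> (nat \<Rightarrow> 'r measure) \<Rightarrow> ennreal" where
  "plan_value k \<mu> \<rho> =
    (INF \<gamma>\<in>plans k \<mu> \<rho>. \<integral>\<^sup>+z. total_cost k (fst z) (fst (snd z)) (snd (snd z)) \<partial>\<gamma>)"

definition refs_prob :: "nat \<Rightarrow> (nat \<Rightarrow> 'r measure) \<Rightarrow> bool" where
  "refs_prob k \<rho> \<longleftrightarrow> (\<forall>i\<in>{k..N}. \<rho> i \<in> prob_measures (borel_of (R i)))"

lemma refs_prob_Suc: "refs_prob k \<rho> \<Longrightarrow> refs_prob (Suc k) \<rho>"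
  by (auto simp: refs_prob_def)

lemma refs_prob_sets:
  assumes "refs_prob k \<rho>"
  shows "i \<in> {k..N} \<Longrightarrow> sets (\<rho> i) = sets (borel_of (R i))" "sets (Pi\<^sub>M {k..N} \<rho>) = sets (refs k)"
proof -
  show eq: "sets (\<rho> i) = sets (borel_of (R i))" if "i \<in> {k..N}" for i
    using assms that unfolding refs_prob_def by (intro prob_measuresD(1)) blast
  show "sets (Pi\<^sub>M {k..N} \<rho>) = sets (refs k)" by (intro sets_PiM_cong refl eq)
qed

lemma baire_retract_inputs:
  assumes "k \<le> N" "space (inputs k) \<noteq> {}"
  shows "baire_retract (inputs k)"
proof (rule baire_retract_PiM, rule polish_baire_retract)
  fix i assume i: "i \<in> {k..<N}"
  then show "polish_topology (U i)" by (intro U) auto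
  obtain v where "v \<in> space (inputs k)" using assms(2) by blast
  then have "v i \<in> topspace (U i)" using i by (auto simp: space_PiM PiE_iff)
  then show "topspace (U i) \<noteq> {}" by auto
qed

lemma baire_retract_refs:
  assumes "refs_prob k \<rho>"
  shows "baire_retract (refs k)"
proof (rule baire_retract_PiM, rule polish_baire_retract)
  fix i assume i: "i \<in> {k..N}"
  then show "polish_topology (R i)" by (intro R) auto
  have "\<rho> i \<in> prob_measures (borel_of (R i))" using assms i by (simp add: refs_prob_def)
  then show "topspace (R i) \<noteq> {}"
    using prob_measuresD(2,3)[of "\<rho> i"] prob_space.not_empty[of "\<rho> i"] by fastforce
qed

text \<open>Forgetting the inputs turns a joint law into a plan, and \<open>ground k\<close> is at
  most the total cost of any inputs. Conversely, inserting selected inputs into a plan adds at most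
  \<open>\<delta>\<close> to its cost, with \<open>\<delta>\<close> arbitrary.\<close>

lemma plan_value_eq_multi_transport_cost:
  assumes k: "k \<le> N" and \<mu>: "\<mu> \<in> prob_measures (borel_of (X k))" and \<rho>: "refs_prob k \<rho>"
  shows "plan_value k \<mu> \<rho> = multi_transport_cost (ground k) \<mu> {k..N} \<rho>"
proof (rule antisym)
  note sets_\<mu> = prob_measuresD(1)[OF \<mu>]
  note sets_\<rho> = refs_prob_sets[OF \<rho>]
  have sets_prod: "sets (\<mu> \<Otimes>\<^sub>M Pi\<^sub>M {k..N} \<rho>) = sets (borel_of (X k) \<Otimes>\<^sub>M refs k)"
    by (intro sets_pair_measure_cong sets_\<mu> sets_\<rho>)
  have multi_iff: "\<gamma> \<in> multi_couplings \<mu> {k..N} \<rho> \<longleftrightarrow>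
      \<gamma> \<in> prob_measures (borel_of (X k) \<Otimes>\<^sub>M refs k) \<and> distr \<gamma> (borel_of (X k)) fst = \<mu> \<and>
      (\<forall>i\<in>{k..N}. distr \<gamma> (\<rho> i) (\<lambda>z. snd z i) = \<rho> i)" for \<gamma>
  proof -
    have "distr \<gamma> \<mu> fst = distr \<gamma> (borel_of (X k)) fst" by (rule distr_cong) (auto simp: sets_\<mu>)
    then show ?thesis
      unfolding multi_couplings_def by (simp add: space_prob_algebra sets_prod case_prod_unfold)
  qed
  have comp: "(\<lambda>r. r i) \<in> refs k \<rightarrow>\<^sub>M \<rho> i" if "i \<in> {k..N}" for i
    unfolding measurable_cong_sets[OF refl sets_\<rho>(1)[OF that]] by (rule measurable_component_singleton[OF that])
  show "multi_transport_cost (ground k) \<mu> {k..N} \<rho> \<le> plan_value k \<mu> \<rho>"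
    unfolding plan_value_def
  proof (rule INF_greatest)
    fix \<gamma> assume \<gamma>: "\<gamma> \<in> plans k \<mu> \<rho>"
    then have \<gamma>P: "\<gamma> \<in> prob_measures (stage k)" by (simp add: plans_def)
    note [measurable_cong] = prob_measuresD(1)[OF \<gamma>P]
    let ?M = "borel_of (X k) \<Otimes>\<^sub>M refs k"
    let ?T = "\<lambda>z :: 'x \<times> (nat \<Rightarrow> 'u) \<times> (nat \<Rightarrow> 'r). (fst z, snd (snd z))"
    have T: "?T \<in> \<gamma> \<rightarrow>\<^sub>M ?M" by measurable
    have "distr \<gamma> ?M ?T \<in> multi_couplings \<mu> {k..N} \<rho>"
      unfolding multi_iff
    proof (intro conjI ballI)
      show "distr \<gamma> ?M ?T \<in> prob_measures ?M" by (rule prob_measures_distr[OF \<gamma>P]) auto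
      have "distr (distr \<gamma> ?M ?T) (borel_of (X k)) fst = distr \<gamma> (borel_of (X k)) fst"
        by (rule distr_distr_cong[OF T]) auto
      then show "distr (distr \<gamma> ?M ?T) (borel_of (X k)) fst = \<mu>" using \<gamma> by (simp add: plans_def)
      fix i assume i: "i \<in> {k..N}"
      have "distr (distr \<gamma> ?M ?T) (\<rho> i) (\<lambda>z. snd z i) = distr \<gamma> (\<rho> i) (\<lambda>z. snd (snd z) i)"
        by (rule distr_distr_cong[OF T measurable_compose[OF measurable_snd comp[OF i]]]) simp
      then show "distr (distr \<gamma> ?M ?T) (\<rho> i) (\<lambda>z. snd z i) = \<rho> i" using \<gamma> i by (simp add: plans_def)
    qed
    then have "multi_transport_cost (ground k) \<mu> {k..N} \<rho> \<le> plan_cost (ground k) (distr \<gamma> ?M ?T)"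
      unfolding multi_transport_cost_def by (rule INF_lower)
    also have "\<dots> \<le> (\<integral>\<^sup>+z. ground k (?T z) \<partial>\<gamma>)"
      unfolding plan_cost_eq by (rule nn_integral_distr_le[OF T])
    also have "\<dots> \<le> (\<integral>\<^sup>+z. total_cost k (fst z) (fst (snd z)) (snd (snd z)) \<partial>\<gamma>)"
      unfolding ground_cost_to_go_eq[OF k]
      by (intro nn_integral_mono INF_lower) (auto simp: prob_measuresD(3)[OF \<gamma>P] space_pair_measure)
    finally show "multi_transport_cost (ground k) \<mu> {k..N} \<rho> \<le>
        (\<integral>\<^sup>+z. total_cost k (fst z) (fst (snd z)) (snd (snd z)) \<partial>\<gamma>)" .
  qed
  show "plan_value k \<mu> \<rho> \<le> multi_transport_cost (ground k) \<mu> {k..N} \<rho>"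
    unfolding multi_transport_cost_def
  proof (rule INF_greatest)
    fix \<gamma> assume "\<gamma> \<in> multi_couplings \<mu> {k..N} \<rho>"
    then have \<gamma>P: "\<gamma> \<in> prob_measures (borel_of (X k) \<Otimes>\<^sub>M refs k)"
      and \<gamma>_fst: "distr \<gamma> (borel_of (X k)) fst = \<mu>"
      and \<gamma>_ref: "\<And>i. i \<in> {k..N} \<Longrightarrow> distr \<gamma> (\<rho> i) (\<lambda>z. snd z i) = \<rho> i"
      unfolding multi_iff by auto
    note sets_\<gamma> [measurable_cong] = prob_measuresD(1)[OF \<gamma>P]
    interpret \<gamma>: prob_space \<gamma> by (rule prob_measuresD(2)[OF \<gamma>P])
    show "plan_value k \<mu> \<rho> \<le> plan_cost (ground k) \<gamma>"
    \<comment> \<open>An empty input product admits no selector, but then \<open>ground k\<close> is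
      infinite everywhere, and so is its integral against a probability measure.\<close>
    proof (cases "space (inputs k) = {}")
      case True
      then have "ground k z = top" for z by (cases z) (simp only: ground_cost_to_go_eq[OF k] image_empty Inf_empty)
      then show ?thesis by (simp add: plan_cost_eq \<gamma>.emeasure_space_1)
    next
      case False
      show ?thesis
      proof (rule ennreal_le_epsilon)
        fix \<delta> :: real assume "0 < \<delta>"
        let ?h = "\<lambda>(y, v). total_cost k (fst y) v (snd y)"
        have h: "?h \<in> borel_measurable (\<gamma> \<Otimes>\<^sub>M inputs k)"
        proof -
          have "(\<lambda>p. (fst (fst p), snd p, snd (fst p))) \<in> \<gamma> \<Otimes>\<^sub>M inputs k \<rightarrow>\<^sub>M stage k" by measurable
          from measurable_compose[OF this measurable_total_cost_stage[OF k]]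
          show ?thesis by (simp add: case_prod_beta)
        qed
        obtain s where s: "s \<in> completion \<gamma> \<rightarrow>\<^sub>M inputs k"
          and opt: "\<And>y. y \<in> space \<gamma> \<Longrightarrow> ?h (y, s y) \<le> (INF v\<in>space (inputs k). ?h (y, v)) + ennreal \<delta>"
          using near_minimal_selection[OF \<gamma>.finite_measure_axioms baire_retract_inputs[OF k False] h \<open>0 < \<delta>\<close>]
          by blast
        let ?T = "\<lambda>z. (fst z, s z, snd z)"
        have fst_\<gamma>: "fst \<in> \<gamma> \<rightarrow>\<^sub>M borel_of (X k)" and snd_\<gamma>: "snd \<in> \<gamma> \<rightarrow>\<^sub>M refs k" by measurable
        have T: "?T \<in> completion \<gamma> \<rightarrow>\<^sub>M stage k"
          by (intro measurable_Pair s measurable_completion fst_\<gamma> snd_\<gamma>)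
        \<comment> \<open>The selector is measurable for the completion only, so it is the completed
          plan that is pushed forward. The image is a law on the Borel sets again, and completing
          leaves the marginals in the Borel coordinates unchanged.\<close>
        let ?\<gamma> = "distr (completion \<gamma>) (stage k) ?T"
        have "prob_space (completion \<gamma>)"
          by (rule prob_spaceI) (simp add: \<gamma>.emeasure_space_1)
        then have \<gamma>'P: "?\<gamma> \<in> prob_measures (stage k)"
          using T by (auto simp: space_prob_algebra intro: prob_space.prob_space_distr)
        have "?\<gamma> \<in> plans k \<mu> \<rho>"
          unfolding plans_def
        proof (intro CollectI conjI ballI \<gamma>'P)
          have "distr ?\<gamma> (borel_of (X k)) fst = distr (completion \<gamma>) (borel_of (X k)) fst"
            by (rule distr_distr_cong[OF T]) auto
          also have "\<dots> = \<mu>" by (simp add: distr_completion[OF fst_\<gamma>] \<gamma>_fst)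
          finally show "distr ?\<gamma> (borel_of (X k)) fst = \<mu>" .
          fix i assume i: "i \<in> {k..N}"
          have "distr ?\<gamma> (\<rho> i) (\<lambda>z. snd (snd z) i) = distr (completion \<gamma>) (\<rho> i) (\<lambda>z. snd z i)"
            by (rule distr_distr_cong[OF T])
              (auto intro!: measurable_compose[OF _ comp[OF i]])
          also have "\<dots> = \<rho> i"
            unfolding distr_completion[OF measurable_compose[OF snd_\<gamma> comp[OF i]]] by (rule \<gamma>_ref[OF i])
          finally show "distr ?\<gamma> (\<rho> i) (\<lambda>z. snd (snd z) i) = \<rho> i" .
        qed
        then have "plan_value k \<mu> \<rho> \<le> (\<integral>\<^sup>+z. total_cost k (fst z) (fst (snd z)) (snd (snd z)) \<partial>?\<gamma>)"
          unfolding plan_value_def by (rule INF_lower)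
        also have "\<dots> = (\<integral>\<^sup>+y. total_cost k (fst y) (s y) (snd y) \<partial>completion \<gamma>)"
          by (subst nn_integral_distr[OF T]) (simp_all add: measurable_total_cost_stage[OF k])
        also have "\<dots> \<le> (\<integral>\<^sup>+y. ground k y + ennreal \<delta> \<partial>completion \<gamma>)"
        proof (rule nn_integral_mono)
          fix y assume "y \<in> space (completion \<gamma>)"
          then show "total_cost k (fst y) (s y) (snd y) \<le> ground k y + ennreal \<delta>"
            using opt[of y] by (cases y) (simp add: ground_cost_to_go_eq[OF k])
        qed
        also have "\<dots> = (\<integral>\<^sup>+y. ground k y + ennreal \<delta> \<partial>\<gamma>)" by (rule nn_integral_completion)
        also have "\<dots> \<le> plan_cost (ground k) \<gamma> + ennreal \<delta>"
          unfolding plan_cost_eq by (rule nn_integral_add_const_le[OF \<gamma>.prob_space_axioms]) simp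
        finally show "plan_value k \<mu> \<rho> \<le> plan_cost (ground k) \<gamma> + ennreal \<delta>" .
      qed
    qed
  qed
qed


section \<open>Gluing and splitting\<close>

text \<open>The later stages are rerun from the state that \<open>\<alpha>\<close> produces: in the
  representation of \<open>\<beta>\<close> as the law of \<open>(x', D (x', \<omega>))\<close>, the
  point \<open>x'\<close> is replaced by \<open>f k (x, u)\<close>, with noise independent of
  \<open>\<alpha>\<close>. The resulting joint law has \<open>\<alpha>\<close> as its current part
  and \<open>\<beta>\<close> as its tail, and its cost is the sum of theirs.\<close>

lemma plan_value_gluing:
  assumes k: "k < N" and \<mu>: "\<mu> \<in> prob_measures (borel_of (X k))" and \<rho>: "refs_prob k \<rho>"
    and \<Lambda>: "\<Lambda> \<in> state_input_measures (X k) (U k) \<mu>"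
    and \<alpha>: "\<alpha> \<in> couplings \<Lambda> (\<rho> k)"
    and \<beta>: "\<beta> \<in> plans (Suc k) (distr \<Lambda> (borel_of (X (Suc k))) (f k)) \<rho>"
  shows "plan_value k \<mu> \<rho> \<le> (\<integral>\<^sup>+z. g k z \<partial>\<alpha>) +
    (\<integral>\<^sup>+z. total_cost (Suc k) (fst z) (fst (snd z)) (snd (snd z)) \<partial>\<beta>)"
proof -
  note f [OF k, measurable] g [OF k, measurable]
  note sets_\<rho> = refs_prob_sets[OF \<rho>]
  let ?W = "inputs (Suc k) \<Otimes>\<^sub>M refs (Suc k)"
  let ?X' = "borel_of (X (Suc k))"
  let ?XU = "borel_of (X k) \<Otimes>\<^sub>M borel_of (U k)"
  have \<Lambda>P: "\<Lambda> \<in> prob_measures ?XU" and \<Lambda>_fst: "distr \<Lambda> (borel_of (X k)) fst = \<mu>"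
    using \<Lambda> by (auto simp: state_input_measures_def)
  note sets_\<Lambda> [measurable_cong] = prob_measuresD(1)[OF \<Lambda>P]
  have sets_\<rho>k [measurable_cong]: "sets (\<rho> k) = sets (borel_of (R k))"
    by (rule sets_\<rho>(1)) (use k in auto)
  have sets_\<alpha>: "sets \<alpha> = sets (\<Lambda> \<Otimes>\<^sub>M \<rho> k)" and \<alpha>_fst: "distr \<alpha> \<Lambda> fst = \<Lambda>"
    and \<alpha>_snd: "distr \<alpha> (\<rho> k) snd = \<rho> k" and "prob_space \<alpha>"
    using \<alpha> by (auto simp: couplings_def space_prob_algebra)
  interpret \<alpha>: prob_space \<alpha> by fact
  have sets_\<alpha>' [measurable_cong]: "sets \<alpha> = sets (?XU \<Otimes>\<^sub>M borel_of (R k))"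
    unfolding sets_\<alpha> by (intro sets_pair_measure_cong sets_\<Lambda> sets_\<rho>k)
  have \<beta>P: "\<beta> \<in> prob_measures (stage (Suc k))"
    and \<beta>_fst: "distr \<beta> ?X' fst = distr \<Lambda> ?X' (f k)"
    and \<beta>_ref: "\<And>i. i \<in> {Suc k..N} \<Longrightarrow> distr \<beta> (\<rho> i) (\<lambda>z. snd (snd z) i) = \<rho> i"
    using \<beta> by (auto simp: plans_def)
  note sets_\<beta> = prob_measuresD(1)[OF \<beta>P] and prob_\<beta> = prob_measuresD(2)[OF \<beta>P]
  \<comment> \<open>A probability measure on a product with these inputs excludes that their space
    is empty.\<close>
  have "space (inputs (Suc k)) \<noteq> {}"
    using prob_space.not_empty[OF prob_\<beta>] prob_measuresD(3)[OF \<beta>P] by (auto simp: space_pair_measure)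
  then have W: "baire_retract ?W"
    using k by (intro baire_retract_pair baire_retract_inputs baire_retract_refs[of _ \<rho>] refs_prob_Suc \<rho>) auto
  define \<U> where "\<U> = uniform_measure lborel {0..<1::real}"
  have sets_\<U> [measurable_cong]: "sets \<U> = sets borel" by (simp add: \<U>_def)
  interpret \<U>: prob_space \<U> unfolding \<U>_def by (rule prob_space_uniform_measure) auto
  obtain D where D [measurable]: "D \<in> ?X' \<Otimes>\<^sub>M borel \<rightarrow>\<^sub>M ?W"
    and \<beta>_D: "\<beta> = distr (distr \<Lambda> ?X' (f k) \<Otimes>\<^sub>M \<U>) (stage (Suc k)) (\<lambda>(x, u). (x, D (x, u)))"
    using noise_outsourcing[OF prob_\<beta> sets_\<beta> W] unfolding \<beta>_fst \<U>_def by blast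
  interpret \<alpha>\<U>: pair_prob_space \<alpha> \<U> ..
  let ?P = "\<alpha> \<Otimes>\<^sub>M \<U>"
  let ?F = "\<lambda>z. (f k (fst (fst z)), snd z)"
  \<comment> \<open>The noise stays independent when the dynamics act on the first factor, so the
    representation of \<open>\<beta>\<close> can be realised on \<open>?P\<close>.\<close>
  have F_distr: "distr ?P (?X' \<Otimes>\<^sub>M borel) ?F = distr \<Lambda> ?X' (f k) \<Otimes>\<^sub>M \<U>"
  proof -
    have "distr \<Lambda> ?X' (f k) = distr \<alpha> ?X' (\<lambda>z. f k (fst z))"
    proof -
      have "distr (distr \<alpha> \<Lambda> fst) ?X' (f k) = distr \<alpha> ?X' (\<lambda>z. f k (fst z))"
        by (rule distr_distr_cong) auto
      then show ?thesis by (simp add: \<alpha>_fst)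
    qed
    moreover have "\<U> = distr \<U> borel (\<lambda>u. u)" by (rule distr_id2[symmetric]) (simp add: sets_\<U>)
    ultimately have "distr \<Lambda> ?X' (f k) \<Otimes>\<^sub>M \<U> =
        distr \<alpha> ?X' (\<lambda>z. f k (fst z)) \<Otimes>\<^sub>M distr \<U> borel (\<lambda>u. u)" by simp
    also have "\<dots> = distr ?P (?X' \<Otimes>\<^sub>M borel) (\<lambda>(z, u). (f k (fst z), u))"
    proof (rule pair_measure_distr)
      show "sigma_finite_measure (distr \<U> borel (\<lambda>u. u))"
        by (intro prob_space_imp_sigma_finite \<U>.prob_space_distr) measurable
    qed measurable
    finally show ?thesis by (simp add: case_prod_unfold)
  qed
  let ?G = "\<lambda>z. (f k (fst (fst z)), D (?F z))"
  have G: "?G \<in> ?P \<rightarrow>\<^sub>M stage (Suc k)" by measurable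
  have \<beta>_G: "\<beta> = distr ?P (stage (Suc k)) ?G"
    unfolding \<beta>_D F_distr[symmetric] by (rule distr_distr_cong) auto
  \<comment> \<open>Slot \<open>k\<close>, left free by the tail from \<open>D\<close>, receives the
    input and the reference drawn by \<open>\<alpha>\<close>.\<close>
  let ?T = "\<lambda>z. (fst (fst (fst z)), (fst (D (?F z)))(k := snd (fst (fst z))), (snd (D (?F z)))(k := snd (fst z)))"
  have T: "?T \<in> ?P \<rightarrow>\<^sub>M stage k"
  proof (intro measurable_Pair)
    have ins: "{k..<N} = insert k {Suc k..<N}" "{k..N} = insert k {Suc k..N}" using k by auto
    show "(\<lambda>z. (fst (D (?F z)))(k := snd (fst (fst z)))) \<in> ?P \<rightarrow>\<^sub>M inputs k"
      unfolding ins by (rule measurable_fun_upd[where J="{Suc k..<N}"]) (auto, measurable)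
    show "(\<lambda>z. (snd (D (?F z)))(k := snd (fst z))) \<in> ?P \<rightarrow>\<^sub>M refs k"
      unfolding ins by (rule measurable_fun_upd[where J="{Suc k..N}"]) (auto, measurable)
  qed measurable
  let ?\<gamma> = "distr ?P (stage k) ?T"
  have \<gamma>P: "?\<gamma> \<in> prob_measures (stage k)"
    using \<alpha>\<U>.prob_space_distr[OF T] by (simp add: space_prob_algebra)
  have comp: "(\<lambda>z. snd (snd z) i) \<in> stage j \<rightarrow>\<^sub>M \<rho> i" if "i \<in> {j..N}" "k \<le> j" for i j
  proof -
    have "i \<in> {k..N}" using that by auto
    from that(1) show ?thesis
      unfolding measurable_cong_sets[OF refl sets_\<rho>(1)[OF \<open>i \<in> {k..N}\<close>]] by measurable
  qed
  have "?\<gamma> \<in> plans k \<mu> \<rho>"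
    unfolding plans_def
  proof (intro CollectI conjI ballI \<gamma>P)
    have "distr ?\<gamma> (borel_of (X k)) fst = distr ?P (borel_of (X k)) (\<lambda>z. fst (fst (fst z)))"
      by (rule distr_distr_cong[OF T]) auto
    also have "\<dots> = distr (distr (distr ?P \<alpha> fst) \<Lambda> fst) (borel_of (X k)) fst"
    proof -
      have "distr (distr ?P \<alpha> fst) \<Lambda> fst = distr ?P \<Lambda> (\<lambda>z. fst (fst z))"
        by (rule distr_distr_cong) auto
      also have "distr \<dots> (borel_of (X k)) fst = distr ?P (borel_of (X k)) (\<lambda>z. fst (fst (fst z)))"
        by (rule distr_distr_cong) auto
      finally show ?thesis by simp
    qed
    also have "\<dots> = \<mu>" by (simp add: \<U>.distr_pair_fst \<alpha>_fst \<Lambda>_fst)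
    finally show "distr ?\<gamma> (borel_of (X k)) fst = \<mu>" .
    fix i assume i: "i \<in> {k..N}"
    show "distr ?\<gamma> (\<rho> i) (\<lambda>z. snd (snd z) i) = \<rho> i"
    proof (cases "i = k")
      case True
      have "distr ?\<gamma> (\<rho> k) (\<lambda>z. snd (snd z) k) = distr ?P (\<rho> k) (\<lambda>z. snd (fst z))"
        by (rule distr_distr_cong[OF T]) (use i in \<open>auto intro!: comp simp: True\<close>)
      also have "\<dots> = distr (distr ?P \<alpha> fst) (\<rho> k) snd"
        by (rule distr_distr_cong[symmetric]) auto
      finally show ?thesis by (simp add: True \<U>.distr_pair_fst \<alpha>_snd)
    next
      case False
      then have i': "i \<in> {Suc k..N}" using i by auto
      have "distr ?\<gamma> (\<rho> i) (\<lambda>z. snd (snd z) i) = distr ?P (\<rho> i) (\<lambda>z. snd (snd (?G z)) i)"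
        by (rule distr_distr_cong[OF T]) (use i False in \<open>auto intro!: comp\<close>)
      also have "\<dots> = distr \<beta> (\<rho> i) (\<lambda>z. snd (snd z) i)"
        unfolding \<beta>_G by (rule distr_distr_cong[symmetric, OF G]) (use i' in \<open>auto intro!: comp\<close>)
      finally show ?thesis using \<beta>_ref[OF i'] by simp
    qed
  qed
  then have "plan_value k \<mu> \<rho> \<le> (\<integral>\<^sup>+z. total_cost k (fst z) (fst (snd z)) (snd (snd z)) \<partial>?\<gamma>)"
    unfolding plan_value_def by (rule INF_lower)
  also have "\<dots> = (\<integral>\<^sup>+z. total_cost k (fst (?T z)) (fst (snd (?T z))) (snd (snd (?T z))) \<partial>?P)"
    by (rule nn_integral_distr[OF T]) (use k in \<open>auto intro: measurable_total_cost_stage\<close>)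
  also have "\<dots> = (\<integral>\<^sup>+z. g k (fst z) + total_cost (Suc k) (fst (?G z)) (fst (snd (?G z))) (snd (snd (?G z))) \<partial>?P)"
  proof (rule nn_integral_cong)
    fix z
    have "total_cost (Suc k) (f k (fst (fst z))) (fst (snd (?T z))) (snd (snd (?T z))) =
        total_cost (Suc k) (f k (fst (fst z))) (fst (snd (?G z))) (snd (snd (?G z)))"
      by (rule total_cost_cong) (use k in auto)
    then show "total_cost k (fst (?T z)) (fst (snd (?T z))) (snd (snd (?T z))) =
        g k (fst z) + total_cost (Suc k) (fst (?G z)) (fst (snd (?G z))) (snd (snd (?G z)))"
      unfolding total_cost_Suc[OF k] by simp
  qed
  also have "\<dots> = (\<integral>\<^sup>+z. g k (fst z) \<partial>?P) +
      (\<integral>\<^sup>+z. total_cost (Suc k) (fst (?G z)) (fst (snd (?G z))) (snd (snd (?G z))) \<partial>?P)"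
  proof (rule nn_integral_add)
    show "(\<lambda>z. total_cost (Suc k) (fst (?G z)) (fst (snd (?G z))) (snd (snd (?G z)))) \<in> borel_measurable ?P"
      by (rule measurable_compose[OF G measurable_total_cost_stage]) (use k in auto)
  qed measurable
  also have "(\<integral>\<^sup>+z. g k (fst z) \<partial>?P) = (\<integral>\<^sup>+z. g k z \<partial>distr ?P \<alpha> fst)"
    by (rule nn_integral_distr[symmetric]) auto
  also have "distr ?P \<alpha> fst = \<alpha>" by (rule \<U>.distr_pair_fst)
  also have "(\<integral>\<^sup>+z. total_cost (Suc k) (fst (?G z)) (fst (snd (?G z))) (snd (snd (?G z))) \<partial>?P) =
      (\<integral>\<^sup>+z. total_cost (Suc k) (fst z) (fst (snd z)) (snd (snd z)) \<partial>\<beta>)"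
    unfolding \<beta>_G by (rule nn_integral_distr[OF G, symmetric]) (use k in \<open>auto intro: measurable_total_cost_stage\<close>)
  finally show ?thesis .
qed

text \<open>The law of state and input at stage \<open>k\<close> is an explicit choice of
  \<open>\<Lambda>\<close>. Projecting \<open>\<gamma>\<close> to the current stage and to the later
  stages then yields a competitor for each of the two infima on the left.\<close>

lemma plan_value_splitting:
  assumes k: "k < N" and \<mu>: "\<mu> \<in> prob_measures (borel_of (X k))" and \<rho>: "refs_prob k \<rho>"
    and \<gamma>: "\<gamma> \<in> plans k \<mu> \<rho>"
  shows "\<exists>\<Lambda>\<in>state_input_measures (X k) (U k) \<mu>. transport_cost (g k) \<Lambda> (\<rho> k) +
      plan_value (Suc k) (distr \<Lambda> (borel_of (X (Suc k))) (f k)) \<rho> \<le>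
    (\<integral>\<^sup>+z. total_cost k (fst z) (fst (snd z)) (snd (snd z)) \<partial>\<gamma>)"
proof -
  note f [OF k, measurable] g [OF k, measurable]
  note sets_\<rho> = refs_prob_sets[OF \<rho>]
  let ?X' = "borel_of (X (Suc k))"
  let ?XU = "borel_of (X k) \<Otimes>\<^sub>M borel_of (U k)"
  have sets_\<rho>k [measurable_cong]: "sets (\<rho> k) = sets (borel_of (R k))"
    by (rule sets_\<rho>(1)) (use k in auto)
  have \<gamma>P: "\<gamma> \<in> prob_measures (stage k)" and \<gamma>_fst: "distr \<gamma> (borel_of (X k)) fst = \<mu>"
    and \<gamma>_ref: "\<And>i. i \<in> {k..N} \<Longrightarrow> distr \<gamma> (\<rho> i) (\<lambda>z. snd (snd z) i) = \<rho> i"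
    using \<gamma> by (auto simp: plans_def)
  note [measurable_cong] = prob_measuresD(1)[OF \<gamma>P]
  interpret \<gamma>: prob_space \<gamma> by (rule prob_measuresD(2)[OF \<gamma>P])
  have [measurable]: "(\<lambda>v. v k) \<in> inputs k \<rightarrow>\<^sub>M borel_of (U k)" "(\<lambda>r. r k) \<in> refs k \<rightarrow>\<^sub>M borel_of (R k)"
    using k by (auto intro!: measurable_component_singleton)
  have [measurable]: "(\<lambda>v. restrict v {Suc k..<N}) \<in> inputs k \<rightarrow>\<^sub>M inputs (Suc k)"
    "(\<lambda>r. restrict r {Suc k..N}) \<in> refs k \<rightarrow>\<^sub>M refs (Suc k)"
    by (rule measurable_restrict_subset; auto)+
  let ?S = "\<lambda>z :: 'x \<times> (nat \<Rightarrow> 'u) \<times> (nat \<Rightarrow> 'r). (fst z, fst (snd z) k)"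
  have S: "?S \<in> \<gamma> \<rightarrow>\<^sub>M ?XU" by measurable
  define \<Lambda> where "\<Lambda> = distr \<gamma> ?XU ?S"
  have sets_\<Lambda> [measurable_cong]: "sets \<Lambda> = sets ?XU" by (simp add: \<Lambda>_def)
  have \<Lambda>: "\<Lambda> \<in> state_input_measures (X k) (U k) \<mu>"
    unfolding state_input_measures_def
  proof (intro CollectI conjI)
    show "\<Lambda> \<in> prob_measures ?XU" using \<gamma>.prob_space_distr[OF S] by (simp add: \<Lambda>_def space_prob_algebra)
    have "distr \<Lambda> (borel_of (X k)) fst = distr \<gamma> (borel_of (X k)) fst"
      unfolding \<Lambda>_def by (rule distr_distr_cong[OF S]) auto
    then show "distr \<Lambda> (borel_of (X k)) fst = \<mu>" by (simp add: \<gamma>_fst)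
  qed
  let ?A = "\<lambda>z. (?S z, snd (snd z) k)"
  have A: "?A \<in> \<gamma> \<rightarrow>\<^sub>M \<Lambda> \<Otimes>\<^sub>M \<rho> k"
  proof (rule measurable_Pair)
    show "?S \<in> \<gamma> \<rightarrow>\<^sub>M \<Lambda>" using S by (simp add: measurable_cong_sets[OF refl sets_\<Lambda>])
    show "(\<lambda>z. snd (snd z) k) \<in> \<gamma> \<rightarrow>\<^sub>M \<rho> k"
      unfolding measurable_cong_sets[OF refl sets_\<rho>k] using k by measurable
  qed
  have "distr \<gamma> (\<Lambda> \<Otimes>\<^sub>M \<rho> k) ?A \<in> couplings \<Lambda> (\<rho> k)"
    unfolding couplings_def
  proof (intro CollectI conjI)
    show "distr \<gamma> (\<Lambda> \<Otimes>\<^sub>M \<rho> k) ?A \<in> prob_measures (\<Lambda> \<Otimes>\<^sub>M \<rho> k)"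
      using \<gamma>.prob_space_distr[OF A] by (simp add: space_prob_algebra)
    have "distr (distr \<gamma> (\<Lambda> \<Otimes>\<^sub>M \<rho> k) ?A) \<Lambda> fst = distr \<gamma> \<Lambda> ?S"
      by (rule distr_distr_cong[OF A]) auto
    also have "\<dots> = \<Lambda>" by (subst (2) \<Lambda>_def) (rule distr_cong, auto simp: sets_\<Lambda>)
    finally show "distr (distr \<gamma> (\<Lambda> \<Otimes>\<^sub>M \<rho> k) ?A) \<Lambda> fst = \<Lambda>" .
    have "distr (distr \<gamma> (\<Lambda> \<Otimes>\<^sub>M \<rho> k) ?A) (\<rho> k) snd = distr \<gamma> (\<rho> k) (\<lambda>z. snd (snd z) k)"
      by (rule distr_distr_cong[OF A]) auto
    then show "distr (distr \<gamma> (\<Lambda> \<Otimes>\<^sub>M \<rho> k) ?A) (\<rho> k) snd = \<rho> k" using k by (simp add: \<gamma>_ref)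
  qed
  then have "transport_cost (g k) \<Lambda> (\<rho> k) \<le> (\<integral>\<^sup>+z. g k z \<partial>distr \<gamma> (\<Lambda> \<Otimes>\<^sub>M \<rho> k) ?A)"
    unfolding transport_cost_def plan_cost_eq[symmetric] by (rule INF_lower)
  also have "\<dots> = (\<integral>\<^sup>+z. g k (?A z) \<partial>\<gamma>)" by (rule nn_integral_distr[OF A]) measurable
  finally have le_A: "transport_cost (g k) \<Lambda> (\<rho> k) \<le> (\<integral>\<^sup>+z. g k (?A z) \<partial>\<gamma>)" .
  let ?B = "\<lambda>z. (f k (?S z), restrict (fst (snd z)) {Suc k..<N}, restrict (snd (snd z)) {Suc k..N})"
  have B: "?B \<in> \<gamma> \<rightarrow>\<^sub>M stage (Suc k)" by measurable
  let ?\<mu>' = "distr \<Lambda> ?X' (f k)"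
  have "distr \<gamma> (stage (Suc k)) ?B \<in> plans (Suc k) ?\<mu>' \<rho>"
    unfolding plans_def
  proof (intro CollectI conjI ballI)
    show "distr \<gamma> (stage (Suc k)) ?B \<in> prob_measures (stage (Suc k))"
      using \<gamma>.prob_space_distr[OF B] by (simp add: space_prob_algebra)
    have "distr (distr \<gamma> (stage (Suc k)) ?B) ?X' fst = distr \<gamma> ?X' (\<lambda>z. f k (?S z))"
      by (rule distr_distr_cong[OF B]) auto
    also have "\<dots> = ?\<mu>'" unfolding \<Lambda>_def by (rule distr_distr_cong[symmetric, OF S]) auto
    finally show "distr (distr \<gamma> (stage (Suc k)) ?B) ?X' fst = ?\<mu>'" .
    fix i assume i: "i \<in> {Suc k..N}"
    then have i': "i \<in> {k..N}" by auto
    have "(\<lambda>z. snd (snd z) i) \<in> stage (Suc k) \<rightarrow>\<^sub>M \<rho> i"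
      unfolding measurable_cong_sets[OF refl sets_\<rho>(1)[OF i']] using i by measurable
    then have "distr (distr \<gamma> (stage (Suc k)) ?B) (\<rho> i) (\<lambda>z. snd (snd z) i) = distr \<gamma> (\<rho> i) (\<lambda>z. snd (snd z) i)"
      by (rule distr_distr_cong[OF B]) (use i in auto)
    then show "distr (distr \<gamma> (stage (Suc k)) ?B) (\<rho> i) (\<lambda>z. snd (snd z) i) = \<rho> i"
      using \<gamma>_ref[OF i'] by simp
  qed
  then have "plan_value (Suc k) ?\<mu>' \<rho> \<le> (\<integral>\<^sup>+z. total_cost (Suc k) (fst z) (fst (snd z)) (snd (snd z)) \<partial>distr \<gamma> (stage (Suc k)) ?B)"
    unfolding plan_value_def by (rule INF_lower)
  also have "\<dots> = (\<integral>\<^sup>+z. total_cost (Suc k) (fst (?B z)) (fst (snd (?B z))) (snd (snd (?B z))) \<partial>\<gamma>)"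
    by (rule nn_integral_distr[OF B]) (use k in \<open>auto intro: measurable_total_cost_stage\<close>)
  finally have "transport_cost (g k) \<Lambda> (\<rho> k) + plan_value (Suc k) ?\<mu>' \<rho> \<le> (\<integral>\<^sup>+z. g k (?A z) \<partial>\<gamma>) +
      (\<integral>\<^sup>+z. total_cost (Suc k) (fst (?B z)) (fst (snd (?B z))) (snd (snd (?B z))) \<partial>\<gamma>)"
    using le_A by (intro add_mono)
  also have "\<dots> \<le> (\<integral>\<^sup>+z. g k (?A z) + total_cost (Suc k) (fst (?B z)) (fst (snd (?B z))) (snd (snd (?B z))) \<partial>\<gamma>)"
    by (rule nn_integral_superadditive)
  also have "\<dots> = (\<integral>\<^sup>+z. total_cost k (fst z) (fst (snd z)) (snd (snd z)) \<partial>\<gamma>)"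
  proof (rule nn_integral_cong)
    fix z
    have "total_cost (Suc k) (f k (?S z)) (fst (snd (?B z))) (snd (snd (?B z))) =
        total_cost (Suc k) (f k (?S z)) (fst (snd z)) (snd (snd z))"
      by (rule total_cost_cong) (use k in auto)
    then show "g k (?A z) + total_cost (Suc k) (fst (?B z)) (fst (snd (?B z))) (snd (snd (?B z))) =
        total_cost k (fst z) (fst (snd z)) (snd (snd z))"
      unfolding total_cost_Suc[OF k] by simp
  qed
  finally show ?thesis using \<Lambda> by blast
qed


section \<open>Dynamic programming\<close>

abbreviation "prob_cost k \<equiv> prob_cost_to_go N X U f g gN k"

text \<open>At the last stage the inputs form a one-point product and the references a product with
  one factor, so joint laws and couplings correspond by relabelling.\<close>

lemma plan_value_N:
  assumes \<mu>: "\<mu> \<in> prob_measures (borel_of (X N))" and \<rho>: "refs_prob N \<rho>"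
  shows "plan_value N \<mu> \<rho> = transport_cost gN \<mu> (\<rho> N)"
proof (rule antisym)
  note gN [measurable]
  have sets_\<rho> [measurable_cong]: "sets (\<rho> N) = sets (borel_of (R N))"
    by (rule refs_prob_sets(1)[OF \<rho>]) simp
  note sets_\<mu> [measurable_cong] = prob_measuresD(1)[OF \<mu>]
  show "plan_value N \<mu> \<rho> \<le> transport_cost gN \<mu> (\<rho> N)"
    unfolding transport_cost_def
  proof (rule INF_greatest)
    fix \<alpha> assume \<alpha>: "\<alpha> \<in> couplings \<mu> (\<rho> N)"
    then have sets_\<alpha> [measurable_cong]: "sets \<alpha> = sets (\<mu> \<Otimes>\<^sub>M \<rho> N)" and "prob_space \<alpha>"
      and \<alpha>_fst: "distr \<alpha> \<mu> fst = \<mu>" and \<alpha>_snd: "distr \<alpha> (\<rho> N) snd = \<rho> N"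
      by (auto simp: couplings_def space_prob_algebra)
    interpret \<alpha>: prob_space \<alpha> by fact
    \<comment> \<open>The empty input tuple is the function that is \<open>undefined\<close>
      everywhere.\<close>
    let ?T = "\<lambda>z :: 'x \<times> 'r. (fst z, \<lambda>i\<in>{N..<N}. undefined, \<lambda>i\<in>{N..N}. snd z)"
    have T: "?T \<in> \<alpha> \<rightarrow>\<^sub>M stage N"
    proof (intro measurable_Pair measurable_restrict)
      show "fst \<in> \<alpha> \<rightarrow>\<^sub>M borel_of (X N)" by measurable
      show "snd \<in> \<alpha> \<rightarrow>\<^sub>M borel_of (R i)" if "i \<in> {N..N}" for i using that by simp
    qed auto
    have "distr \<alpha> (stage N) ?T \<in> plans N \<mu> \<rho>"
      unfolding plans_def
    proof (intro CollectI conjI ballI)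
      show "distr \<alpha> (stage N) ?T \<in> prob_measures (stage N)"
        using \<alpha>.prob_space_distr[OF T] by (simp add: space_prob_algebra)
      have "distr (distr \<alpha> (stage N) ?T) (borel_of (X N)) fst = distr \<alpha> (borel_of (X N)) fst"
        by (rule distr_distr_cong[OF T]) auto
      also have "\<dots> = distr \<alpha> \<mu> fst" by (rule distr_cong) (auto simp: sets_\<mu>)
      finally show "distr (distr \<alpha> (stage N) ?T) (borel_of (X N)) fst = \<mu>" by (simp add: \<alpha>_fst)
      fix i assume "i \<in> {N..N}"
      then have i: "i = N" by simp
      have "(\<lambda>z. snd (snd z) N) \<in> stage N \<rightarrow>\<^sub>M \<rho> N"
        unfolding measurable_cong_sets[OF refl sets_\<rho>] by measurable
      then have "distr (distr \<alpha> (stage N) ?T) (\<rho> N) (\<lambda>z. snd (snd z) N) = distr \<alpha> (\<rho> N) snd"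
        by (rule distr_distr_cong[OF T]) simp
      then show "distr (distr \<alpha> (stage N) ?T) (\<rho> i) (\<lambda>z. snd (snd z) i) = \<rho> i"
        unfolding i by (simp add: \<alpha>_snd)
    qed
    then have "plan_value N \<mu> \<rho> \<le> (\<integral>\<^sup>+z. total_cost N (fst z) (fst (snd z)) (snd (snd z)) \<partial>distr \<alpha> (stage N) ?T)"
      unfolding plan_value_def by (rule INF_lower)
    also have "\<dots> = plan_cost gN \<alpha>"
      by (subst nn_integral_distr[OF T]) (auto intro: measurable_total_cost_stage simp: plan_cost_eq total_cost_N)
    finally show "plan_value N \<mu> \<rho> \<le> plan_cost gN \<alpha>" .
  qed
  show "transport_cost gN \<mu> (\<rho> N) \<le> plan_value N \<mu> \<rho>"
    unfolding plan_value_def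
  proof (rule INF_greatest)
    fix \<gamma> assume \<gamma>: "\<gamma> \<in> plans N \<mu> \<rho>"
    then have \<gamma>P: "\<gamma> \<in> prob_measures (stage N)" and \<gamma>_fst: "distr \<gamma> (borel_of (X N)) fst = \<mu>"
      and \<gamma>_snd: "distr \<gamma> (\<rho> N) (\<lambda>z. snd (snd z) N) = \<rho> N"
      by (auto simp: plans_def)
    note [measurable_cong] = prob_measuresD(1)[OF \<gamma>P]
    interpret \<gamma>: prob_space \<gamma> by (rule prob_measuresD(2)[OF \<gamma>P])
    let ?A = "\<lambda>z :: 'x \<times> (nat \<Rightarrow> 'u) \<times> (nat \<Rightarrow> 'r). (fst z, snd (snd z) N)"
    have A: "?A \<in> \<gamma> \<rightarrow>\<^sub>M \<mu> \<Otimes>\<^sub>M \<rho> N"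
    proof (rule measurable_Pair)
      show "(\<lambda>z. snd (snd z) N) \<in> \<gamma> \<rightarrow>\<^sub>M \<rho> N"
        unfolding measurable_cong_sets[OF refl sets_\<rho>] by measurable
    qed measurable
    have "distr \<gamma> (\<mu> \<Otimes>\<^sub>M \<rho> N) ?A \<in> couplings \<mu> (\<rho> N)"
      unfolding couplings_def
    proof (intro CollectI conjI)
      show "distr \<gamma> (\<mu> \<Otimes>\<^sub>M \<rho> N) ?A \<in> prob_measures (\<mu> \<Otimes>\<^sub>M \<rho> N)"
        using \<gamma>.prob_space_distr[OF A] by (simp add: space_prob_algebra)
      have "distr (distr \<gamma> (\<mu> \<Otimes>\<^sub>M \<rho> N) ?A) \<mu> fst = distr \<gamma> \<mu> fst"
        by (rule distr_distr_cong[OF A]) auto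
      also have "\<dots> = distr \<gamma> (borel_of (X N)) fst" by (rule distr_cong) (auto simp: sets_\<mu>)
      finally show "distr (distr \<gamma> (\<mu> \<Otimes>\<^sub>M \<rho> N) ?A) \<mu> fst = \<mu>" by (simp add: \<gamma>_fst)
      have "distr (distr \<gamma> (\<mu> \<Otimes>\<^sub>M \<rho> N) ?A) (\<rho> N) snd = distr \<gamma> (\<rho> N) (\<lambda>z. snd (snd z) N)"
        by (rule distr_distr_cong[OF A]) auto
      then show "distr (distr \<gamma> (\<mu> \<Otimes>\<^sub>M \<rho> N) ?A) (\<rho> N) snd = \<rho> N" by (simp add: \<gamma>_snd)
    qed
    then have "transport_cost gN \<mu> (\<rho> N) \<le> (\<integral>\<^sup>+z. gN z \<partial>distr \<gamma> (\<mu> \<Otimes>\<^sub>M \<rho> N) ?A)"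
      unfolding transport_cost_def plan_cost_eq[symmetric] by (rule INF_lower)
    also have "\<dots> = (\<integral>\<^sup>+z. total_cost N (fst z) (fst (snd z)) (snd (snd z)) \<partial>\<gamma>)"
      unfolding total_cost_N by (rule nn_integral_distr[OF A]) measurable
    finally show "transport_cost gN \<mu> (\<rho> N) \<le>
        (\<integral>\<^sup>+z. total_cost N (fst z) (fst (snd z)) (snd (snd z)) \<partial>\<gamma>)" .
  qed
qed

lemma distr_dynamics_prob:
  assumes "k < N" "\<Lambda> \<in> state_input_measures (X k) (U k) \<mu>"
  shows "distr \<Lambda> (borel_of (X (Suc k))) (f k) \<in> prob_measures (borel_of (X (Suc k)))"
  using assms f by (intro prob_measures_distr) (auto simp: state_input_measures_def)

lemma prob_cost_Suc: "k < N \<Longrightarrow> prob_cost k \<mu> \<rho> =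
    (INF \<Lambda>\<in>state_input_measures (X k) (U k) \<mu>. transport_cost (g k) \<Lambda> (\<rho> k) +
      prob_cost (Suc k) (distr \<Lambda> (borel_of (X (Suc k))) (f k)) \<rho>)"
  by (subst prob_cost_to_go.simps) simp

lemma prob_cost_N: "prob_cost N \<mu> \<rho> = transport_cost gN \<mu> (\<rho> N)"
  by (subst prob_cost_to_go.simps) simp

text \<open>Backward induction: splitting bounds the recursion by the cost of each joint law, and
  gluing bounds \<open>plan_value\<close> by each sum of a coupling cost and the cost of a later
  joint law.\<close>

lemma prob_cost_eq_plan_value:
  assumes "k \<le> N" "\<mu> \<in> prob_measures (borel_of (X k))" "refs_prob k \<rho>"
  shows "prob_cost k \<mu> \<rho> = plan_value k \<mu> \<rho>"
  using assms
proof (induction k arbitrary: \<mu> rule: inc_induct)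
  case base
  then show ?case by (simp add: prob_cost_N plan_value_N)
next
  case (step k)
  have IH: "prob_cost (Suc k) (distr \<Lambda> (borel_of (X (Suc k))) (f k)) \<rho> =
      plan_value (Suc k) (distr \<Lambda> (borel_of (X (Suc k))) (f k)) \<rho>"
    if "\<Lambda> \<in> state_input_measures (X k) (U k) \<mu>" for \<Lambda>
    by (intro step.IH distr_dynamics_prob[OF step.hyps(2) that] refs_prob_Suc step.prems(2))
  show ?case
  proof (rule antisym)
    show "prob_cost k \<mu> \<rho> \<le> plan_value k \<mu> \<rho>"
      unfolding plan_value_def
    proof (rule INF_greatest)
      fix \<gamma> assume "\<gamma> \<in> plans k \<mu> \<rho>"
      from plan_value_splitting[OF step.hyps(2) step.prems this]
      obtain \<Lambda> where \<Lambda>: "\<Lambda> \<in> state_input_measures (X k) (U k) \<mu>"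
        and le: "transport_cost (g k) \<Lambda> (\<rho> k) + plan_value (Suc k) (distr \<Lambda> (borel_of (X (Suc k))) (f k)) \<rho>
          \<le> (\<integral>\<^sup>+z. total_cost k (fst z) (fst (snd z)) (snd (snd z)) \<partial>\<gamma>)" by blast
      show "prob_cost k \<mu> \<rho> \<le> (\<integral>\<^sup>+z. total_cost k (fst z) (fst (snd z)) (snd (snd z)) \<partial>\<gamma>)"
        unfolding prob_cost_Suc[OF step.hyps(2)]
        by (rule INF_lower2[OF \<Lambda>]) (simp only: IH[OF \<Lambda>] le)
    qed
    show "plan_value k \<mu> \<rho> \<le> prob_cost k \<mu> \<rho>"
      unfolding prob_cost_Suc[OF step.hyps(2)]
    proof (rule INF_greatest)
      fix \<Lambda> assume \<Lambda>: "\<Lambda> \<in> state_input_measures (X k) (U k) \<mu>"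
      show "plan_value k \<mu> \<rho> \<le> transport_cost (g k) \<Lambda> (\<rho> k) +
          prob_cost (Suc k) (distr \<Lambda> (borel_of (X (Suc k))) (f k)) \<rho>"
        unfolding IH[OF \<Lambda>] transport_cost_def plan_value_def[of "Suc k"] plan_cost_eq
        by (rule ennreal_INF_add_INF_greatest) (rule plan_value_gluing[OF step.hyps(2) step.prems \<Lambda>])
    qed
  qed
qed

theorem prob_cost_eq_multi_transport_cost:
  assumes "k \<le> N" "\<mu> \<in> prob_measures (borel_of (X k))" "refs_prob k \<rho>"
  shows "prob_cost k \<mu> \<rho> = multi_transport_cost (ground k) \<mu> {k..N} \<rho>"
  using prob_cost_eq_plan_value[OF assms] plan_value_eq_multi_transport_cost[OF assms] by simp

section \<open>The value of the control problem as a cost-to-go\<close>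

definition tails :: "nat \<Rightarrow> 'x measure \<Rightarrow> ((nat \<Rightarrow> 'x measure) \<times> (nat \<Rightarrow> ('x \<times> 'u) measure)) set" where
  "tails k \<mu> = {(m, l). m k = \<mu> \<and>
      (\<forall>i\<in>{k..N}. m i \<in> prob_measures (borel_of (X i))) \<and>
      (\<forall>i\<in>{k..<N}. l i \<in> state_input_measures (X i) (U i) (m i)) \<and>
      (\<forall>i\<in>{k..<N}. m (Suc i) = distr (l i) (borel_of (X (Suc i))) (f i))}"

definition tail_cost :: "nat \<Rightarrow> (nat \<Rightarrow> 'r measure) \<Rightarrow> (nat \<Rightarrow> 'x measure) \<Rightarrow> (nat \<Rightarrow> ('x \<times> 'u) measure) \<Rightarrow> ennreal" where
  "tail_cost k \<rho> m l = transport_cost gN (m N) (\<rho> N) + (\<Sum>i\<in>{k..<N}. transport_cost (g i) (l i) (\<rho> i))"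

lemma tail_cost_Suc: "k < N \<Longrightarrow> tail_cost k \<rho> m l = transport_cost (g k) (l k) (\<rho> k) + tail_cost (Suc k) \<rho> m l"
  by (simp add: tail_cost_def sum.atLeast_Suc_lessThan add_ac)

text \<open>Each stage of a trajectory is one candidate in the recursion. Entries of
  \<open>m\<close> and \<open>l\<close> below the initial stage are unconstrained, so the same pair
  is a tail from every later stage and the induction never changes it.\<close>

lemma prob_cost_le_tail_cost:
  assumes "k \<le> N" "(m, l) \<in> tails k \<mu>"
  shows "prob_cost k \<mu> \<rho> \<le> tail_cost k \<rho> m l"
  using assms
proof (induction k arbitrary: \<mu> rule: inc_induct)
  case base
  then show ?case by (simp add: prob_cost_N tail_cost_def tails_def)
next
  case (step k)
  have l: "l k \<in> state_input_measures (X k) (U k) \<mu>"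
    and next_m: "m (Suc k) = distr (l k) (borel_of (X (Suc k))) (f k)"
    using step.prems step.hyps by (auto simp: tails_def)
  have "(m, l) \<in> tails (Suc k) (m (Suc k))"
    using step.prems by (auto simp: tails_def)
  from step.IH[OF this] show ?case
    unfolding tail_cost_Suc[OF step.hyps(2)] prob_cost_Suc[OF step.hyps(2)]
    by (intro INF_lower2[OF l] add_left_mono) (simp only: next_m)
qed

text \<open>Prepending \<open>\<mu>\<close> and \<open>\<Lambda>\<close> to a tail from
  \<open>Suc k\<close> gives a tail from \<open>k\<close> whose cost grows by the stage cost.
  Constants move inside the infima, so near-optimal controls never have to be chosen.\<close>

lemma INF_tail_cost_le_prob_cost:
  assumes "k \<le> N" "\<mu> \<in> prob_measures (borel_of (X k))"
  shows "(INF (m, l)\<in>tails k \<mu>. tail_cost k \<rho> m l) \<le> prob_cost k \<mu> \<rho>"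
  using assms
proof (induction k arbitrary: \<mu> rule: inc_induct)
  case base
  \<comment> \<open>At stage \<open>N\<close> no input law is constrained, hence the default in the
    second component.\<close>
  then have "(\<lambda>_. \<mu>, undefined) \<in> tails N \<mu>" by (simp add: tails_def)
  then show ?case by (rule INF_lower2) (simp add: prob_cost_N tail_cost_def)
next
  case (step k)
  show ?case
    unfolding prob_cost_Suc[OF step.hyps(2)]
  proof (rule INF_greatest)
    fix \<Lambda> assume \<Lambda>: "\<Lambda> \<in> state_input_measures (X k) (U k) \<mu>"
    let ?\<mu>' = "distr \<Lambda> (borel_of (X (Suc k))) (f k)"
    have "(INF (m, l)\<in>tails k \<mu>. tail_cost k \<rho> m l) \<le>
        transport_cost (g k) \<Lambda> (\<rho> k) + (INF (m, l)\<in>tails (Suc k) ?\<mu>'. tail_cost (Suc k) \<rho> m l)"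
      unfolding ennreal_INF_const_add
    proof (rule INF_greatest, clarify)
      fix m l assume ml: "(m, l) \<in> tails (Suc k) ?\<mu>'"
      have "(m(k := \<mu>), l(k := \<Lambda>)) \<in> tails k \<mu>"
        unfolding tails_def mem_Collect_eq case_prod_conv
      proof (intro conjI ballI)
        fix i assume "i \<in> {k..N}"
        then consider "i = k" | "i \<in> {Suc k..N}" by force
        then show "(m(k := \<mu>)) i \<in> prob_measures (borel_of (X i))"
          using ml step.prems by cases (auto simp: tails_def)
      next
        fix i assume "i \<in> {k..<N}"
        then consider "i = k" | "i \<in> {Suc k..<N}" by force
        then show "(l(k := \<Lambda>)) i \<in> state_input_measures (X i) (U i) ((m(k := \<mu>)) i)"
          using ml \<Lambda> by cases (auto simp: tails_def)
      next
        fix i assume "i \<in> {k..<N}"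
        then consider "i = k" | "i \<in> {Suc k..<N}" by force
        then show "(m(k := \<mu>)) (Suc i) = distr ((l(k := \<Lambda>)) i) (borel_of (X (Suc i))) (f i)"
          using ml by cases (auto simp: tails_def)
      qed simp
      moreover have "tail_cost k \<rho> (m(k := \<mu>)) (l(k := \<Lambda>)) =
          transport_cost (g k) \<Lambda> (\<rho> k) + tail_cost (Suc k) \<rho> m l"
        unfolding tail_cost_Suc[OF step.hyps(2)] using step.hyps(2) by (simp add: tail_cost_def)
      ultimately show "(INF (m, l)\<in>tails k \<mu>. tail_cost k \<rho> m l) \<le>
          transport_cost (g k) \<Lambda> (\<rho> k) + tail_cost (Suc k) \<rho> m l"
        by (intro INF_lower2[of "(m(k := \<mu>), l(k := \<Lambda>))"]) auto
    qed
    also have "\<dots> \<le> transport_cost (g k) \<Lambda> (\<rho> k) + prob_cost (Suc k) ?\<mu>' \<rho>"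
      by (intro add_left_mono step.IH distr_dynamics_prob[OF step.hyps(2) \<Lambda>])
    finally show "(INF (m, l)\<in>tails k \<mu>. tail_cost k \<rho> m l) \<le>
        transport_cost (g k) \<Lambda> (\<rho> k) + prob_cost (Suc k) ?\<mu>' \<rho>" .
  qed
qed

theorem control_value_eq_prob_cost:
  assumes "\<mu> \<in> prob_measures (borel_of (X 0))"
  shows "control_value N X U f g gN \<mu> \<rho> = prob_cost 0 \<mu> \<rho>"
proof -
  have "admissible_trajectories N X U f \<mu> = tails 0 \<mu>"
    by (auto simp: admissible_trajectories_def tails_def)
  then have "control_value N X U f g gN \<mu> \<rho> = (INF (m, l)\<in>tails 0 \<mu>. tail_cost 0 \<rho> m l)"
    by (simp add: control_value_def tail_cost_def atLeast0LessThan)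
  also have "\<dots> = prob_cost 0 \<mu> \<rho>"
  proof (rule antisym)
    show "(INF (m, l)\<in>tails 0 \<mu>. tail_cost 0 \<rho> m l) \<le> prob_cost 0 \<mu> \<rho>"
      by (rule INF_tail_cost_le_prob_cost) (use assms in auto)
    show "prob_cost 0 \<mu> \<rho> \<le> (INF (m, l)\<in>tails 0 \<mu>. tail_cost 0 \<rho> m l)"
      by (rule INF_greatest) (auto intro: prob_cost_le_tail_cost)
  qed
  finally show ?thesis .
qed

text \<open>Under \<open>\<gamma>\<close>, the map \<open>?A\<close> yields the current state, input
  and reference, and \<open>?B\<close> the next state with the later references. The law of the
  first competes in the stage cost; that of the second competes in \<open>prob_cost (Suc k)\<close>,
  which is a transport cost by \<open>prob_cost_eq_multi_transport_cost\<close>. One half of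
  \<open>\<epsilon>\<close> pays for \<open>u\<close>, the other for
  \<open>\<gamma>\<close>.\<close>

theorem eps_optimal_state_input_distr:
  assumes k: "k < N" and \<mu>: "\<mu> \<in> prob_measures (borel_of (X k))" and \<rho>: "refs_prob k \<rho>"
    and \<epsilon>: "(0::real) \<le> \<epsilon>"
    and u: "u \<in> borel_of (X k) \<Otimes>\<^sub>M refs k \<rightarrow>\<^sub>M borel_of (U k)"
    and u_opt: "eps_optimal_input_map (\<epsilon> / 2) N X U R f g gN k u"
    and \<gamma>_opt: "eps_optimal_plan (\<epsilon> / 2) (ground k) \<mu> {k..N} \<rho> \<gamma>"
  shows "eps_optimal_state_input \<epsilon> N X U f g gN k \<mu> \<rho>
    (distr \<gamma> (borel_of (X k) \<Otimes>\<^sub>M borel_of (U k)) (\<lambda>(x, r). (x, u (x, r))))"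
proof -
  note f [OF k, measurable] g [OF k, measurable] u [measurable]
  note sets_\<rho> = refs_prob_sets[OF \<rho>]
  let ?X' = "borel_of (X (Suc k))"
  let ?XU = "borel_of (X k) \<Otimes>\<^sub>M borel_of (U k)"
  have sets_\<rho>k: "sets (\<rho> k) = sets (borel_of (R k))"
    by (rule sets_\<rho>(1)) (use k in auto)
  note sets_\<mu> [measurable_cong] = prob_measuresD(1)[OF \<mu>]
  have "\<gamma> \<in> multi_couplings \<mu> {k..N} \<rho>"
    using \<gamma>_opt by (simp add: eps_optimal_plan_def)
  then have sets_\<gamma>: "sets \<gamma> = sets (\<mu> \<Otimes>\<^sub>M Pi\<^sub>M {k..N} \<rho>)" and "prob_space \<gamma>"
    and \<gamma>_fst: "distr \<gamma> \<mu> fst = \<mu>"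
    and \<gamma>_ref: "\<And>i. i \<in> {k..N} \<Longrightarrow> distr \<gamma> (\<rho> i) (\<lambda>z. snd z i) = \<rho> i"
    by (auto simp: multi_couplings_def space_prob_algebra case_prod_unfold)
  interpret \<gamma>: prob_space \<gamma> by fact
  have sets_\<gamma>' [measurable_cong]: "sets \<gamma> = sets (borel_of (X k) \<Otimes>\<^sub>M refs k)"
    unfolding sets_\<gamma> by (intro sets_pair_measure_cong sets_\<mu> sets_\<rho>)
  have comp: "(\<lambda>z. snd z i) \<in> \<gamma> \<rightarrow>\<^sub>M \<rho> i" if "i \<in> {k..N}" for i
    unfolding measurable_cong_sets[OF refl sets_\<rho>(1)[OF that]] using that by measurable
  let ?S = "\<lambda>z. (fst z, u z)"
  have S: "?S \<in> \<gamma> \<rightarrow>\<^sub>M ?XU" by measurable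
  define \<Lambda> where "\<Lambda> = distr \<gamma> ?XU ?S"
  have sets_\<Lambda> [measurable_cong]: "sets \<Lambda> = sets ?XU" by (simp add: \<Lambda>_def)
  have \<Lambda>: "\<Lambda> \<in> state_input_measures (X k) (U k) \<mu>"
    unfolding state_input_measures_def
  proof (intro CollectI conjI)
    show "\<Lambda> \<in> prob_measures ?XU" using \<gamma>.prob_space_distr[OF S] by (simp add: \<Lambda>_def space_prob_algebra)
    have "distr \<Lambda> (borel_of (X k)) fst = distr \<gamma> (borel_of (X k)) fst"
      unfolding \<Lambda>_def by (rule distr_distr_cong[OF S]) auto
    also have "\<dots> = distr \<gamma> \<mu> fst" by (rule distr_cong) (auto simp: sets_\<mu>)
    finally show "distr \<Lambda> (borel_of (X k)) fst = \<mu>" by (simp add: \<gamma>_fst)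
  qed
  let ?A = "\<lambda>z. (?S z, snd z k)"
  have A: "?A \<in> \<gamma> \<rightarrow>\<^sub>M \<Lambda> \<Otimes>\<^sub>M \<rho> k"
    using S comp[of k] k by (intro measurable_Pair) (auto simp: measurable_cong_sets[OF refl sets_\<Lambda>])
  have g_A: "g k \<in> borel_measurable (\<Lambda> \<Otimes>\<^sub>M \<rho> k)"
    using g[OF k] by (simp add: measurable_cong_sets[OF sets_pair_measure_cong[OF sets_\<Lambda> sets_\<rho>k] refl])
  have "distr \<gamma> (\<Lambda> \<Otimes>\<^sub>M \<rho> k) ?A \<in> couplings \<Lambda> (\<rho> k)"
    unfolding couplings_def
  proof (intro CollectI conjI)
    show "distr \<gamma> (\<Lambda> \<Otimes>\<^sub>M \<rho> k) ?A \<in> prob_measures (\<Lambda> \<Otimes>\<^sub>M \<rho> k)"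
      using \<gamma>.prob_space_distr[OF A] by (simp add: space_prob_algebra)
    have "distr (distr \<gamma> (\<Lambda> \<Otimes>\<^sub>M \<rho> k) ?A) \<Lambda> fst = distr \<gamma> \<Lambda> ?S"
      by (rule distr_distr_cong[OF A]) auto
    also have "\<dots> = \<Lambda>" by (subst (2) \<Lambda>_def) (rule distr_cong, auto simp: sets_\<Lambda>)
    finally show "distr (distr \<gamma> (\<Lambda> \<Otimes>\<^sub>M \<rho> k) ?A) \<Lambda> fst = \<Lambda>" .
    have "distr (distr \<gamma> (\<Lambda> \<Otimes>\<^sub>M \<rho> k) ?A) (\<rho> k) snd = distr \<gamma> (\<rho> k) (\<lambda>z. snd z k)"
      by (rule distr_distr_cong[OF A]) auto
    then show "distr (distr \<gamma> (\<Lambda> \<Otimes>\<^sub>M \<rho> k) ?A) (\<rho> k) snd = \<rho> k" using k by (simp add: \<gamma>_ref)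
  qed
  then have "transport_cost (g k) \<Lambda> (\<rho> k) \<le> (\<integral>\<^sup>+z. g k z \<partial>distr \<gamma> (\<Lambda> \<Otimes>\<^sub>M \<rho> k) ?A)"
    unfolding transport_cost_def plan_cost_eq[symmetric] by (rule INF_lower)
  also have "\<dots> = (\<integral>\<^sup>+z. g k (?A z) \<partial>\<gamma>)" by (rule nn_integral_distr[OF A]) (simp add: g_A)
  finally have le_A: "transport_cost (g k) \<Lambda> (\<rho> k) \<le> (\<integral>\<^sup>+z. g k (?A z) \<partial>\<gamma>)" .
  let ?\<mu>' = "distr \<Lambda> ?X' (f k)"
  have \<mu>': "?\<mu>' \<in> prob_measures ?X'" by (rule distr_dynamics_prob[OF k \<Lambda>])
  let ?B = "\<lambda>z. (f k (?S z), restrict (snd z) {Suc k..N})"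
  let ?L = "?\<mu>' \<Otimes>\<^sub>M Pi\<^sub>M {Suc k..N} \<rho>"
  have "(\<lambda>r. restrict r {Suc k..N}) \<in> refs k \<rightarrow>\<^sub>M refs (Suc k)"
    by (rule measurable_restrict_subset) auto
  then have "?B \<in> \<gamma> \<rightarrow>\<^sub>M ?X' \<Otimes>\<^sub>M refs (Suc k)" by measurable
  moreover have sets_L: "sets ?L = sets (?X' \<Otimes>\<^sub>M refs (Suc k))"
    using refs_prob_sets(2)[OF refs_prob_Suc[OF \<rho>]] by (intro sets_pair_measure_cong) simp_all
  ultimately have B: "?B \<in> \<gamma> \<rightarrow>\<^sub>M ?L" by (simp only: measurable_cong_sets[OF refl sets_L])
  have "distr \<gamma> ?L ?B \<in> multi_couplings ?\<mu>' {Suc k..N} \<rho>"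
    unfolding multi_couplings_def
  proof (intro CollectI conjI ballI)
    show "distr \<gamma> ?L ?B \<in> prob_measures ?L"
      using \<gamma>.prob_space_distr[OF B] by (simp add: space_prob_algebra)
    have "distr (distr \<gamma> ?L ?B) ?\<mu>' fst = distr \<gamma> ?\<mu>' (\<lambda>z. f k (?S z))"
      by (rule distr_distr_cong[OF B]) auto
    also have "\<dots> = distr \<gamma> ?X' (\<lambda>z. f k (?S z))" by (rule distr_cong) auto
    also have "\<dots> = ?\<mu>'" unfolding \<Lambda>_def by (rule distr_distr_cong[symmetric, OF S]) auto
    finally show "distr (distr \<gamma> ?L ?B) ?\<mu>' fst = ?\<mu>'" .
    fix i assume i: "i \<in> {Suc k..N}"
    have "distr (distr \<gamma> ?L ?B) (\<rho> i) (\<lambda>(x, r). r i) = distr \<gamma> (\<rho> i) (\<lambda>z. snd z i)"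
      by (rule distr_distr_cong[OF B]) (use i in auto)
    then show "distr (distr \<gamma> ?L ?B) (\<rho> i) (\<lambda>(x, r). r i) = \<rho> i"
      using \<gamma>_ref[of i] i by simp
  qed
  then have "prob_cost (Suc k) ?\<mu>' \<rho> \<le> plan_cost (ground (Suc k)) (distr \<gamma> ?L ?B)"
    using k unfolding prob_cost_eq_multi_transport_cost[OF Suc_leI[OF k] \<mu>' refs_prob_Suc[OF \<rho>]]
      multi_transport_cost_def by (intro INF_lower)
  also have "\<dots> \<le> (\<integral>\<^sup>+z. ground (Suc k) (?B z) \<partial>\<gamma>)"
    unfolding plan_cost_eq by (rule nn_integral_distr_le[OF B])
  finally have "transport_cost (g k) \<Lambda> (\<rho> k) + prob_cost (Suc k) ?\<mu>' \<rho> \<le>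
      (\<integral>\<^sup>+z. g k (?A z) \<partial>\<gamma>) + (\<integral>\<^sup>+z. ground (Suc k) (?B z) \<partial>\<gamma>)"
    by (intro add_mono le_A)
  also have "\<dots> \<le> (\<integral>\<^sup>+z. g k (?A z) + ground (Suc k) (?B z) \<partial>\<gamma>)"
    by (rule nn_integral_superadditive)
  \<comment> \<open>Near-optimality of \<open>u\<close> holds at every point of the product, and
    that is the space of \<open>\<gamma>\<close>, so the estimate is pointwise with no exceptional
    set.\<close>
  also have "\<dots> \<le> (\<integral>\<^sup>+z. ground k z + ennreal (\<epsilon> / 2) \<partial>\<gamma>)"
  proof (rule nn_integral_mono)
    fix z assume "z \<in> space \<gamma>"
    then have "fst z \<in> topspace (X k)" "snd z \<in> (\<Pi>\<^sub>E i\<in>{k..N}. topspace (R i))"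
      by (auto simp: sets_eq_imp_space_eq[OF sets_\<gamma>'] space_pair_measure space_PiM)
    with u_opt show "g k (?A z) + ground (Suc k) (?B z) \<le> ground k z + ennreal (\<epsilon> / 2)"
      unfolding eps_optimal_input_map_def by (metis prod.collapse)
  qed
  also have "\<dots> \<le> plan_cost (ground k) \<gamma> + ennreal (\<epsilon> / 2)"
    unfolding plan_cost_eq by (rule nn_integral_add_const_le[OF \<gamma>.prob_space_axioms]) simp
  also have "\<dots> \<le> (multi_transport_cost (ground k) \<mu> {k..N} \<rho> + ennreal (\<epsilon> / 2)) + ennreal (\<epsilon> / 2)"
    using \<gamma>_opt by (intro add_right_mono) (simp add: eps_optimal_plan_def)
  also have "\<dots> = prob_cost k \<mu> \<rho> + ennreal \<epsilon>"
    using \<epsilon> k by (simp add: prob_cost_eq_multi_transport_cost[OF _ \<mu> \<rho>] add.assoc flip: ennreal_plus)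
  finally show ?thesis
    using \<Lambda> unfolding eps_optimal_state_input_def \<Lambda>_def by (simp add: case_prod_unfold)
qed

end

theorem theorem4p1:
  fixes N :: nat
    and X :: "nat \<Rightarrow> 'x topology"
    and U :: "nat \<Rightarrow> 'u topology"
    and R :: "nat \<Rightarrow> 'r topology"
    and f :: "nat \<Rightarrow> 'x \<times> 'u \<Rightarrow> 'x"
    and g :: "nat \<Rightarrow> ('x \<times> 'u) \<times> 'r \<Rightarrow> ennreal"
    and gN :: "'x \<times> 'r \<Rightarrow> ennreal"
  assumes N: "N \<ge> 1"
    and X: "\<And>k. k \<le> N \<Longrightarrow> polish_topology (X k)"
    and U: "\<And>k. k < N \<Longrightarrow> polish_topology (U k)"
    and R: "\<And>k. k \<le> N \<Longrightarrow> polish_topology (R k)"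
    and f: "\<And>k. k < N \<Longrightarrow>
      f k \<in> borel_of (X k) \<Otimes>\<^sub>M borel_of (U k) \<rightarrow>\<^sub>M borel_of (X (Suc k))"
    and g: "\<And>k. k < N \<Longrightarrow>
      g k \<in> borel_measurable ((borel_of (X k) \<Otimes>\<^sub>M borel_of (U k)) \<Otimes>\<^sub>M borel_of (R k))"
    and gN: "gN \<in> borel_measurable (borel_of (X N) \<Otimes>\<^sub>M borel_of (R N))"
  shows
    \<comment> \<open>(i)\<close>
    "(\<forall>k\<le>N. \<forall>\<mu>\<in>prob_measures (borel_of (X k)). \<forall>\<rho>.
        (\<forall>i\<in>{k..N}. \<rho> i \<in> prob_measures (borel_of (R i))) \<longrightarrow>
        prob_cost_to_go N X U f g gN k \<mu> \<rho> =
          multi_transport_cost (ground_cost_to_go N U f g gN k) \<mu> {k..N} \<rho>)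
    \<and>
    (\<forall>\<mu>\<in>prob_measures (borel_of (X 0)). \<forall>\<rho>.
        (\<forall>i\<in>{0..N}. \<rho> i \<in> prob_measures (borel_of (R i))) \<longrightarrow>
        control_value N X U f g gN \<mu> \<rho> = prob_cost_to_go N X U f g gN 0 \<mu> \<rho>)
    \<and>
    \<comment> \<open>(ii) and (iii)\<close>
    (\<forall>k<N. \<forall>\<mu>\<in>prob_measures (borel_of (X k)). \<forall>\<rho>. \<forall>\<epsilon>::real. \<forall>u \<gamma> \<Lambda>.
        (\<forall>i\<in>{k..N}. \<rho> i \<in> prob_measures (borel_of (R i))) \<longrightarrow>
        \<epsilon> \<ge> 0 \<longrightarrow>
        u \<in> borel_of (X k) \<Otimes>\<^sub>M ref_space N R k \<rightarrow>\<^sub>M borel_of (U k) \<longrightarrow>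
        eps_optimal_input_map (\<epsilon> / 2) N X U R f g gN k u \<longrightarrow>
        eps_optimal_plan (\<epsilon> / 2) (ground_cost_to_go N U f g gN k) \<mu> {k..N} \<rho> \<gamma> \<longrightarrow>
        \<Lambda> = distr \<gamma> (borel_of (X k) \<Otimes>\<^sub>M borel_of (U k)) (\<lambda>(x, r). (x, u (x, r))) \<longrightarrow>
        eps_optimal_state_input \<epsilon> N X U f g gN k \<mu> \<rho> \<Lambda> \<and>
        (\<epsilon> = 0 \<longrightarrow> optimal_state_input N X U f g gN k \<mu> \<rho> \<Lambda>) \<and>
        (\<forall>T. T \<in> borel_of (X k) \<rightarrow>\<^sub>M ref_space N R k \<longrightarrow>
          \<gamma> = distr \<mu> (borel_of (X k) \<Otimes>\<^sub>M ref_space N R k) (\<lambda>x. (x, T x)) \<longrightarrow>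
          \<Lambda> = distr \<mu> (borel_of (X k) \<Otimes>\<^sub>M borel_of (U k)) (\<lambda>x. (x, u (x, T x)))))"
proof -
  interpret control_problem N X U R f g gN
    by unfold_locales (use X U R f g gN in auto)
  \<comment> \<open>Pushing \<open>\<mu>\<close> forward to the graph of \<open>T\<close> and then
    applying the input map is a single pushforward.\<close>
  have III: "distr \<gamma> (borel_of (X k) \<Otimes>\<^sub>M borel_of (U k)) (\<lambda>(x, r). (x, u (x, r))) =
      distr \<mu> (borel_of (X k) \<Otimes>\<^sub>M borel_of (U k)) (\<lambda>x. (x, u (x, T x)))"
    if \<mu>: "\<mu> \<in> prob_measures (borel_of (X k))"
      and [measurable]: "u \<in> borel_of (X k) \<Otimes>\<^sub>M ref_space N R k \<rightarrow>\<^sub>M borel_of (U k)"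
        "T \<in> borel_of (X k) \<rightarrow>\<^sub>M ref_space N R k"
      and \<gamma>: "\<gamma> = distr \<mu> (borel_of (X k) \<Otimes>\<^sub>M ref_space N R k) (\<lambda>x. (x, T x))"
    for k \<mu> u T \<gamma>
  proof -
    note [measurable_cong] = prob_measuresD(1)[OF \<mu>]
    have "(\<lambda>x. (x, T x)) \<in> \<mu> \<rightarrow>\<^sub>M borel_of (X k) \<Otimes>\<^sub>M ref_space N R k"
      "(\<lambda>(x, r). (x, u (x, r))) \<in> borel_of (X k) \<Otimes>\<^sub>M ref_space N R k \<rightarrow>\<^sub>M borel_of (X k) \<Otimes>\<^sub>M borel_of (U k)"
      by measurable
    then show ?thesis unfolding \<gamma> by (rule distr_distr_cong) simp
  qed
  show ?thesis
  proof (intro conjI)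
    show "\<forall>k\<le>N. \<forall>\<mu>\<in>prob_measures (borel_of (X k)). \<forall>\<rho>.
        (\<forall>i\<in>{k..N}. \<rho> i \<in> prob_measures (borel_of (R i))) \<longrightarrow>
        prob_cost_to_go N X U f g gN k \<mu> \<rho> =
          multi_transport_cost (ground_cost_to_go N U f g gN k) \<mu> {k..N} \<rho>"
      by (intro allI ballI impI prob_cost_eq_multi_transport_cost) (auto simp: refs_prob_def)
    show "\<forall>\<mu>\<in>prob_measures (borel_of (X 0)). \<forall>\<rho>.
        (\<forall>i\<in>{0..N}. \<rho> i \<in> prob_measures (borel_of (R i))) \<longrightarrow>
        control_value N X U f g gN \<mu> \<rho> = prob_cost_to_go N X U f g gN 0 \<mu> \<rho>"
      by (intro allI ballI impI control_value_eq_prob_cost)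
  next
    have II: "eps_optimal_state_input \<epsilon> N X U f g gN k \<mu> \<rho> \<Lambda>"
      if "k < N" "\<mu> \<in> prob_measures (borel_of (X k))"
        "\<forall>i\<in>{k..N}. \<rho> i \<in> prob_measures (borel_of (R i))" "\<epsilon> \<ge> 0"
        "u \<in> borel_of (X k) \<Otimes>\<^sub>M ref_space N R k \<rightarrow>\<^sub>M borel_of (U k)"
        "eps_optimal_input_map (\<epsilon> / 2) N X U R f g gN k u"
        "eps_optimal_plan (\<epsilon> / 2) (ground_cost_to_go N U f g gN k) \<mu> {k..N} \<rho> \<gamma>"
        "\<Lambda> = distr \<gamma> (borel_of (X k) \<Otimes>\<^sub>M borel_of (U k)) (\<lambda>(x, r). (x, u (x, r)))"
      for k \<mu> \<rho> \<epsilon> u \<gamma> \<Lambda>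
      unfolding that(8) using that(1-7)
      by (intro eps_optimal_state_input_distr) (simp_all add: refs_prob_def ref_space_def)
    show "\<forall>k<N. \<forall>\<mu>\<in>prob_measures (borel_of (X k)). \<forall>\<rho>. \<forall>\<epsilon>::real. \<forall>u \<gamma> \<Lambda>.
        (\<forall>i\<in>{k..N}. \<rho> i \<in> prob_measures (borel_of (R i))) \<longrightarrow>
        \<epsilon> \<ge> 0 \<longrightarrow>
        u \<in> borel_of (X k) \<Otimes>\<^sub>M ref_space N R k \<rightarrow>\<^sub>M borel_of (U k) \<longrightarrow>
        eps_optimal_input_map (\<epsilon> / 2) N X U R f g gN k u \<longrightarrow>
        eps_optimal_plan (\<epsilon> / 2) (ground_cost_to_go N U f g gN k) \<mu> {k..N} \<rho> \<gamma> \<longrightarrow>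
        \<Lambda> = distr \<gamma> (borel_of (X k) \<Otimes>\<^sub>M borel_of (U k)) (\<lambda>(x, r). (x, u (x, r))) \<longrightarrow>
        eps_optimal_state_input \<epsilon> N X U f g gN k \<mu> \<rho> \<Lambda> \<and>
        (\<epsilon> = 0 \<longrightarrow> optimal_state_input N X U f g gN k \<mu> \<rho> \<Lambda>) \<and>
        (\<forall>T. T \<in> borel_of (X k) \<rightarrow>\<^sub>M ref_space N R k \<longrightarrow>
          \<gamma> = distr \<mu> (borel_of (X k) \<Otimes>\<^sub>M ref_space N R k) (\<lambda>x. (x, T x)) \<longrightarrow>
          \<Lambda> = distr \<mu> (borel_of (X k) \<Otimes>\<^sub>M borel_of (U k)) (\<lambda>x. (x, u (x, T x))))"
    proof (intro allI ballI impI)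
      fix k \<mu> \<rho> \<epsilon> u \<gamma> \<Lambda>
      assume *: "k < N" "\<mu> \<in> prob_measures (borel_of (X k))"
        "\<forall>i\<in>{k..N}. \<rho> i \<in> prob_measures (borel_of (R i))" "(\<epsilon>::real) \<ge> 0"
        "u \<in> borel_of (X k) \<Otimes>\<^sub>M ref_space N R k \<rightarrow>\<^sub>M borel_of (U k)"
        "eps_optimal_input_map (\<epsilon> / 2) N X U R f g gN k u"
        "eps_optimal_plan (\<epsilon> / 2) (ground_cost_to_go N U f g gN k) \<mu> {k..N} \<rho> \<gamma>"
        "\<Lambda> = distr \<gamma> (borel_of (X k) \<Otimes>\<^sub>M borel_of (U k)) (\<lambda>(x, r). (x, u (x, r)))"
      show "eps_optimal_state_input \<epsilon> N X U f g gN k \<mu> \<rho> \<Lambda> \<and>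
        (\<epsilon> = 0 \<longrightarrow> optimal_state_input N X U f g gN k \<mu> \<rho> \<Lambda>) \<and>
        (\<forall>T. T \<in> borel_of (X k) \<rightarrow>\<^sub>M ref_space N R k \<longrightarrow>
          \<gamma> = distr \<mu> (borel_of (X k) \<Otimes>\<^sub>M ref_space N R k) (\<lambda>x. (x, T x)) \<longrightarrow>
          \<Lambda> = distr \<mu> (borel_of (X k) \<Otimes>\<^sub>M borel_of (U k)) (\<lambda>x. (x, u (x, T x))))"
      proof (intro conjI allI impI)
        show 1: "eps_optimal_state_input \<epsilon> N X U f g gN k \<mu> \<rho> \<Lambda>" by (rule II[OF *])
        show "optimal_state_input N X U f g gN k \<mu> \<rho> \<Lambda>" if "\<epsilon> = 0" using 1 that by simp
        fix T assume "T \<in> borel_of (X k) \<rightarrow>\<^sub>M ref_space N R k"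
          "\<gamma> = distr \<mu> (borel_of (X k) \<Otimes>\<^sub>M ref_space N R k) (\<lambda>x. (x, T x))"
        then show "\<Lambda> = distr \<mu> (borel_of (X k) \<Otimes>\<^sub>M borel_of (U k)) (\<lambda>x. (x, u (x, T x)))"
          unfolding *(8) by (rule III[OF *(2,5)])
      qed
    qed
  qed
qed

end
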